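(* Let $n\ge2$, let $\Omega\subset\mathbb R^n$ be a bounded domain with smooth boundary, $c\in\mathbb R$, and let $u$ be a smooth function on $\overline\Omega$ with $|Du|<1$ satisfying $$\mathrm{div}\Big(\frac{Du}{w}\Big)=n\ \text{ in }\Omega,\qquad u=c\ \text{ on }\partial\Omega,\qquad w=\sqrt{1-|Du|^2}.$$ Let $R_0=\frac{n|\Omega|}{|\partial\Omega|}$ and $H_0=\frac1{R_0}$. Then $$\frac1{n-1}\int_\Omega\Big(\frac{n-1}{n}S_1^2-2S_2\Big)dx+\frac1{R_0}\int_{\partial\Omega}\Big(\frac{|Du|}{w}-R_0\Big)^2d\sigma_x=\int_{\partial\Omega}(H_0-H_{\partial\Omega})\Big(\frac{|Du|}{w}\Big)^2d\sigma_x .$$ Furthermore, if the mean curvature $H_{\partial\Omega}$ of $\partial\Omega$ satisfies $H_{\partial\Omega}\ge H_0$ on $\partial\Omega$, then $\Omega$ is a ball. In particular, the same conclusion holds if $H_{\partial\Omega}$ equals some constant on $\partial\Omega$.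
   Context: $S_1$ and $S_2$ are the first and second elementary symmetric functions of the eigenvalues of the matrix $A=(h_i^j)$, $h_i^j=D_i(u_j/w)$ (the shape operator of the space-like graph of $u$ in Minkowski space $\mathbb R^{n,1}$). $H_{\partial\Omega}$ is the arithmetic mean of the principal curvatures of $\partial\Omega$, positive for balls. $|\Omega|$ and $|\partial\Omega|$ are the volume of $\Omega$ and the $(n-1)$-dimensional measure of $\partial\Omega$; $d\sigma_x$ is the surface measure. *)

theory Defs
  imports "HOL-Analysis.Analysis" "HOL-Computational_Algebra.Polynomial"
begin

section \<open>Differential operators and smoothness\<close>

definition partial_deriv :: "'n \<Rightarrow> (real^'n \<Rightarrow> real) \<Rightarrow> real^'n \<Rightarrow> real" where
  "partial_deriv i f x = frechet_derivative f (at x) (axis i 1)"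

definition grad :: "(real^'n \<Rightarrow> real) \<Rightarrow> real^'n \<Rightarrow> real^'n" where
  "grad f x = (\<chi> i. partial_deriv i f x)"

definition divergence :: "(real^'n \<Rightarrow> real^'n) \<Rightarrow> real^'n \<Rightarrow> real" where
  "divergence F x = (\<Sum>i\<in>UNIV. partial_deriv i (\<lambda>y. F y $ i) x)"

text \<open>Meant for open sets only, since \<^const>\<open>partial_deriv\<close> uses two-sided derivatives.\<close>

primrec Ck_on :: "nat \<Rightarrow> (real^'n) set \<Rightarrow> (real^'n \<Rightarrow> real) \<Rightarrow> bool" where
  "Ck_on 0 U f \<longleftrightarrow> continuous_on U f"
| "Ck_on (Suc k) U f \<longleftrightarrow> f differentiable_on U \<and> (\<forall>i. Ck_on k U (partial_deriv i f))"

text \<open>Smoothness on an arbitrary set (here: on the closure of a domain) means smoothness on an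
  open neighbourhood of that set. In particular the derivatives at boundary points of a domain
  with smooth boundary are determined by the values of \<open>f\<close> on the closure.\<close>

definition smooth_on :: "(real^'n) set \<Rightarrow> (real^'n \<Rightarrow> real) \<Rightarrow> bool" where
  "smooth_on S f \<longleftrightarrow> (\<exists>V. open V \<and> S \<subseteq> V \<and> (\<forall>k. Ck_on k V f))"


section \<open>Domains with smooth boundary\<close>

text \<open>Smooth functions of the \<open>n - 1\<close> coordinates other than the \<open>i\<close>-th one are represented as
  smooth functions on all of \<open>\<real>\<^sup>n\<close> which do not depend on the \<open>i\<close>-th coordinate; the gradient of
  such a function has vanishing \<open>i\<close>-th component.\<close>

definition smooth_height :: "'n \<Rightarrow> (real^'n \<Rightarrow> real) \<Rightarrow> bool" where
  "smooth_height i \<gamma> \<longleftrightarrow> smooth_on UNIV \<gamma> \<and> (\<forall>x t. \<gamma> (x + t *\<^sub>R axis i 1) = \<gamma> x)"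

text \<open>Up to the choice of a coordinate axis \<open>i\<close> and its orientation \<open>s\<close>, the set \<open>\<Omega>\<close> is locally
  the region strictly on one side of the graph of a smooth function.\<close>

definition smooth_boundary :: "(real^'n) set \<Rightarrow> bool" where
  "smooth_boundary \<Omega> \<longleftrightarrow>
     (\<forall>p\<in>frontier \<Omega>. \<exists>r>0. \<exists>i. \<exists>s\<in>{1, -1}. \<exists>\<gamma>. smooth_height i \<gamma> \<and>
        \<Omega> \<inter> ball p r = {x \<in> ball p r. s * (x $ i) > s * \<gamma> x})"

definition bounded_smooth_domain :: "(real^'n) set \<Rightarrow> bool" where
  "bounded_smooth_domain \<Omega> \<longleftrightarrow>
     open \<Omega> \<and> connected \<Omega> \<and> \<Omega> \<noteq> {} \<and> bounded \<Omega> \<and> smooth_boundary \<Omega>"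


section \<open>Surface measure\<close>

definition graph_patch :: "(real^'n) set \<Rightarrow> 'n \<Rightarrow> (real^'n) set \<Rightarrow> (real^'n \<Rightarrow> real) \<Rightarrow> bool" where
  "graph_patch S i W \<gamma> \<longleftrightarrow>
     open W \<and> smooth_height i \<gamma> \<and> S \<inter> W = {x \<in> W. x $ i = \<gamma> x}"

text \<open>\<open>hyper i z\<close> is the point of the coordinate hyperplane \<open>x\<^sub>i = 0\<close> with the remaining
  coordinates \<open>z\<close>; the \<open>(n-1)\<close>-dimensional Lebesgue measure on that hyperplane is the product
  measure over the index set \<open>UNIV - {i}\<close>.\<close>

definition hyper :: "'n \<Rightarrow> ('n \<Rightarrow> real) \<Rightarrow> real^'n" where
  "hyper i z = (\<chi> j. if j = i then 0 else z j)"

definition graph_point :: "'n \<Rightarrow> (real^'n \<Rightarrow> real) \<Rightarrow> ('n \<Rightarrow> real) \<Rightarrow> real^'n" where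
  "graph_point i \<gamma> z = hyper i z + \<gamma> (hyper i z) *\<^sub>R axis i 1"

text \<open>The surface measure of a smooth hypersurface \<open>S\<close>, as a Borel measure on \<open>\<real>\<^sup>n\<close> concentrated
  on \<open>S\<close>. It is the unique such measure which on every piece of \<open>S\<close> that is the graph of a smooth
  function \<open>\<gamma>\<close> over a coordinate hyperplane is given by \<open>d\<sigma> = sqrt (1 + |D\<gamma>|\<^sup>2) dz\<close>.\<close>

definition is_surface_measure :: "(real^'n) set \<Rightarrow> (real^'n) measure \<Rightarrow> bool" where
  "is_surface_measure S \<sigma> \<longleftrightarrow>
     sets \<sigma> = sets borel \<and> emeasure \<sigma> (- S) = 0 \<and>
     (\<forall>i W \<gamma> A. graph_patch S i W \<gamma> \<longrightarrow> A \<in> sets borel \<longrightarrow> A \<subseteq> S \<inter> W \<longrightarrow>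
        emeasure \<sigma> A =
          (\<integral>\<^sup>+ z. indicator A (graph_point i \<gamma> z)
                  * ennreal (sqrt (1 + (norm (grad \<gamma> (hyper i z)))\<^sup>2))
             \<partial>(Pi\<^sub>M (UNIV - {i}) (\<lambda>_. lborel))))"

definition surface_measure :: "(real^'n) set \<Rightarrow> (real^'n) measure" where
  "surface_measure S = (THE \<sigma>. is_surface_measure S \<sigma>)"


section \<open>Mean curvature of the boundary\<close>

text \<open>The limit condition expresses that \<open>\<nu>\<close> is orthogonal to the boundary at \<open>p\<close>, the last
  condition that it points out of \<open>\<Omega>\<close>.\<close>

definition outer_normal :: "(real^'n) set \<Rightarrow> real^'n \<Rightarrow> real^'n" where
  "outer_normal \<Omega> p = (THE \<nu>. norm \<nu> = 1 \<and>
     ((\<lambda>y. (\<nu> \<bullet> (y - p)) / norm (y - p)) \<longlongrightarrow> 0) (at p within frontier \<Omega>) \<and>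
     (\<forall>\<^sub>F t in at_right 0. p - t *\<^sub>R \<nu> \<in> \<Omega> \<and> p + t *\<^sub>R \<nu> \<notin> closure \<Omega>))"

text \<open>\<open>B\<close> is an orthonormal basis of the tangent hyperplane at \<open>p\<close> consisting of principal
  directions, i.e. eigenvectors of the differential \<open>L\<close> of the Gauss map along the boundary, and
  \<open>\<kappa> b\<close> is the principal curvature in direction \<open>b\<close>. A derivative within the boundary is only
  determined on tangent vectors, which is where \<open>L\<close> is used. With respect to the outer normal,
  the principal curvatures of a sphere of radius \<open>r\<close> are \<open>1 / r\<close>.\<close>

definition principal_curvature_frame ::
  "(real^'n) set \<Rightarrow> real^'n \<Rightarrow> (real^'n) set \<Rightarrow> (real^'n \<Rightarrow> real) \<Rightarrow> bool" where
  "principal_curvature_frame \<Omega> p B \<kappa> \<longleftrightarrow>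
     pairwise orthogonal B \<and> (\<forall>b\<in>B. norm b = 1) \<and>
     span B = {v. v \<bullet> outer_normal \<Omega> p = 0} \<and>
     (\<exists>L. (outer_normal \<Omega> has_derivative L) (at p within frontier \<Omega>) \<and>
          (\<forall>b\<in>B. L b = \<kappa> b *\<^sub>R b))"

definition mean_curvature :: "(real^'n) set \<Rightarrow> real^'n \<Rightarrow> real" where
  "mean_curvature \<Omega> p =
     (THE H. \<exists>B \<kappa>. principal_curvature_frame \<Omega> p B \<kappa> \<and>
                    H = (\<Sum>b\<in>B. \<kappa> b) / (real CARD('n) - 1))"


section \<open>Elementary symmetric functions of the eigenvalues of a matrix\<close>

definition charpoly :: "real^'n^'n \<Rightarrow> complex poly" where
  "charpoly A = det (\<chi> i j. (if i = j then [:0, 1:] else 0) - [:complex_of_real (A $ i $ j):])"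

text \<open>An enumeration of the complex eigenvalues with algebraic multiplicity.\<close>

definition eigenvalues :: "real^'n^'n \<Rightarrow> 'n \<Rightarrow> complex" where
  "eigenvalues A = (SOME l. charpoly A = (\<Prod>i\<in>UNIV. [:- l i, 1:]))"

text \<open>The symmetric functions of the eigenvalues of a real matrix are real, so that taking the
  real part only changes the type.\<close>

definition eig_sym :: "nat \<Rightarrow> real^'n^'n \<Rightarrow> real" where
  "eig_sym k A = Re (\<Sum>I | card I = k. \<Prod>i\<in>I. eigenvalues A i)"


section \<open>Space-like graphs in Minkowski space\<close>

definition w_fun :: "(real^'n \<Rightarrow> real) \<Rightarrow> real^'n \<Rightarrow> real" where
  "w_fun u x = sqrt (1 - (norm (grad u x))\<^sup>2)"

definition shape_matrix :: "(real^'n \<Rightarrow> real) \<Rightarrow> real^'n \<Rightarrow> real^'n^'n" where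
  "shape_matrix u x = (\<chi> i j. partial_deriv i (\<lambda>y. grad u y $ j / w_fun u y) x)"

end

theory Submission
  imports Defs "HOL-Computational_Algebra.Fundamental_Theorem_Algebra"
begin

text \<open>The proof rests on the vector field \<open>v = Du / w\<close>. Its Jacobian is the shape matrix \<open>A\<close>, so \<open>div v = S\<^sub>1 = n\<close>
  and \<open>2 S\<^sub>2 = n\<^sup>2 - tr A\<^sup>2\<close>; since \<open>u\<close> is constant on the boundary, \<open>v = q \<nu>\<close> there.

  The identity comes from two applications of the divergence theorem. The flux of \<open>v\<close> gives
  \<open>\<integral>\<^bsub>\<partial>\<Omega>\<^esub> q = n |\<Omega>|\<close>. For fields \<open>X\<close>, \<open>Y\<close> one has
  \<open>div (X div Y - D\<^sub>X Y) = div X div Y - tr (DX DY)\<close>, because the second derivatives commute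
  (\<open>divergence_newton_field\<close>). With \<open>X = Y = v\<close> the right-hand side is \<open>2 S\<^sub>2\<close>, and on the boundary the normal
  component of the field is \<open>(n - 1) H q\<^sup>2\<close>: the tangential divergence of a normal field \<open>q \<nu>\<close> only sees the
  curvature (\<open>tangential_divergence_normal_field\<close>). Expanding \<open>(q - R\<^sub>0)\<^sup>2\<close> gives the identity; that
  \<open>q\<close> equals \<open>|Du| / w\<close>, and not its negative, follows from the maximum principle \<open>u \<le> c\<close>.

  If \<open>H \<ge> H\<^sub>0\<close>, the right-hand side of the identity is at most zero, whereas both terms on the left are at least
  zero: \<open>tr A\<^sup>2 \<ge> n\<close> because \<open>A\<close> is the product of a symmetric and a positive definite matrix
  (\<open>trace_square_shape\<close>). Hence \<open>A = I\<close> throughout \<open>\<Omega>\<close>, so \<open>v = x - a\<close>, the graph is a piece of a hyperboloid, and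
  the boundary condition puts \<open>\<partial>\<Omega>\<close> on a sphere around \<open>a\<close>. If \<open>H\<close> is a constant, Minkowski's formula
  \<open>|\<partial>\<Omega>| = \<integral>\<^bsub>\<partial>\<Omega>\<^esub> (x \<bullet> \<nu>) H\<close> forces \<open>H = H\<^sub>0\<close>. It is the same divergence identity for \<open>X = x\<close> and an extension
  \<open>Y\<close> of the normal.

  The following foundations carry this. The divergence theorem (\<open>divergence_theorem\<close>) is proved
  on one side of a graph by Fubini's theorem and a shear, and globalized with cut-off functions. The same local
  theorem shows that the measure of a graph does not depend on the coordinate hyperplane over which it is a graph:
  two charts give the same flux for every field, hence the same integral for every test function
  (\<open>graph_measure_test_function\<close>). Thus the surface measure exists. Finally, the mean curvature is well defined
  because the derivative of the normal is self-adjoint on tangent vectors and therefore has an orthonormal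
  eigenbasis (\<open>shape_operator_frame\<close>), and its trace does not depend on that basis. The symmetric functions
  \<open>S\<^sub>1\<close>, \<open>S\<^sub>2\<close> are related to traces through the first-order term of \<open>det (I - t A)\<close>.\<close>


section \<open>Calculus of partial derivatives\<close>

lemma partial_deriv_eq:
  "(f has_derivative D) (at x) \<Longrightarrow> partial_deriv i f x = D (axis i 1)"
  by (simp add: partial_deriv_def frechet_derivative_at[symmetric])

lemma linear_eq_inner:
  fixes D :: "real^'n \<Rightarrow> real"
  assumes "linear D"
  shows "D h = (\<chi> i. D (axis i 1)) \<bullet> h"
proof -
  have "D h = D (\<Sum>i\<in>UNIV. (h$i) *\<^sub>R axis i 1)"
    using basis_expansion[of h] by (simp add: scalar_mult_eq_scaleR)
  also have "\<dots> = (\<Sum>i\<in>UNIV. h$i * D (axis i 1))"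
    using assms by (simp add: linear_sum linear_scale)
  finally show ?thesis by (simp add: inner_vec_def mult.commute)
qed

lemma has_derivative_grad:
  fixes f :: "real^'n \<Rightarrow> real"
  assumes "f differentiable (at x)"
  shows "(f has_derivative (\<lambda>h. grad f x \<bullet> h)) (at x)"
proof -
  have d: "(f has_derivative frechet_derivative f (at x)) (at x)"
    using assms frechet_derivative_works by blast
  have "frechet_derivative f (at x) = (\<lambda>h. grad f x \<bullet> h)"
    unfolding grad_def partial_deriv_def
    using linear_eq_inner[OF has_derivative_linear[OF d]] by (rule ext)
  then show ?thesis using d by simp
qed

lemma grad_nth [simp]: "grad f x $ i = partial_deriv i f x"
  by (simp add: grad_def)

lemma grad_eqI:
  fixes f :: "real^'n \<Rightarrow> real"
  assumes "(f has_derivative (\<lambda>h. v \<bullet> h)) (at x)"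
  shows "grad f x = v"
  by (simp add: vec_eq_iff partial_deriv_eq[OF assms] inner_axis)

lemma partial_deriv_cong:
  assumes "open U" "x \<in> U" "\<And>y. y \<in> U \<Longrightarrow> f y = g y"
  shows "partial_deriv i f x = partial_deriv i g x"
proof -
  have "(f has_derivative D) (at x) \<longleftrightarrow> (g has_derivative D) (at x)" for D
    using assms has_derivative_transform_within_open by (metis (no_types, lifting))
  then show ?thesis unfolding partial_deriv_def frechet_derivative_def by simp
qed

lemma Ck_on_cong:
  assumes "open U" "Ck_on k U f" "\<And>y. y \<in> U \<Longrightarrow> f y = g y"
  shows "Ck_on k U g"
  using assms(2,3)
proof (induction k arbitrary: f g)
  case 0
  then show ?case using continuous_on_cong by force
next
  case (Suc k)
  have "partial_deriv i f y = partial_deriv i g y" if "y \<in> U" for y i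
    using partial_deriv_cong[OF assms(1) that] Suc.prems(2) by blast
  moreover have "g differentiable_on U"
    using Suc.prems has_derivative_transform[of _ U g f]
    by (auto simp: differentiable_on_def differentiable_def) metis
  ultimately show ?case using Suc by (metis Ck_on.simps(2))
qed

lemma Ck_on_subset: "Ck_on k U f \<Longrightarrow> V \<subseteq> U \<Longrightarrow> Ck_on k V f"
  by (induction k arbitrary: f) (auto intro: continuous_on_subset differentiable_on_subset)

lemma Ck_on_Suc_imp: "Ck_on (Suc k) U f \<Longrightarrow> Ck_on k U f"
  by (induction k arbitrary: f) (auto intro: differentiable_imp_continuous_on)

lemma Ck_on_le: "Ck_on k U f \<Longrightarrow> l \<le> k \<Longrightarrow> Ck_on l U f"
  by (induction k arbitrary: l) (auto simp: le_Suc_eq dest: Ck_on_Suc_imp simp del: Ck_on.simps)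

lemma Ck_on_continuous: "Ck_on k U f \<Longrightarrow> continuous_on U f"
  using Ck_on_le[of k U f 0] by simp

lemma Ck_on_differentiable:
  "Ck_on (Suc k) U f \<Longrightarrow> open U \<Longrightarrow> x \<in> U \<Longrightarrow> f differentiable (at x)"
  by (simp add: differentiable_on_eq_differentiable_at)

lemma Ck_on_has_derivative:
  "Ck_on (Suc k) U f \<Longrightarrow> open U \<Longrightarrow> x \<in> U \<Longrightarrow> (f has_derivative (\<lambda>h. grad f x \<bullet> h)) (at x)"
  by (intro has_derivative_grad Ck_on_differentiable)

lemma Ck_on_partial: "Ck_on (Suc k) U f \<Longrightarrow> Ck_on k U (partial_deriv i f)"
  by simp

lemma Ck_on_SucI:
  assumes "open U" "\<And>x. x \<in> U \<Longrightarrow> (f has_derivative D x) (at x)"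
    and "\<And>i. Ck_on k U (\<lambda>x. D x (axis i 1))"
  shows "Ck_on (Suc k) U f"
proof -
  have "f differentiable_on U"
    using assms(1,2) by (auto simp: differentiable_on_eq_differentiable_at differentiable_def)
  moreover have "Ck_on k U (partial_deriv i f)" for i
    using partial_deriv_eq[OF assms(2)]
    by (intro Ck_on_cong[OF assms(1) assms(3)[of i]]) simp
  ultimately show ?thesis by simp
qed

lemma Ck_on_const [simp]: "open U \<Longrightarrow> Ck_on k U (\<lambda>x. a)"
proof (induction k arbitrary: a)
  case (Suc k)
  show ?case
    by (rule Ck_on_SucI[where D="\<lambda>x h. 0"]) (use Suc in auto)
qed simp

lemma Ck_on_linear:
  assumes "open U" "bounded_linear f"
  shows "Ck_on k U f"
proof (cases k)
  case 0 then show ?thesis using assms by (simp add: linear_continuous_on)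
next
  case (Suc l)
  show ?thesis unfolding Suc
    by (rule Ck_on_SucI[where D="\<lambda>x. f"])
       (use assms bounded_linear_imp_has_derivative in auto)
qed

lemma Ck_on_nth: "open U \<Longrightarrow> Ck_on k U (\<lambda>x. x $ i)"
  by (intro Ck_on_linear bounded_linear_vec_nth)

lemma Ck_on_add:
  assumes "open U" "Ck_on k U f" "Ck_on k U g"
  shows "Ck_on k U (\<lambda>x. f x + g x)"
  using assms(2,3)
proof (induction k arbitrary: f g)
  case 0 then show ?case by (auto intro: continuous_intros)
next
  case (Suc k)
  show ?case
    by (rule Ck_on_SucI[where D="\<lambda>x h. grad f x \<bullet> h + grad g x \<bullet> h"])
       (use Suc assms(1) Ck_on_has_derivative in
         \<open>auto intro!: has_derivative_add simp: inner_axis simp del: Ck_on.simps dest: Ck_on_partial\<close>)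
qed

lemma Ck_on_mult:
  assumes "open U" "Ck_on k U f" "Ck_on k U g"
  shows "Ck_on k U (\<lambda>x. f x * g x)"
  using assms(2,3)
proof (induction k arbitrary: f g)
  case 0 then show ?case by (auto intro: continuous_intros)
next
  case (Suc k)
  have "Ck_on k U f" "Ck_on k U g" using Suc.prems Ck_on_Suc_imp by blast+
  then have *: "Ck_on k U (\<lambda>x. f x * partial_deriv i g x + partial_deriv i f x * g x)" for i
    using Suc by (intro Ck_on_add[OF assms(1)] Suc.IH) auto
  show ?case
    by (rule Ck_on_SucI[where D="\<lambda>x h. f x * (grad g x \<bullet> h) + (grad f x \<bullet> h) * g x"])
       (use * Suc.prems assms(1) Ck_on_has_derivative in
         \<open>auto intro!: has_derivative_mult simp: inner_axis simp del: Ck_on.simps\<close>)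
qed

lemma Ck_on_uminus: "open U \<Longrightarrow> Ck_on k U f \<Longrightarrow> Ck_on k U (\<lambda>x. - f x)"
  using Ck_on_mult[of U k "\<lambda>x. -1" f] by simp

lemma Ck_on_diff: "open U \<Longrightarrow> Ck_on k U f \<Longrightarrow> Ck_on k U g \<Longrightarrow> Ck_on k U (\<lambda>x. f x - g x)"
  using Ck_on_add[of U k f "\<lambda>x. - g x"] Ck_on_uminus[of U k g] by simp

lemma Ck_on_sum:
  "open U \<Longrightarrow> (\<And>a. a \<in> A \<Longrightarrow> Ck_on k U (f a)) \<Longrightarrow> Ck_on k U (\<lambda>x. \<Sum>a\<in>A. f a x)"
  by (induction A rule: infinite_finite_induct) (auto intro!: Ck_on_add simp del: Ck_on.simps)

lemma Ck_on_prod: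
  "open U \<Longrightarrow> (\<And>a. a \<in> A \<Longrightarrow> Ck_on k U (f a)) \<Longrightarrow> Ck_on k U (\<lambda>x. \<Prod>a\<in>A. f a x)"
  by (induction A rule: infinite_finite_induct) (auto intro!: Ck_on_mult simp del: Ck_on.simps)

lemma Ck_on_inverse:
  assumes "open U" "Ck_on k U f" "\<And>x. x \<in> U \<Longrightarrow> f x \<noteq> 0"
  shows "Ck_on k U (\<lambda>x. inverse (f x))"
  using assms(2)
proof (induction k)
  case 0 then show ?case using assms(3) by (auto intro: continuous_intros)
next
  case (Suc k)
  have "Ck_on k U f" using Suc.prems Ck_on_Suc_imp by blast
  then have i: "Ck_on k U (\<lambda>x. inverse (f x))" using Suc.IH by blast
  have *: "Ck_on k U (\<lambda>x. - (inverse (f x) * partial_deriv i f x * inverse (f x)))" for i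
    using Suc.prems by (intro Ck_on_uminus Ck_on_mult i assms(1)) auto
  show ?case
    by (rule Ck_on_SucI[where D="\<lambda>x h. - (inverse (f x) * (grad f x \<bullet> h) * inverse (f x))"])
       (use * Suc.prems assms(1,3) Ck_on_has_derivative in
         \<open>auto intro!: Deriv.has_derivative_inverse simp: inner_axis simp del: Ck_on.simps\<close>)
qed

lemma Ck_on_sqrt:
  assumes "open U" "Ck_on k U f" "\<And>x. x \<in> U \<Longrightarrow> f x > 0"
  shows "Ck_on k U (\<lambda>x. sqrt (f x))"
  using assms(2)
proof (induction k)
  case 0 then show ?case by (auto intro: continuous_intros)
next
  case (Suc k)
  have "Ck_on k U f" using Suc.prems Ck_on_Suc_imp by blast
  then have i: "Ck_on k U (\<lambda>x. sqrt (f x))" using Suc.IH by blast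
  have nz: "sqrt (f x) \<noteq> 0" if "x \<in> U" for x using assms(3)[OF that] by simp
  have *: "Ck_on k U (\<lambda>x. partial_deriv i f x * (inverse (sqrt (f x)) * (1/2)))" for i
    using Suc.prems by (intro Ck_on_mult Ck_on_inverse i assms(1) nz Ck_on_const) auto
  show ?case
    by (rule Ck_on_SucI[where D="\<lambda>x h. (grad f x \<bullet> h) * (inverse (sqrt (f x)) * (1/2))"])
       (use * Suc.prems assms(1,3) Ck_on_has_derivative in
         \<open>auto intro!: derivative_eq_intros simp: inner_axis field_simps simp del: Ck_on.simps\<close>)
qed

lemma DERIV_max0_power:
  fixes t :: real
  shows "((\<lambda>t. (max 0 t) ^ Suc (Suc k)) has_real_derivative (real (k+2) * (max 0 t) ^ Suc k)) (at t)"
proof (cases t "0::real" rule: linorder_cases)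
  case less
  have "((\<lambda>t::real. 0) has_real_derivative 0) (at t)" by simp
  then have "((\<lambda>t. (max 0 t) ^ Suc (Suc k)) has_real_derivative 0) (at t)"
    by (rule has_field_derivative_transform_within[of _ _ _ _ "-t"]) (use less in \<open>auto simp: dist_real_def max_def\<close>)
  then show ?thesis using less by simp
next
  case greater
  have "((\<lambda>t::real. t ^ Suc (Suc k)) has_real_derivative real (k+2) * t ^ Suc k) (at t)"
    using DERIV_pow[of "Suc (Suc k)" t] by simp
  then have "((\<lambda>t. (max 0 t) ^ Suc (Suc k)) has_real_derivative real (k+2) * t ^ Suc k) (at t)"
    by (rule has_field_derivative_transform_within[of _ _ _ _ t]) (use greater in \<open>auto simp: dist_real_def max_def\<close>)
  then show ?thesis using greater by (simp add: max_def)
next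
  case equal
  have "((\<lambda>h::real. (max 0 h) ^ Suc k) \<longlongrightarrow> (max 0 0) ^ Suc k) (at 0)"
    by (intro tendsto_intros)
  then have l: "((\<lambda>h::real. (max 0 h) ^ Suc k) \<longlongrightarrow> 0) (at 0)" by simp
  have "((\<lambda>h::real. (max 0 h) ^ Suc (Suc k) / h) \<longlongrightarrow> 0) (at 0)"
    by (rule Lim_transform_eventually[OF l])
       (auto simp: eventually_at_filter max_def intro!: always_eventually)
  then show ?thesis using equal by (simp add: DERIV_def)
qed

text \<open>Powers of the positive part are the source of all cut-off functions: they vanish where
  \<open>g \<le> 0\<close> and lose only finitely much differentiability.\<close>

lemma Ck_on_max0_power:
  assumes "open U" "Ck_on k U g"
  shows "Ck_on k U (\<lambda>x. (max 0 (g x)) ^ Suc k)"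
  using assms(2)
proof (induction k)
  case 0 then show ?case by (auto intro!: continuous_intros)
next
  case (Suc k)
  have g: "Ck_on k U g" using Suc.prems Ck_on_Suc_imp by blast
  have *: "Ck_on k U (\<lambda>x. (real (k+2) * (max 0 (g x)) ^ Suc k) * partial_deriv i g x)" for i
    using Suc.prems Suc.IH[OF g] by (intro Ck_on_mult assms(1) Ck_on_const) auto
  have d: "((\<lambda>x. (max 0 (g x)) ^ Suc (Suc k)) has_derivative
          (\<lambda>h. (real (k+2) * (max 0 (g x)) ^ Suc k) * (grad g x \<bullet> h))) (at x)" if "x \<in> U" for x
    using has_derivative_compose[OF Ck_on_has_derivative[OF Suc.prems assms(1) that]
        DERIV_max0_power[where t="g x" and k=k, unfolded has_field_derivative_def]]
    by simp
  show ?case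
    by (rule Ck_on_SucI[OF assms(1) d]) (use * in \<open>auto simp: inner_axis simp del: Ck_on.simps\<close>)
qed

lemma Ck_on_Un:
  assumes "open U" "open V" "Ck_on k U f" "Ck_on k V f"
  shows "Ck_on k (U \<union> V) f"
  using assms(3,4)
proof (induction k arbitrary: f)
  case 0 then show ?case using assms by (simp add: continuous_on_open_Un)
next
  case (Suc k)
  then show ?case using assms(1,2)
    by (auto simp: differentiable_on_eq_differentiable_at open_Un)
qed

lemma Ck_on_zero_extension:
  assumes "Ck_on k (ball p r) f" "r' < r"
    and "\<And>x. x \<in> ball p r \<Longrightarrow> x \<notin> cball p r' \<Longrightarrow> f x = 0"
  shows "Ck_on k UNIV (\<lambda>x. if x \<in> ball p r then f x else 0)"
proof -
  have "Ck_on k (ball p r) (\<lambda>x. if x \<in> ball p r then f x else 0)"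
    by (rule Ck_on_cong[OF _ assms(1)]) auto
  moreover have "Ck_on k (- cball p r') (\<lambda>x. if x \<in> ball p r then f x else 0)"
    by (rule Ck_on_cong[where f="\<lambda>x. 0"]) (use assms(3) in \<open>auto intro!: Ck_on_const\<close>)
  ultimately have "Ck_on k (ball p r \<union> - cball p r') (\<lambda>x. if x \<in> ball p r then f x else 0)"
    by (intro Ck_on_Un) auto
  moreover have "ball p r \<union> - cball p r' = UNIV" using assms(2) by auto
  ultimately show ?thesis by simp
qed

lemma Ck_on_norm_square_diff: "open U \<Longrightarrow> Ck_on k U (\<lambda>x. (norm (x - p))\<^sup>2)"
  unfolding power2_norm_eq_inner inner_vec_def inner_real_def vector_minus_component
  by (intro Ck_on_sum Ck_on_mult Ck_on_diff Ck_on_nth Ck_on_const)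

lemma cutoff_exists:
  fixes p :: "real^'n"
  assumes "0 < r"
  obtains \<psi> :: "real^'n \<Rightarrow> real" where "Ck_on k UNIV \<psi>" "\<And>x. x \<in> ball p (r/2) \<Longrightarrow> \<psi> x = 1"
    "\<And>x. x \<notin> ball p r \<Longrightarrow> \<psi> x = 0"
proof -
  \<comment> \<open>on the inner ball \<open>r\<^sup>2 - |x - p|\<^sup>2 \<ge> 3 r\<^sup>2 / 4\<close>, whence \<open>\<beta> \<ge> 1\<close>\<close>
  define \<beta> where "\<beta> x = (max 0 ((r\<^sup>2 - (norm (x - p))\<^sup>2) * (4 / (3 * r\<^sup>2)))) ^ Suc k" for x
  define \<psi> where "\<psi> x = 1 - (max 0 (1 - \<beta> x)) ^ Suc k" for x
  have "Ck_on k UNIV \<beta>" unfolding \<beta>_def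
    by (intro Ck_on_max0_power Ck_on_mult Ck_on_diff Ck_on_const Ck_on_norm_square_diff) auto
  then have "Ck_on k UNIV \<psi>" unfolding \<psi>_def
    by (intro Ck_on_max0_power Ck_on_diff Ck_on_const) auto
  moreover have "\<psi> x = 1" if "x \<in> ball p (r/2)" for x
  proof -
    have "norm (x - p) \<le> r/2" using that by (simp add: dist_norm norm_minus_commute)
    then have "(norm (x - p))\<^sup>2 \<le> (r/2)\<^sup>2" by (intro power_mono) auto
    then have "1 \<le> (r\<^sup>2 - (norm (x - p))\<^sup>2) * (4 / (3 * r\<^sup>2))"
      using assms by (simp add: field_simps power2_eq_square)
    then have "1 \<le> \<beta> x" unfolding \<beta>_def by (intro one_le_power) auto
    then show ?thesis by (simp add: \<psi>_def)
  qed
  moreover have "\<psi> x = 0" if "x \<notin> ball p r" for x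
  proof -
    have "r \<le> norm (x - p)" using that by (simp add: dist_norm norm_minus_commute)
    then have "r\<^sup>2 \<le> (norm (x - p))\<^sup>2" using assms by (intro power_mono) auto
    then have "(r\<^sup>2 - (norm (x - p))\<^sup>2) * (4 / (3 * r\<^sup>2)) \<le> 0"
      by (intro mult_nonpos_nonneg) auto
    then have "\<beta> x = 0" unfolding \<beta>_def by (simp add: max_def)
    then show ?thesis by (simp add: \<psi>_def)
  qed
  ultimately show ?thesis using that by blast
qed

lemma partial_deriv_has_real_derivative:
  fixes f :: "real^'n \<Rightarrow> real"
  assumes "f differentiable (at (x + t *\<^sub>R v))"
  shows "((\<lambda>t. f (x + t *\<^sub>R v)) has_real_derivative (grad f (x + t *\<^sub>R v) \<bullet> v)) (at t)"
proof -
  have "((\<lambda>t. x + t *\<^sub>R v) has_derivative (\<lambda>h. h *\<^sub>R v)) (at t)"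
    by (auto intro!: derivative_eq_intros)
  from has_derivative_compose[OF this has_derivative_grad[OF assms]]
  show ?thesis by (simp add: has_field_derivative_def mult.commute[of _ "grad f _ \<bullet> v"])
qed

text \<open>Two applications of the mean value theorem, one in each direction.\<close>

lemma second_difference:
  fixes f :: "real^'n \<Rightarrow> real"
  assumes C: "Ck_on 2 (ball x r) f" and h: "0 < h" "h * 2 < r"
  obtains y where "dist x y \<le> 2 * h"
    "f (x + h *\<^sub>R axis i 1 + h *\<^sub>R axis j 1) - f (x + h *\<^sub>R axis i 1) - f (x + h *\<^sub>R axis j 1) + f x
      = h * h * partial_deriv j (partial_deriv i f) y"
proof -
  let ?ei = "axis i 1 :: real^'n" and ?ej = "axis j 1 :: real^'n"
  have C2: "Ck_on (Suc 0) (ball x r) (partial_deriv i f)" and C1: "Ck_on (Suc 0) (ball x r) f"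
    using C Ck_on_le[OF C, of 1] by (auto simp: numeral_2_eq_2)
  have inb: "x + s *\<^sub>R ?ei + t *\<^sub>R ?ej \<in> ball x r \<and> dist x (x + s *\<^sub>R ?ei + t *\<^sub>R ?ej) \<le> 2 * h"
    if "0 \<le> s" "s \<le> h" "0 \<le> t" "t \<le> h" for s t
  proof -
    have "norm (s *\<^sub>R ?ei + t *\<^sub>R ?ej) \<le> s + t"
      using norm_triangle_ineq[of "s *\<^sub>R ?ei" "t *\<^sub>R ?ej"] that by simp
    moreover have "dist x (x + s *\<^sub>R ?ei + t *\<^sub>R ?ej) = norm (s *\<^sub>R ?ei + t *\<^sub>R ?ej)"
      by (metis add.assoc add_diff_cancel_left' dist_commute dist_norm)
    ultimately show ?thesis using that h by auto
  qed
  define g where "g s = f (x + s *\<^sub>R ?ei + h *\<^sub>R ?ej) - f (x + s *\<^sub>R ?ei)" for s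
  have dg: "(g has_real_derivative
      partial_deriv i f (x + s *\<^sub>R ?ei + h *\<^sub>R ?ej) - partial_deriv i f (x + s *\<^sub>R ?ei)) (at s)"
    if "0 \<le> s" "s \<le> h" for s
  proof -
    have a: "f differentiable (at ((x + h *\<^sub>R ?ej) + s *\<^sub>R ?ei))" "f differentiable (at (x + s *\<^sub>R ?ei))"
      using inb[of s h] inb[of s 0] that h
      by (auto intro!: Ck_on_differentiable[OF C1] simp: algebra_simps)
    show ?thesis unfolding g_def
      using DERIV_diff[OF partial_deriv_has_real_derivative[OF a(1)] partial_deriv_has_real_derivative[OF a(2)]]
      by (simp add: inner_axis algebra_simps)
  qed
  obtain s where s: "0 < s" "s < h" "g h - g 0 = (h - 0) *
      (partial_deriv i f (x + s *\<^sub>R ?ei + h *\<^sub>R ?ej) - partial_deriv i f (x + s *\<^sub>R ?ei))"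
    using MVT2[OF h(1) dg] by blast
  have dk: "((\<lambda>t. partial_deriv i f (x + s *\<^sub>R ?ei + t *\<^sub>R ?ej)) has_real_derivative
      partial_deriv j (partial_deriv i f) (x + s *\<^sub>R ?ei + t *\<^sub>R ?ej)) (at t)"
    if "0 \<le> t" "t \<le> h" for t
  proof -
    have a: "partial_deriv i f differentiable (at (x + s *\<^sub>R ?ei + t *\<^sub>R ?ej))"
      using inb[of s t] that s by (intro Ck_on_differentiable[OF C2]) auto
    show ?thesis
      using partial_deriv_has_real_derivative[OF a] by (simp add: inner_axis)
  qed
  obtain t where t: "0 < t" "t < h"
     "partial_deriv i f (x + s *\<^sub>R ?ei + h *\<^sub>R ?ej) - partial_deriv i f (x + s *\<^sub>R ?ei + 0 *\<^sub>R ?ej)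
      = (h - 0) * partial_deriv j (partial_deriv i f) (x + s *\<^sub>R ?ei + t *\<^sub>R ?ej)"
    using MVT2[OF h(1) dk] by blast
  show ?thesis
  proof (rule that[of "x + s *\<^sub>R ?ei + t *\<^sub>R ?ej"])
    show "dist x (x + s *\<^sub>R ?ei + t *\<^sub>R ?ej) \<le> 2 * h" using inb[of s t] s t by auto
    show "f (x + h *\<^sub>R ?ei + h *\<^sub>R ?ej) - f (x + h *\<^sub>R ?ei) - f (x + h *\<^sub>R ?ej) + f x
      = h * h * partial_deriv j (partial_deriv i f) (x + s *\<^sub>R ?ei + t *\<^sub>R ?ej)"
      using s(3) t(3) by (simp add: g_def)
  qed
qed

text \<open>Symmetry of second derivatives (Schwarz): both mixed derivatives are limits of the same
  second difference quotient, which is symmetric in the two directions.\<close>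

lemma partial_deriv_commute:
  fixes f :: "real^'n \<Rightarrow> real"
  assumes "open U" "Ck_on 2 U f" "x \<in> U"
  shows "partial_deriv j (partial_deriv i f) x = partial_deriv i (partial_deriv j f) x"
proof -
  obtain r where r: "r > 0" "ball x r \<subseteq> U" using assms(1,3) openE by blast
  have C: "Ck_on 2 (ball x r) f" using Ck_on_subset[OF assms(2) r(2)] .
  define d where "d i j h = (f (x + h *\<^sub>R axis i 1 + h *\<^sub>R axis j 1) - f (x + h *\<^sub>R axis i 1)
     - f (x + h *\<^sub>R axis j 1) + f x) / (h * h)" for i j h
  have lim: "((d i j) \<longlongrightarrow> partial_deriv j (partial_deriv i f) x) (at_right 0)" for i j
  proof (rule tendstoI)
    fix e :: real assume "e > 0"
    have "continuous_on (ball x r) (partial_deriv j (partial_deriv i f))"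
      using C by (simp add: numeral_2_eq_2)
    then have "isCont (partial_deriv j (partial_deriv i f)) x"
      using r(1) by (simp add: continuous_on_eq_continuous_at)
    then obtain \<delta> where \<delta>: "\<delta> > 0" "\<And>y. dist x y < \<delta> \<Longrightarrow>
        dist (partial_deriv j (partial_deriv i f) y) (partial_deriv j (partial_deriv i f) x) < e"
      using \<open>e > 0\<close> by (metis continuous_at_eps_delta dist_commute)
    have "dist (d i j h) (partial_deriv j (partial_deriv i f) x) < e"
      if "0 < h" "h < min (r/2) (\<delta>/2)" for h
    proof -
      have "h * 2 < r" using that by simp
      from second_difference[OF C that(1) \<open>h * 2 < r\<close>, of i j]
      obtain y where y: "dist x y \<le> 2 * h"
        "f (x + h *\<^sub>R axis i 1 + h *\<^sub>R axis j 1) - f (x + h *\<^sub>R axis i 1) - f (x + h *\<^sub>R axis j 1) + f x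
          = h * h * partial_deriv j (partial_deriv i f) y"
        by blast
      then have "d i j h = partial_deriv j (partial_deriv i f) y"
        using that(1) by (simp add: d_def)
      then show ?thesis using \<delta>(2)[of y] y(1) that by auto
    qed
    then show "\<forall>\<^sub>F h in at_right 0. dist (d i j h) (partial_deriv j (partial_deriv i f) x) < e"
      using r(1) \<delta>(1) by (intro eventually_at_rightI[of 0 "min (r/2) (\<delta>/2)"]) auto
  qed
  have "d i j = d j i" by (auto simp: d_def fun_eq_iff algebra_simps)
  then show ?thesis
    using tendsto_unique[OF _ lim[of i j]] lim[of j i] by force
qed


section \<open>Lebesgue measure in Cartesian coordinates\<close>

abbreviation hplane_measure :: "'n \<Rightarrow> ('n \<Rightarrow> real) measure" where
  "hplane_measure i \<equiv> Pi\<^sub>M (UNIV - {i}) (\<lambda>_. lborel)"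

interpretation lborel_product: product_sigma_finite "\<lambda>_::'n::finite. lborel :: real measure" ..

lemma borel_measurable_vec:
  fixes f :: "'a \<Rightarrow> real^'n"
  shows "(\<And>i. (\<lambda>x. f x $ i) \<in> borel_measurable M) \<Longrightarrow> f \<in> borel_measurable M"
  by (subst borel_measurable_euclidean_space) (auto simp: Basis_vec_def inner_axis)

lemma prod_Basis_vec: "(\<Prod>b\<in>(Basis :: (real^'n) set). g b) = (\<Prod>i\<in>UNIV. g (axis i 1))"
proof -
  have B: "(Basis :: (real^'n) set) = (\<lambda>i. axis i 1) ` UNIV" by (auto simp: Basis_vec_def)
  show ?thesis unfolding B by (subst prod.reindex) (auto simp: inj_on_def axis_eq_axis)
qed

lemma measurable_vec_lambda [measurable]:
  "(\<lambda>f. \<chi> i. f i) \<in> Pi\<^sub>M (UNIV::'n::finite set) (\<lambda>_. lborel) \<rightarrow>\<^sub>M (borel :: (real^'n) measure)"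
proof (rule borel_measurable_vec)
  fix i :: 'n
  have "(\<lambda>f. f i) \<in> Pi\<^sub>M (UNIV::'n set) (\<lambda>_. lborel :: real measure) \<rightarrow>\<^sub>M lborel"
    by (rule measurable_component_singleton) auto
  then show "(\<lambda>f. (\<chi> i. f i) $ i) \<in> borel_measurable (Pi\<^sub>M (UNIV::'n set) (\<lambda>_. lborel :: real measure))"
    by simp
qed

text \<open>Both measures give every box the product of its side lengths.\<close>

lemma lborel_eq_distr_PiM:
  "(lborel :: (real^'n) measure) = distr (Pi\<^sub>M UNIV (\<lambda>_. lborel)) borel (\<lambda>f. \<chi> i. f i)"
proof (rule lborel_eqI)
  fix l u :: "real^'n"
  assume lu: "\<And>b. b \<in> Basis \<Longrightarrow> l \<bullet> b \<le> u \<bullet> b"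
  have le: "l $ i \<le> u $ i" for i using lu[of "axis i 1"] by (simp add: inner_axis axis_in_Basis_iff)
  have "(\<lambda>f. \<chi> i. f i) -` box l u \<inter> space (Pi\<^sub>M UNIV (\<lambda>_. lborel)) = (\<Pi>\<^sub>E i\<in>UNIV. {l $ i <..< u $ i})"
    by (auto simp: mem_box_cart space_PiM PiE_iff)
  then have "emeasure (distr (Pi\<^sub>M UNIV (\<lambda>_. lborel)) borel (\<lambda>f. \<chi> i. f i)) (box l u)
     = emeasure (Pi\<^sub>M (UNIV::'n set) (\<lambda>_. lborel)) (\<Pi>\<^sub>E i\<in>UNIV. {l $ i <..< u $ i})"
    by (subst emeasure_distr) auto
  also have "\<dots> = (\<Prod>i\<in>UNIV. ennreal (u $ i - l $ i))"
    by (subst lborel_product.emeasure_PiM) (use le in auto)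
  also have "\<dots> = ennreal (\<Prod>b\<in>Basis. (u - l) \<bullet> b)"
    by (subst prod_ennreal) (use le in \<open>auto simp: prod_Basis_vec inner_axis\<close>)
  finally show "emeasure (distr (Pi\<^sub>M UNIV (\<lambda>_. lborel)) borel (\<lambda>f. \<chi> i. f i)) (box l u)
     = ennreal (\<Prod>b\<in>Basis. (u - l) \<bullet> b)" .
qed auto

lemma vec_lambda_fun_upd: "(\<chi> j. (z(i := t)) j) = hyper i z + t *\<^sub>R axis i 1"
  by (auto simp: vec_eq_iff hyper_def axis_def)

lemma hyper_measurable [measurable]:
  "hyper i \<in> borel_measurable (hplane_measure (i::'n::finite))"
proof (rule borel_measurable_vec)
  fix j :: 'n
  show "(\<lambda>z. hyper i z $ j) \<in> borel_measurable (hplane_measure i)"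
  proof (cases "j = i")
    case False
    then have "(\<lambda>f. f j) \<in> hplane_measure i \<rightarrow>\<^sub>M lborel"
      by (intro measurable_component_singleton) auto
    then show ?thesis using False by (simp add: hyper_def)
  qed (simp add: hyper_def)
qed

lemma integral_lborel_split:
  fixes f :: "real^'n \<Rightarrow> real"
  assumes "integrable lborel f"
  shows "(\<integral>x. f x \<partial>lborel) = (\<integral>z. (\<integral>t. f (hyper i z + t *\<^sub>R axis i 1) \<partial>lborel) \<partial>hplane_measure i)"
proof -
  have ins: "insert i (UNIV - {i}) = UNIV" by auto
  have fm: "f \<in> borel_measurable borel" using assms by auto
  have int: "integrable (Pi\<^sub>M (insert i (UNIV - {i})) (\<lambda>_. lborel)) (\<lambda>g. f (\<chi> j. g j))"
    using assms fm unfolding ins by (subst (asm) lborel_eq_distr_PiM) (simp add: integrable_distr_eq)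
  have "(\<integral>x. f x \<partial>lborel) = (\<integral>g. f (\<chi> j. g j) \<partial>Pi\<^sub>M (insert i (UNIV - {i})) (\<lambda>_. lborel))"
    unfolding ins by (subst lborel_eq_distr_PiM) (simp add: integral_distr fm)
  also have "\<dots> = (\<integral>z. (\<integral>t. f (\<chi> j. (z(i := t)) j) \<partial>lborel) \<partial>hplane_measure i)"
    by (subst lborel_product.product_integral_insert[OF _ _ int]) auto
  finally show ?thesis unfolding vec_lambda_fun_upd .
qed

lemma integrable_compact_support:
  fixes f :: "'a::euclidean_space \<Rightarrow> real"
  assumes f: "continuous_on UNIV f" and K: "compact K" "\<And>x. x \<notin> K \<Longrightarrow> f x = 0"
    and [measurable]: "E \<in> sets borel"
  shows "integrable lborel (\<lambda>x. indicator E x * f x)"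
proof -
  have "integrable lborel (\<lambda>x. indicator K x *\<^sub>R f x)"
    using f K(1) by (intro borel_integrable_compact) (auto intro: continuous_on_subset)
  moreover have "(\<lambda>x. indicator K x *\<^sub>R f x) = f"
    using K(2) by (auto simp: indicator_def fun_eq_iff)
  ultimately have "integrable lborel f" by simp
  from integrable_mult_indicator[OF _ this, of E] show ?thesis by simp
qed

section \<open>The divergence theorem on one side of a graph\<close>

text \<open>The sign \<open>s\<close> selects one of the two half lines bounded by \<open>a\<close>.\<close>

lemma FTC_half_line:
  fixes g g' :: "real \<Rightarrow> real"
  assumes deriv: "\<And>t. (g has_real_derivative g' t) (at t)" and cont: "continuous_on UNIV g'"
    and supp: "\<And>t. \<bar>t\<bar> > M \<Longrightarrow> g t = 0" and s: "s \<in> {1, -1}"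
  shows "(\<integral>t. indicator {t. s * t > s * a} t * g' t \<partial>lborel) = - s * g a"
proof -
  have supp': "g' t = 0" if "\<bar>t\<bar> > M" for t
  proof (rule DERIV_unique[OF deriv])
    have "open {t. \<bar>t\<bar> > M}" by (intro open_Collect_less continuous_intros)
    then show "(g has_real_derivative 0) (at t)"
      by (rule has_field_derivative_transform_within_open[where f="\<lambda>_. 0", rotated])
         (use that supp in auto)
  qed
  \<comment> \<open>the interval from \<open>- b\<close> to \<open>b\<close> contains \<open>a\<close> and the support of \<open>g\<close>\<close>
  define b where "b = \<bar>M\<bar> + \<bar>a\<bar> + 1"
  have c: "isCont g' x" for x using cont by (simp add: continuous_on_eq_continuous_at)
  have [measurable]: "g' \<in> borel_measurable borel" using cont by (rule borel_measurable_continuous_onI)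
  have z: "g b = 0" "g (-b) = 0" by (auto intro!: supp simp: b_def)
  show ?thesis
  proof (cases "s = 1")
    case True
    have "(\<integral>t. indicator {t. s * t > s * a} t * g' t \<partial>lborel) = (\<integral>t. g' t * indicator {a..b} t \<partial>lborel)"
    proof (rule integral_cong_AE)
      show "AE t in lborel. indicator {t. s * t > s * a} t * g' t = g' t * indicator {a..b} t"
        using AE_lborel_singleton[of a]
      proof eventually_elim
        case (elim t)
        have "t > b \<Longrightarrow> g' t = 0" by (rule supp') (auto simp: b_def)
        then show ?case using True elim by (auto simp: indicator_def)
      qed
    qed measurable
    also have "\<dots> = g b - g a"
      by (intro integral_FTC_Icc_real deriv c) (auto simp: b_def)
    finally show ?thesis using True z by simp
  next
    case False
    then have s: "s = -1" using s by auto
    have "(\<integral>t. indicator {t. s * t > s * a} t * g' t \<partial>lborel) = (\<integral>t. g' t * indicator {-b..a} t \<partial>lborel)"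
    proof (rule integral_cong_AE)
      show "AE t in lborel. indicator {t. s * t > s * a} t * g' t = g' t * indicator {-b..a} t"
        using AE_lborel_singleton[of a]
      proof eventually_elim
        case (elim t)
        have "t < -b \<Longrightarrow> g' t = 0" by (rule supp') (auto simp: b_def)
        then show ?case using s elim by (auto simp: indicator_def)
      qed
    qed measurable
    also have "\<dots> = g a - g (-b)"
      by (intro integral_FTC_Icc_real deriv c) (auto simp: b_def)
    finally show ?thesis using s z by simp
  qed
qed

lemma norm_axis_line_bound:
  fixes x :: "real^'n"
  assumes "norm (x + t *\<^sub>R axis i 1) \<le> M"
  shows "\<bar>t\<bar> \<le> M + norm x"
proof -
  have "\<bar>t\<bar> = norm ((x + t *\<^sub>R axis i 1) - x)" by simp
  also have "\<dots> \<le> M + norm x" using assms norm_triangle_ineq4 by (smt (verit))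
  finally show ?thesis .
qed

lemma FTC_axis_line:
  fixes G :: "real^'n \<Rightarrow> real"
  assumes G: "Ck_on 1 UNIV G" and supp: "\<And>x. norm x > M \<Longrightarrow> G x = 0" and s: "s \<in> {1, -1}"
  shows "(\<integral>t. indicator {t. s * t > s * a} t * partial_deriv i G (x + t *\<^sub>R axis i 1) \<partial>lborel)
    = - s * G (x + a *\<^sub>R axis i 1)"
proof (rule FTC_half_line[where M="M + norm x"])
  have d: "G differentiable (at y)" for y
    using G Ck_on_differentiable[of 0 UNIV G y] by simp
  show "((\<lambda>t. G (x + t *\<^sub>R axis i 1)) has_real_derivative partial_deriv i G (x + t *\<^sub>R axis i 1)) (at t)" for t
    using partial_deriv_has_real_derivative[OF d, of x "axis i 1" t] by (simp add: inner_axis)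
  have "continuous_on UNIV (partial_deriv i G)" using G by simp
  then show "continuous_on UNIV (\<lambda>t. partial_deriv i G (x + t *\<^sub>R axis i 1))"
    by (rule continuous_on_compose2) (auto intro!: continuous_intros)
  show "G (x + t *\<^sub>R axis i 1) = 0" if "\<bar>t\<bar> > M + norm x" for t
  proof (rule supp)
    show "M < norm (x + t *\<^sub>R axis i 1)"
      using norm_axis_line_bound[of x t i M] that by linarith
  qed
qed (rule s)

lemma partial_deriv_zero_off_closed:
  fixes G :: "real^'n \<Rightarrow> real"
  assumes "closed K" "\<And>x. x \<notin> K \<Longrightarrow> G x = 0" "x \<notin> K"
  shows "partial_deriv i G x = 0"
proof -
  have "partial_deriv i G x = partial_deriv i (\<lambda>_. 0) x"
    using assms by (intro partial_deriv_cong[where U="- K"]) auto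
  then show ?thesis by (simp add: partial_deriv_def)
qed

lemma partial_deriv_zero_outside:
  fixes G :: "real^'n \<Rightarrow> real"
  assumes "\<And>x. norm x > M \<Longrightarrow> G x = 0" "norm x > M"
  shows "partial_deriv i G x = 0"
  by (rule partial_deriv_zero_off_closed[of "cball 0 M"]) (use assms in auto)

lemma smooth_heightD:
  assumes "smooth_height i \<gamma>"
  shows "Ck_on k UNIV \<gamma>" "\<gamma> (x + t *\<^sub>R axis i 1) = \<gamma> x"
  using assms by (auto simp: smooth_height_def smooth_on_def top.extremum_unique)

lemma smooth_height_partial:
  assumes "smooth_height i \<gamma>"
  shows "partial_deriv j \<gamma> (x + t *\<^sub>R axis i 1) = partial_deriv j \<gamma> x" "partial_deriv i \<gamma> x = 0"
proof -
  have d: "\<gamma> differentiable (at x)" for x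
    using Ck_on_differentiable[of 0 UNIV \<gamma> x] smooth_heightD(1)[OF assms, of 1] by simp
  have "((\<lambda>x. \<gamma> (x + t *\<^sub>R axis i 1)) has_derivative (\<lambda>h. grad \<gamma> (x + t *\<^sub>R axis i 1) \<bullet> h)) (at x)"
    by (rule has_derivative_compose[OF _ has_derivative_grad[OF d]])
       (auto intro!: derivative_eq_intros)
  then have "(\<gamma> has_derivative (\<lambda>h. grad \<gamma> (x + t *\<^sub>R axis i 1) \<bullet> h)) (at x)"
    by (simp add: smooth_heightD(2)[OF assms])
  then show "partial_deriv j \<gamma> (x + t *\<^sub>R axis i 1) = partial_deriv j \<gamma> x"
    using grad_eqI by (metis grad_nth)
  have "((\<lambda>t. \<gamma> (x + t *\<^sub>R axis i 1)) has_real_derivative (grad \<gamma> (x + 0 *\<^sub>R axis i 1) \<bullet> axis i 1)) (at 0)"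
    by (rule partial_deriv_has_real_derivative[OF d])
  then have "((\<lambda>t. \<gamma> x) has_real_derivative (partial_deriv i \<gamma> x)) (at 0)"
    by (simp add: smooth_heightD(2)[OF assms] inner_axis)
  then show "partial_deriv i \<gamma> x = 0" using DERIV_const DERIV_unique by blast
qed

lemma smooth_height_hyper:
  assumes "smooth_height i \<gamma>"
  shows "\<gamma> (graph_point i \<gamma> z) = \<gamma> (hyper i z)" "grad \<gamma> (graph_point i \<gamma> z) = grad \<gamma> (hyper i z)"
  unfolding graph_point_def
  by (simp_all add: smooth_heightD(2)[OF assms] vec_eq_iff smooth_height_partial(1)[OF assms])

lemma axis_line_hyper_nth [simp]: "(hyper i z + t *\<^sub>R axis i 1) $ i = t"
  by (simp add: hyper_def)

text \<open>Over every line parallel to the \<open>i\<close>-axis the claim is the fundamental theorem of calculus.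
  The factor \<open>g\<close> is constant along these lines.\<close>

lemma gauss_graph_vertical:
  fixes G g :: "real^'n \<Rightarrow> real"
  assumes G: "Ck_on 1 UNIV G" and supp: "\<And>x. norm x > M \<Longrightarrow> G x = 0" and s: "s \<in> {1, -1}"
    and \<gamma>: "smooth_height i \<gamma>"
    and g: "continuous_on UNIV g" "\<And>x t. g (x + t *\<^sub>R axis i 1) = g x"
  shows "(\<integral>x. indicator {x. s * x $ i > s * \<gamma> x} x * (g x * partial_deriv i G x) \<partial>lborel)
     = (\<integral>z. - s * (g (hyper i z) * G (graph_point i \<gamma> z)) \<partial>hplane_measure i)"
proof -
  have cg: "continuous_on UNIV (\<lambda>x. g x * partial_deriv i G x)"
    using G g by (auto intro: continuous_intros)
  have c\<gamma>: "continuous_on UNIV \<gamma>" using smooth_heightD(1)[OF \<gamma>, of 0] by simp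
  have z: "g x * partial_deriv i G x = 0" if "x \<notin> cball 0 M" for x
    using partial_deriv_zero_outside[of M G x i] supp that by simp
  have "open {x. s * x $ i > s * \<gamma> x}"
    using c\<gamma> by (intro open_Collect_less continuous_intros) auto
  then have "integrable lborel (\<lambda>x. indicator {x. s * x $ i > s * \<gamma> x} x * (g x * partial_deriv i G x))"
    by (intro integrable_compact_support[OF cg compact_cball[of 0 M] z]) auto
  note integral_lborel_split[OF this, of i]
  also have "(\<lambda>z. \<integral>t. indicator {x. s * x $ i > s * \<gamma> x} (hyper i z + t *\<^sub>R axis i 1) *
       (g (hyper i z + t *\<^sub>R axis i 1) * partial_deriv i G (hyper i z + t *\<^sub>R axis i 1)) \<partial>lborel)
     = (\<lambda>z. - s * (g (hyper i z) * G (graph_point i \<gamma> z)))"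
  proof
    fix z
    have "(\<integral>t. indicator {x. s * x $ i > s * \<gamma> x} (hyper i z + t *\<^sub>R axis i 1) *
       (g (hyper i z + t *\<^sub>R axis i 1) * partial_deriv i G (hyper i z + t *\<^sub>R axis i 1)) \<partial>lborel)
      = (\<integral>t. g (hyper i z) * (indicator {t. s * t > s * \<gamma> (hyper i z)} t *
          partial_deriv i G (hyper i z + t *\<^sub>R axis i 1)) \<partial>lborel)"
      by (intro Bochner_Integration.integral_cong refl)
         (auto simp: g(2) smooth_heightD(2)[OF \<gamma>] indicator_def simp del: vector_add_component)
    also have "\<dots> = g (hyper i z) * (- s * G (hyper i z + \<gamma> (hyper i z) *\<^sub>R axis i 1))"
      by (simp add: FTC_axis_line[OF G supp s])
    finally show "(\<integral>t. indicator {x. s * x $ i > s * \<gamma> x} (hyper i z + t *\<^sub>R axis i 1) *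
       (g (hyper i z + t *\<^sub>R axis i 1) * partial_deriv i G (hyper i z + t *\<^sub>R axis i 1)) \<partial>lborel)
       = - s * (g (hyper i z) * G (graph_point i \<gamma> z))"
      by (simp add: graph_point_def)
  qed
  finally show ?thesis .
qed

text \<open>Lines parallel to the bounding hyperplane do not leave the half space, so the fundamental theorem of
  calculus on each of them gives zero.\<close>

lemma gauss_half_space_parallel:
  fixes G :: "real^'n \<Rightarrow> real"
  assumes G: "Ck_on 1 UNIV G" and supp: "\<And>x. norm x > M \<Longrightarrow> G x = 0" and ij: "i \<noteq> j"
  shows "(\<integral>x. indicator {x. s * x $ i > 0} x * partial_deriv j G x \<partial>lborel) = 0"
proof -
  have cg: "continuous_on UNIV (\<lambda>x. partial_deriv j G x)" using G by auto
  have z: "partial_deriv j G x = 0" if "x \<notin> cball 0 M" for x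
    using partial_deriv_zero_outside[of M G x j] supp that by simp
  have "open {x::real^'n. s * x $ i > 0}"
    by (intro open_Collect_less continuous_intros)
  then have "integrable lborel (\<lambda>x. indicator {x. s * x $ i > 0} x * partial_deriv j G x)"
    by (intro integrable_compact_support[OF cg compact_cball[of 0 M] z]) auto
  note integral_lborel_split[OF this, of j]
  also have "(\<lambda>z. \<integral>t. indicator {x. s * x $ i > 0} (hyper j z + t *\<^sub>R axis j 1) *
       partial_deriv j G (hyper j z + t *\<^sub>R axis j 1) \<partial>lborel) = (\<lambda>z. 0)"
  proof
    fix z
    define a where "a = - (M + norm (hyper j z) + 1)"
    have a0: "G (hyper j z + a *\<^sub>R axis j 1) = 0"
    proof (rule supp)
      show "M < norm (hyper j z + a *\<^sub>R axis j 1)"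
      proof (rule ccontr)
        assume "\<not> M < norm (hyper j z + a *\<^sub>R axis j 1)"
        then have le: "norm (hyper j z + a *\<^sub>R axis j 1) \<le> M" by simp
        from norm_axis_line_bound[OF this] show False by (simp add: a_def)
      qed
    qed
    have b: "partial_deriv j G (hyper j z + t *\<^sub>R axis j 1) = 0" if "t \<le> a" for t
    proof (rule ccontr)
      assume "partial_deriv j G (hyper j z + t *\<^sub>R axis j 1) \<noteq> 0"
      then have le: "norm (hyper j z + t *\<^sub>R axis j 1) \<le> M" using z by fastforce
      from norm_axis_line_bound[OF this] that show False by (simp add: a_def)
    qed
    have "(\<integral>t. indicator {x. s * x $ i > 0} (hyper j z + t *\<^sub>R axis j 1) *
       partial_deriv j G (hyper j z + t *\<^sub>R axis j 1) \<partial>lborel)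
      = (\<integral>t. indicator {x. s * x $ i > 0} (hyper j z) * (indicator {t. 1 * t > 1 * a} t *
          partial_deriv j G (hyper j z + t *\<^sub>R axis j 1)) \<partial>lborel)"
      using ij b by (intro Bochner_Integration.integral_cong refl) (auto simp: indicator_def axis_def)
    also have "\<dots> = 0"
      using FTC_axis_line[OF G supp, of M 1 a j "hyper j z"] a0 by simp
    finally show "(\<integral>t. indicator {x. s * x $ i > 0} (hyper j z + t *\<^sub>R axis j 1) *
       partial_deriv j G (hyper j z + t *\<^sub>R axis j 1) \<partial>lborel) = 0" .
  qed
  finally show ?thesis by simp
qed

text \<open>Straightening the graph by the shear \<open>x \<mapsto> x + \<gamma> x *\<^sub>R axis i 1\<close> preserves Lebesgue measure, because it
  translates every line parallel to the \<open>i\<close>-axis.\<close>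

lemma integral_shear:
  fixes f :: "real^'n \<Rightarrow> real"
  assumes \<gamma>: "smooth_height i \<gamma>" and f: "integrable lborel f"
    and f': "integrable lborel (\<lambda>x. f (x + \<gamma> x *\<^sub>R axis i 1))"
  shows "(\<integral>x. f (x + \<gamma> x *\<^sub>R axis i 1) \<partial>lborel) = (\<integral>x. f x \<partial>lborel)"
proof -
  have "(\<integral>t. f (hyper i z + t *\<^sub>R axis i 1 + \<gamma> (hyper i z + t *\<^sub>R axis i 1) *\<^sub>R axis i 1) \<partial>lborel)
      = (\<integral>t. f (hyper i z + t *\<^sub>R axis i 1) \<partial>lborel)" for z
    using lborel_integral_real_affine[of 1 "\<lambda>t. f (hyper i z + t *\<^sub>R axis i 1)" "\<gamma> (hyper i z)"]
    by (simp add: smooth_heightD(2)[OF \<gamma>] scaleR_add_left algebra_simps)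
  then show ?thesis
    unfolding integral_lborel_split[OF f, of i] integral_lborel_split[OF f', of i] by simp
qed

text \<open>The vector \<open>e\<^sub>j + (D\<^sub>j \<gamma>) e\<^sub>i\<close> is tangent to the graph. The shear turns the derivative in its direction into one
  parallel to a half space.\<close>

lemma gauss_graph_tangential:
  fixes G :: "real^'n \<Rightarrow> real"
  assumes G: "Ck_on 1 UNIV G" and supp: "\<And>x. norm x > M \<Longrightarrow> G x = 0"
    and \<gamma>: "smooth_height i \<gamma>" and ij: "i \<noteq> j"
  shows "(\<integral>x. indicator {x. s * x $ i > s * \<gamma> x} x * (partial_deriv j G x + partial_deriv j \<gamma> x * partial_deriv i G x) \<partial>lborel)
     = 0"
proof -
  define \<Phi> where "\<Phi> x = x + \<gamma> x *\<^sub>R axis i 1" for x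
  define f where "f x = partial_deriv j G x + partial_deriv j \<gamma> x * partial_deriv i G x" for x
  have d: "G differentiable (at y)" for y
    using G Ck_on_differentiable[of 0 UNIV G y] by simp
  have d\<gamma>: "\<gamma> differentiable (at y)" for y
    using smooth_heightD(1)[OF \<gamma>, of 1] Ck_on_differentiable[of 0 UNIV \<gamma> y] by simp
  have c\<gamma>: "continuous_on S \<gamma>" for S
    using smooth_heightD(1)[OF \<gamma>, of 0] continuous_on_subset by auto
  have c\<Phi>: "continuous_on UNIV \<Phi>" unfolding \<Phi>_def by (intro continuous_intros c\<gamma>)
  have cf: "continuous_on UNIV f"
    using G smooth_heightD(1)[OF \<gamma>, of 1] unfolding f_def by (auto intro!: continuous_intros)
  have G\<Phi>': "((\<lambda>x. G (\<Phi> x)) has_derivative (\<lambda>h. grad G (\<Phi> x) \<bullet> (h + (grad \<gamma> x \<bullet> h) *\<^sub>R axis i 1))) (at x)" for x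
    unfolding \<Phi>_def
    by (rule has_derivative_compose[OF _ has_derivative_grad[OF d]])
       (auto intro!: derivative_eq_intros has_derivative_grad[OF d\<gamma>])
  have pd: "partial_deriv k (\<lambda>x. G (\<Phi> x)) x = partial_deriv k G (\<Phi> x) + partial_deriv k \<gamma> x * partial_deriv i G (\<Phi> x)" for k x
    by (simp add: partial_deriv_eq[OF G\<Phi>'] inner_axis inner_add_right)
  have C: "Ck_on 1 UNIV (\<lambda>x. G (\<Phi> x))"
  proof -
    have "continuous_on UNIV (\<lambda>x. partial_deriv k G (\<Phi> x) + partial_deriv k \<gamma> x * partial_deriv i G (\<Phi> x))" for k
    proof -
      have "continuous_on UNIV (partial_deriv k G)" for k using G by simp
      then have "continuous_on UNIV (\<lambda>x. partial_deriv k G (\<Phi> x))" for k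
        by (rule continuous_on_compose2[OF _ c\<Phi>]) auto
      then show ?thesis using smooth_heightD(1)[OF \<gamma>, of 1] by (auto intro!: continuous_intros)
    qed
    then have "continuous_on UNIV (partial_deriv k (\<lambda>x. G (\<Phi> x)))" for k by (simp add: pd)
    then show ?thesis
      using G\<Phi>' by (auto simp: differentiable_on_def differentiable_def)
  qed
  define K where "K = (\<lambda>y. y - \<gamma> y *\<^sub>R axis i 1) ` cball 0 M"
  have K: "compact K" unfolding K_def by (intro compact_continuous_image continuous_intros c\<gamma>) auto
  have inK: "x \<in> K" if "norm (\<Phi> x) \<le> M" for x
    unfolding K_def using that
    by (intro image_eqI[of _ _ "\<Phi> x"]) (auto simp: \<Phi>_def smooth_heightD(2)[OF \<gamma>])
  obtain M' where M': "\<And>x. x \<in> K \<Longrightarrow> norm x \<le> M'"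
    using compact_imp_bounded[OF K] by (auto simp: bounded_iff)
  have supp': "G (\<Phi> x) = 0" if "norm x > M'" for x
    using supp[of "\<Phi> x"] inK[of x] M'[of x] that by linarith
  have fz: "f x = 0" if "norm x > M" for x
    using partial_deriv_zero_outside[of M G x] supp that by (simp add: f_def)
  have fint: "integrable lborel (\<lambda>x. indicator {x. s * x $ i > s * \<gamma> x} x * f x)"
  proof (rule integrable_compact_support[OF cf compact_cball[of 0 M]])
    have "open {x. s * x $ i > s * \<gamma> x}" by (intro open_Collect_less continuous_intros c\<gamma>)
    then show "{x. s * x $ i > s * \<gamma> x} \<in> sets borel" by simp
  qed (use fz in auto)
  have eq: "indicator {x. s * x $ i > s * \<gamma> x} (\<Phi> x) * f (\<Phi> x)
     = indicator {x. s * x $ i > 0} x * partial_deriv j (\<lambda>x. G (\<Phi> x)) x" for x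
    unfolding pd f_def
    by (auto simp: indicator_def \<Phi>_def smooth_heightD(2)[OF \<gamma>]
        smooth_height_partial(1)[OF \<gamma>] algebra_simps)
  have f\<Phi>int: "integrable lborel (\<lambda>x. indicator {x. s * x $ i > s * \<gamma> x} (\<Phi> x) * f (\<Phi> x))"
    unfolding eq
  proof (rule integrable_compact_support[OF _ K])
    show "continuous_on UNIV (partial_deriv j (\<lambda>x. G (\<Phi> x)))" using C by simp
    have "open {x::real^'n. s * x $ i > 0}" by (intro open_Collect_less continuous_intros)
    then show "{x::real^'n. s * x $ i > 0} \<in> sets borel" by simp
    show "partial_deriv j (\<lambda>x. G (\<Phi> x)) x = 0" if "x \<notin> K" for x
    proof -
      have "norm (\<Phi> x) > M" using inK[of x] that by linarith
      then show ?thesis using partial_deriv_zero_outside[of M G "\<Phi> x"] supp by (simp add: pd)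
    qed
  qed
  have "(\<integral>x. indicator {x. s * x $ i > s * \<gamma> x} x * f x \<partial>lborel)
      = (\<integral>x. indicator {x. s * x $ i > s * \<gamma> x} (\<Phi> x) * f (\<Phi> x) \<partial>lborel)"
    using integral_shear[OF \<gamma> fint] f\<Phi>int by (simp add: \<Phi>_def)
  also have "\<dots> = 0"
    unfolding eq by (rule gauss_half_space_parallel[OF C supp' ij])
  finally show ?thesis by (simp add: f_def)
qed

text \<open>The vector \<open>e\<^sub>j\<close> is the sum of the tangent vector \<open>e\<^sub>j + (D\<^sub>j \<gamma>) e\<^sub>i\<close> and a multiple of \<open>e\<^sub>i\<close>.\<close>

lemma gauss_graph:
  fixes G :: "real^'n \<Rightarrow> real"
  assumes G: "Ck_on 1 UNIV G" and supp: "\<And>x. norm x > M \<Longrightarrow> G x = 0" and s: "s \<in> {1, -1}"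
    and \<gamma>: "smooth_height i \<gamma>"
  shows "(\<integral>x. indicator {x. s * x $ i > s * \<gamma> x} x * partial_deriv j G x \<partial>lborel)
     = (\<integral>z. s * (grad \<gamma> (hyper i z) - axis i 1) $ j * G (graph_point i \<gamma> z) \<partial>hplane_measure i)"
proof (cases "i = j")
  case True
  show ?thesis
    using gauss_graph_vertical[OF G supp s \<gamma>, of M "\<lambda>_. 1"] True smooth_height_partial(2)[OF \<gamma>]
    by (simp add: axis_def)
next
  case False
  have c\<gamma>: "continuous_on UNIV \<gamma>" "continuous_on UNIV (partial_deriv j \<gamma>)"
    using smooth_heightD(1)[OF \<gamma>, of 0] smooth_heightD(1)[OF \<gamma>, of 1] by auto
  have cG: "continuous_on UNIV (partial_deriv k G)" for k using G by simp
  let ?E = "{x. s * x $ i > s * \<gamma> x}"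
  have "open ?E" using c\<gamma> by (intro open_Collect_less continuous_intros) auto
  then have E: "?E \<in> sets borel" by simp
  have z: "x \<notin> cball 0 M \<Longrightarrow> partial_deriv k G x = 0" for x k
    using partial_deriv_zero_outside[of M G x k] supp by simp
  have 1: "integrable lborel (\<lambda>x. indicator ?E x * partial_deriv j G x)"
    by (rule integrable_compact_support[OF cG compact_cball[of 0 M] z E])
  have 2: "integrable lborel (\<lambda>x. indicator ?E x * (partial_deriv j \<gamma> x * partial_deriv i G x))"
    by (rule integrable_compact_support[OF _ compact_cball[of 0 M] _ E])
       (use c\<gamma> cG z in \<open>auto intro!: continuous_intros\<close>)
  have "0 = (\<integral>x. indicator ?E x * partial_deriv j G x \<partial>lborel)
      + (\<integral>x. indicator ?E x * (partial_deriv j \<gamma> x * partial_deriv i G x) \<partial>lborel)"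
    using gauss_graph_tangential[OF G supp \<gamma> False, of M s] Bochner_Integration.integral_add[OF 1 2]
    by (simp add: distrib_left)
  also have "(\<integral>x. indicator ?E x * (partial_deriv j \<gamma> x * partial_deriv i G x) \<partial>lborel)
      = (\<integral>z. - s * (partial_deriv j \<gamma> (hyper i z) * G (graph_point i \<gamma> z)) \<partial>hplane_measure i)"
    by (rule gauss_graph_vertical[OF G supp s \<gamma> c\<gamma>(2) smooth_height_partial(1)[OF \<gamma>]])
  also have "\<dots> = - (\<integral>z. s * (grad \<gamma> (hyper i z) - axis i 1) $ j * G (graph_point i \<gamma> z) \<partial>hplane_measure i)"
    using False by (simp add: axis_def mult.assoc del: Bochner_Integration.integral_mult_right_zero Bochner_Integration.integral_mult_right)
  finally show ?thesis by simp
qed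


section \<open>Boundary charts and the outer normal\<close>

text \<open>The centre of the ball need not lie on the boundary.\<close>

definition chart :: "(real^'n) set \<Rightarrow> real^'n \<Rightarrow> real \<Rightarrow> 'n \<Rightarrow> real \<Rightarrow> (real^'n \<Rightarrow> real) \<Rightarrow> bool" where
  "chart \<Omega> p r i s \<gamma> \<longleftrightarrow> open \<Omega> \<and> r > 0 \<and> s \<in> {1, -1} \<and> smooth_height i \<gamma> \<and>
     \<Omega> \<inter> ball p r = {x \<in> ball p r. s * (x $ i) > s * \<gamma> x}"

text \<open>The vector \<open>grad \<gamma> x - axis i 1\<close> points below the graph, and the sign \<open>s\<close> turns it outwards.\<close>

definition chart_normal :: "'n \<Rightarrow> real \<Rightarrow> (real^'n \<Rightarrow> real) \<Rightarrow> real^'n \<Rightarrow> real^'n" where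
  "chart_normal i s \<gamma> x = (s / sqrt (1 + (norm (grad \<gamma> x))\<^sup>2)) *\<^sub>R (grad \<gamma> x - axis i 1)"

lemma chartD:
  assumes "chart \<Omega> p r i s \<gamma>"
  shows "open \<Omega>" "r > 0" "s \<in> {1, -1}" "smooth_height i \<gamma>"
    "\<And>x. x \<in> ball p r \<Longrightarrow> x \<in> \<Omega> \<longleftrightarrow> s * (x $ i) > s * \<gamma> x"
proof -
  have e: "\<Omega> \<inter> ball p r = {x \<in> ball p r. s * (x $ i) > s * \<gamma> x}"
    and rest: "open \<Omega> \<and> r > 0 \<and> s \<in> {1, -1} \<and> smooth_height i \<gamma>"
    using assms unfolding chart_def by blast+
  show "open \<Omega>" "r > 0" "s \<in> {1, -1}" "smooth_height i \<gamma>" using rest by blast+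
  show "\<And>x. x \<in> ball p r \<Longrightarrow> x \<in> \<Omega> \<longleftrightarrow> s * (x $ i) > s * \<gamma> x"
    using e by blast
qed

lemma continuous_on_smooth_height: "smooth_height i \<gamma> \<Longrightarrow> continuous_on S \<gamma>"
  using smooth_heightD(1)[of i \<gamma> 0] continuous_on_subset by auto

lemma smooth_height_has_derivative:
  "smooth_height i \<gamma> \<Longrightarrow> (\<gamma> has_derivative (\<lambda>h. grad \<gamma> x \<bullet> h)) (at x within S)"
  using smooth_heightD(1)[of i \<gamma> 1] Ck_on_has_derivative[of 0 UNIV \<gamma> x] has_derivative_at_withinI
  by (metis One_nat_def UNIV_I open_UNIV)

lemma sqrt_one_plus_norm_pos: "sqrt (1 + (norm v)\<^sup>2) > 0"
  by (simp add: add_pos_nonneg)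

lemma norm_conormal_square:
  assumes "smooth_height i \<gamma>"
  shows "(grad \<gamma> x - axis i 1) \<bullet> (grad \<gamma> x - axis i 1) = 1 + (norm (grad \<gamma> x))\<^sup>2"
  by (simp add: inner_diff_left inner_diff_right inner_axis inner_axis' smooth_height_partial(2)[OF assms]
      power2_norm_eq_inner)

lemma norm_chart_normal:
  assumes "smooth_height i \<gamma>" "s \<in> {1, -1}"
  shows "norm (chart_normal i s \<gamma> x) = 1"
proof -
  have "norm (grad \<gamma> x - axis i 1) = sqrt (1 + (norm (grad \<gamma> x))\<^sup>2)"
    using norm_conormal_square[OF assms(1)] by (simp add: norm_eq_sqrt_inner)
  then show ?thesis
    using assms(2) sqrt_one_plus_norm_pos[of "grad \<gamma> x"] by (auto simp: chart_normal_def)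
qed

lemma Ck_on_chart_normal:
  assumes "smooth_height i \<gamma>"
  shows "Ck_on k UNIV (\<lambda>x. chart_normal i s \<gamma> x $ j)"
proof -
  have p: "Ck_on k UNIV (partial_deriv j \<gamma>)" for j
    using smooth_heightD(1)[OF assms, of "Suc k"] by simp
  have "Ck_on k UNIV (\<lambda>x. 1 + (\<Sum>j\<in>UNIV. partial_deriv j \<gamma> x * partial_deriv j \<gamma> x))"
    by (intro Ck_on_add Ck_on_const Ck_on_sum Ck_on_mult p open_UNIV)
  then have "Ck_on k UNIV (\<lambda>x. 1 + (norm (grad \<gamma> x))\<^sup>2)"
    by (simp add: power2_norm_eq_inner inner_vec_def)
  moreover have "1 + (norm (grad \<gamma> x))\<^sup>2 > 0" for x by (simp add: add_pos_nonneg)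
  moreover have "sqrt (1 + (norm (grad \<gamma> x))\<^sup>2) \<noteq> 0" for x using sqrt_one_plus_norm_pos[of "grad \<gamma> x"] by simp
  ultimately have "Ck_on k UNIV (\<lambda>x. s * inverse (sqrt (1 + (norm (grad \<gamma> x))\<^sup>2))
      * (partial_deriv j \<gamma> x - axis i 1 $ j))"
    by (intro Ck_on_mult Ck_on_inverse Ck_on_sqrt Ck_on_diff Ck_on_const p open_UNIV)
  then show ?thesis by (simp add: chart_normal_def divide_inverse)
qed

lemma chart_complement_disjoint:
  assumes c: "chart \<Omega> p r i s \<gamma>" and x: "x \<in> ball p r" "s * (x $ i) < s * \<gamma> x"
  shows "x \<notin> closure \<Omega>"
proof -
  let ?V = "{y. s * (y $ i) < s * \<gamma> y} \<inter> ball p r"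
  have "open {y. s * (y $ i) < s * \<gamma> y}"
    by (intro open_Collect_less continuous_intros continuous_on_smooth_height[OF chartD(4)[OF c]])
  then have "open ?V" by auto
  moreover have "?V \<inter> \<Omega> = {}" using chartD(5)[OF c] by force
  ultimately have "?V \<inter> closure \<Omega> = {}" using open_Int_closure_eq_empty by blast
  then show ?thesis using x by blast
qed

text \<open>In the chart, the function \<open>s (x\<^sub>i - \<gamma> x)\<close>, which is positive inside the domain and negative outside, strictly decreases in
  the direction of the normal.\<close>

lemma chart_normal_cross:
  assumes c: "chart \<Omega> p r i s \<gamma>" and x: "x \<in> ball p r" "x $ i = \<gamma> x"
  defines "N \<equiv> chart_normal i s \<gamma> x"
  shows "\<forall>\<^sub>F t in at_right 0. x - t *\<^sub>R N \<in> \<Omega> \<and> x + t *\<^sub>R N \<notin> closure \<Omega>"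
proof -
  note C = chartD[OF c]
  define h where "h t = s * ((x + t *\<^sub>R N) $ i - \<gamma> (x + t *\<^sub>R N))" for t
  have "\<gamma> differentiable (at (x + 0 *\<^sub>R N))"
    using smooth_height_has_derivative[OF C(4)] by (auto simp: differentiable_def)
  note dg = partial_deriv_has_real_derivative[OF this]
  have "(h has_real_derivative s * (N $ i - grad \<gamma> x \<bullet> N)) (at 0)"
    unfolding h_def using dg by (auto intro!: derivative_eq_intros)
  also have "s * (N $ i - grad \<gamma> x \<bullet> N) = - (s * ((grad \<gamma> x - axis i 1) \<bullet> N))"
    by (simp add: inner_diff_left inner_axis' algebra_simps)
  also have "\<dots> = - ((1 + (norm (grad \<gamma> x))\<^sup>2) / sqrt (1 + (norm (grad \<gamma> x))\<^sup>2))"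
    using C(3) norm_conormal_square[OF C(4), of x] by (auto simp: N_def chart_normal_def)
  finally have d: "(h has_real_derivative - ((1 + (norm (grad \<gamma> x))\<^sup>2) / sqrt (1 + (norm (grad \<gamma> x))\<^sup>2))) (at 0)" .
  moreover have "- ((1 + (norm (grad \<gamma> x))\<^sup>2) / sqrt (1 + (norm (grad \<gamma> x))\<^sup>2)) < 0"
    using sqrt_one_plus_norm_pos[of "grad \<gamma> x"] by (auto intro!: divide_pos_pos add_pos_nonneg)
  ultimately obtain d1 d2 where d: "d1 > 0" "\<And>t. 0 < t \<Longrightarrow> t < d1 \<Longrightarrow> h (0 - t) > h 0"
    "d2 > 0" "\<And>t. 0 < t \<Longrightarrow> t < d2 \<Longrightarrow> h 0 > h (0 + t)"
    using DERIV_neg_dec_left DERIV_neg_dec_right by metis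
  have h0: "h 0 = 0" using x by (simp add: h_def)
  obtain e where e: "e > 0" "ball x e \<subseteq> ball p r" using x(1) open_ball openE by blast
  have n: "norm N = 1" unfolding N_def by (rule norm_chart_normal[OF C(4,3)])
  have "x - t *\<^sub>R N \<in> \<Omega> \<and> x + t *\<^sub>R N \<notin> closure \<Omega>" if t: "0 < t" "t < min (min d1 d2) e" for t
  proof -
    have b: "x - t *\<^sub>R N \<in> ball p r" "x + t *\<^sub>R N \<in> ball p r"
      using t e(2) n by (auto simp: subset_iff dist_norm)
    have "h (- t) > 0" "h t < 0" using d(2)[of t] d(4)[of t] t h0 by auto
    then show ?thesis
      using C(5)[OF b(1)] chart_complement_disjoint[OF c b(2)] by (simp add: h_def algebra_simps)
  qed
  then show ?thesis
    using d e by (intro eventually_at_rightI[of 0 "min (min d1 d2) e"]) auto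
qed

text \<open>A point of the graph is approached from inside the domain along the normal.\<close>

lemma chart_frontier_iff:
  assumes c: "chart \<Omega> p r i s \<gamma>" and x: "x \<in> ball p r"
  shows "x \<in> frontier \<Omega> \<longleftrightarrow> x $ i = \<gamma> x"
proof
  note C = chartD[OF c]
  assume "x \<in> frontier \<Omega>"
  then have "x \<in> closure \<Omega>" "x \<notin> \<Omega>" using C(1) by (auto simp: frontier_def interior_open)
  then have "\<not> s * (x $ i) < s * \<gamma> x" "\<not> s * (x $ i) > s * \<gamma> x"
    using chart_complement_disjoint[OF c x] C(5)[OF x] by blast+
  then have "s * (x $ i) = s * \<gamma> x" by linarith
  moreover have "s \<noteq> 0" using C(3) by auto
  ultimately show "x $ i = \<gamma> x" by simp
next
  note C = chartD[OF c]
  assume e: "x $ i = \<gamma> x"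
  then have "x \<notin> \<Omega>" using C(5)[OF x] by simp
  moreover have "x \<in> closure \<Omega>"
  proof -
    define N where "N = chart_normal i s \<gamma> x"
    have "\<forall>\<^sub>F t in at_right 0. x - t *\<^sub>R N \<in> closure \<Omega>"
      using chart_normal_cross[OF c x e] closure_subset unfolding N_def
      by (auto elim!: eventually_mono)
    moreover have "((\<lambda>t. x - t *\<^sub>R N) \<longlongrightarrow> x - 0 *\<^sub>R N) (at_right 0)" by (intro tendsto_intros)
    ultimately show ?thesis by (intro Lim_in_closed_set[of "closure \<Omega>" "\<lambda>t. x - t *\<^sub>R N" "at_right 0"]) auto
  qed
  ultimately show "x \<in> frontier \<Omega>" using C(1) by (simp add: frontier_def interior_open)
qed

lemma chart_graph_patch:
  "chart \<Omega> p r i s \<gamma> \<Longrightarrow> graph_patch (frontier \<Omega>) i (ball p r) \<gamma>"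
  using chart_frontier_iff chartD(4) unfolding graph_patch_def by fastforce

text \<open>Every tangent vector is the velocity of a curve in the boundary: project the straight line
  vertically onto the graph.\<close>

lemma chart_tangent_curve:
  assumes c: "chart \<Omega> p r i s \<gamma>" and x: "x \<in> ball p r" "x $ i = \<gamma> x"
    and \<tau>: "\<tau> \<bullet> chart_normal i s \<gamma> x = 0"
  obtains \<alpha> where "\<alpha> 0 = x" "(\<alpha> has_vector_derivative \<tau>) (at 0)" "\<forall>\<^sub>F t in at 0. \<alpha> t \<in> frontier \<Omega>"
proof -
  note C = chartD[OF c]
  have "\<tau> \<bullet> (grad \<gamma> x - axis i 1) = 0"
    using \<tau> C(3) sqrt_one_plus_norm_pos[of "grad \<gamma> x"] by (auto simp: chart_normal_def)
  then have \<tau>: "grad \<gamma> x \<bullet> \<tau> = \<tau> $ i"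
    by (simp add: inner_diff_right inner_axis inner_commute[of \<tau> "grad \<gamma> x"])
  define \<alpha> where "\<alpha> t = x + t *\<^sub>R \<tau> + (\<gamma> (x + t *\<^sub>R \<tau>) - (x + t *\<^sub>R \<tau>) $ i) *\<^sub>R axis i 1" for t
  have a0: "\<alpha> 0 = x" using x by (simp add: \<alpha>_def)
  have "\<gamma> differentiable (at (x + 0 *\<^sub>R \<tau>))"
    using smooth_height_has_derivative[OF C(4)] by (auto simp: differentiable_def)
  from partial_deriv_has_real_derivative[OF this]
  have dg: "((\<lambda>t. \<gamma> (x + t *\<^sub>R \<tau>)) has_derivative (\<lambda>h. h * (\<tau> $ i))) (at 0)"
    using \<tau> by (simp add: has_field_derivative_def mult.commute[of _ "\<tau> $ i"])
  have d: "(\<alpha> has_vector_derivative \<tau>) (at 0)"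
    unfolding \<alpha>_def has_vector_derivative_def
    by (auto intro!: derivative_eq_intros dg)
  have "isCont \<alpha> 0" using d has_vector_derivative_continuous by blast
  then have "(\<alpha> \<longlongrightarrow> x) (at 0)" using a0 by (simp add: isCont_def)
  then have "\<forall>\<^sub>F t in at 0. \<alpha> t \<in> ball p r" using x(1) topological_tendstoD open_ball by blast
  then have "\<forall>\<^sub>F t in at 0. \<alpha> t \<in> frontier \<Omega>"
  proof eventually_elim
    case (elim t)
    have "\<alpha> t $ i = \<gamma> (\<alpha> t)"
      by (simp add: \<alpha>_def smooth_heightD(2)[OF C(4)] del: scaleR_left_diff_distrib)
    then show ?case using chart_frontier_iff[OF c elim] by simp
  qed
  then show ?thesis using that a0 d by blast
qed

lemma chart_normal_orthogonal:
  assumes c: "chart \<Omega> p r i s \<gamma>" and x: "x \<in> ball p r" "x $ i = \<gamma> x"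
  defines "N \<equiv> chart_normal i s \<gamma> x"
  shows "((\<lambda>y. (N \<bullet> (y - x)) / norm (y - x)) \<longlongrightarrow> 0) (at x within frontier \<Omega>)"
proof -
  note C = chartD[OF c]
  define k where "k = s / sqrt (1 + (norm (grad \<gamma> x))\<^sup>2)"
  have "((\<lambda>y. norm (\<gamma> y - \<gamma> x - grad \<gamma> x \<bullet> (y - x)) / norm (y - x)) \<longlongrightarrow> 0) (at x within frontier \<Omega>)"
    using smooth_height_has_derivative[OF C(4), of x "frontier \<Omega>"] by (simp add: has_derivative_iff_norm)
  then have l: "((\<lambda>y. \<bar>k\<bar> * (norm (\<gamma> y - \<gamma> x - grad \<gamma> x \<bullet> (y - x)) / norm (y - x))) \<longlongrightarrow> 0) (at x within frontier \<Omega>)"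
    by (rule tendsto_mult_right_zero)
  have "\<forall>\<^sub>F y in at x within frontier \<Omega>. y \<in> ball p r"
    using x(1) topological_tendstoD[OF tendsto_ident_at] open_ball by blast
  moreover have "\<forall>\<^sub>F y in at x within frontier \<Omega>. y \<in> frontier \<Omega>"
    by (simp add: eventually_at_filter)
  ultimately have "\<forall>\<^sub>F y in at x within frontier \<Omega>.
      \<bar>k\<bar> * (norm (\<gamma> y - \<gamma> x - grad \<gamma> x \<bullet> (y - x)) / norm (y - x)) = \<bar>(N \<bullet> (y - x)) / norm (y - x)\<bar>"
  proof eventually_elim
    case (elim y)
    then have "y $ i = \<gamma> y" using chart_frontier_iff[OF c] by simp
    then have "N \<bullet> (y - x) = - k * (\<gamma> y - \<gamma> x - grad \<gamma> x \<bullet> (y - x))"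
      using x(2) by (simp add: N_def chart_normal_def k_def[symmetric] inner_diff_left inner_diff_right inner_axis' algebra_simps)
    then show ?case by (simp add: abs_mult)
  qed
  from Lim_transform_eventually[OF l this] show ?thesis by (simp only: tendsto_rabs_zero_iff)
qed

text \<open>Otherwise \<open>\<nu>\<close> has a tangential component \<open>\<tau> \<noteq> 0\<close>. Along a boundary curve with velocity \<open>\<tau>\<close> the difference quotients
  \<open>\<nu> \<bullet> (y - x) / norm (y - x)\<close> have absolute values tending to the length of \<open>\<tau>\<close>.\<close>

lemma orthogonal_limit_imp_parallel:
  assumes c: "chart \<Omega> p r i s \<gamma>" and x: "x \<in> ball p r" "x $ i = \<gamma> x"
    and \<nu>: "((\<lambda>y. (\<nu> \<bullet> (y - x)) / norm (y - x)) \<longlongrightarrow> 0) (at x within frontier \<Omega>)"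
  shows "\<nu> = (\<nu> \<bullet> chart_normal i s \<gamma> x) *\<^sub>R chart_normal i s \<gamma> x"
proof -
  note C = chartD[OF c]
  define N where "N = chart_normal i s \<gamma> x"
  have N1: "N \<bullet> N = 1" using norm_chart_normal[OF C(4,3), of x] by (simp add: N_def norm_eq_1)
  define \<tau> where "\<tau> = \<nu> - (\<nu> \<bullet> N) *\<^sub>R N"
  have \<tau>N: "\<tau> \<bullet> N = 0" by (simp add: \<tau>_def inner_diff_left N1)
  show ?thesis
  proof (rule ccontr)
    assume "\<not> ?thesis"
    then have \<tau>0: "\<tau> \<noteq> 0" by (simp add: \<tau>_def N_def)
    obtain \<alpha> where \<alpha>: "\<alpha> 0 = x" "(\<alpha> has_vector_derivative \<tau>) (at 0)" "\<forall>\<^sub>F t in at 0. \<alpha> t \<in> frontier \<Omega>"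
      using chart_tangent_curve[OF c x, of \<tau>] \<tau>N unfolding N_def by blast
    have q: "((\<lambda>t. (1 / t) *\<^sub>R (\<alpha> t - x)) \<longlongrightarrow> \<tau>) (at 0)"
    proof -
      have "((\<lambda>t. norm (\<alpha> t - \<alpha> 0 - (t - 0) *\<^sub>R \<tau>) / norm (t - 0)) \<longlongrightarrow> 0) (at 0)"
        using \<alpha>(2) unfolding has_vector_derivative_def has_derivative_iff_norm by blast
      moreover have "\<forall>\<^sub>F t in at 0. norm (\<alpha> t - \<alpha> 0 - (t - 0) *\<^sub>R \<tau>) / norm (t - 0)
          = norm ((1 / t) *\<^sub>R (\<alpha> t - x) - \<tau>)"
      proof -
        have "norm (\<alpha> t - \<alpha> 0 - (t - 0) *\<^sub>R \<tau>) / norm (t - 0) = norm ((1 / t) *\<^sub>R (\<alpha> t - x) - \<tau>)"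
          if "t \<noteq> 0" for t
        proof -
          have "(1 / t) *\<^sub>R (\<alpha> t - x) - \<tau> = (1 / t) *\<^sub>R (\<alpha> t - x - t *\<^sub>R \<tau>)"
            using that by (simp add: scaleR_diff_right)
          then show ?thesis using \<alpha>(1) by (simp add: divide_inverse_commute)
        qed
        then show ?thesis by (simp add: eventually_at_filter)
      qed
      ultimately have "((\<lambda>t. norm ((1 / t) *\<^sub>R (\<alpha> t - x) - \<tau>)) \<longlongrightarrow> 0) (at 0)"
        by (rule Lim_transform_eventually)
      then show ?thesis by (rule LIM_zero_cancel[OF tendsto_norm_zero_cancel])
    qed
    have "isCont \<alpha> 0" using \<alpha>(2) has_vector_derivative_continuous by blast
    then have ax: "(\<alpha> \<longlongrightarrow> x) (at 0)" using \<alpha>(1) by (simp add: isCont_def)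
    have "\<forall>\<^sub>F t in at 0. (1 / t) *\<^sub>R (\<alpha> t - x) \<noteq> 0"
      using tendsto_imp_eventually_ne[OF q \<tau>0] .
    then have ne: "\<forall>\<^sub>F t in at 0. \<alpha> t \<noteq> x" by eventually_elim auto
    have "filterlim \<alpha> (at x within frontier \<Omega>) (at 0)"
      using ax \<alpha>(3) ne by (auto simp: filterlim_at eventually_conj_iff)
    then have "((\<lambda>t. (\<nu> \<bullet> (\<alpha> t - x)) / norm (\<alpha> t - x)) \<longlongrightarrow> 0) (at 0)"
      by (rule filterlim_compose[OF \<nu>])
    then have "((\<lambda>t. \<bar>(\<nu> \<bullet> (\<alpha> t - x)) / norm (\<alpha> t - x)\<bar> * norm ((1 / t) *\<^sub>R (\<alpha> t - x))) \<longlongrightarrow> 0 * norm \<tau>) (at 0)"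
      using q by (intro tendsto_mult tendsto_norm tendsto_rabs_zero)
    moreover have "\<forall>\<^sub>F t in at 0. \<bar>(\<nu> \<bullet> (\<alpha> t - x)) / norm (\<alpha> t - x)\<bar> * norm ((1 / t) *\<^sub>R (\<alpha> t - x))
         = \<bar>\<nu> \<bullet> ((1 / t) *\<^sub>R (\<alpha> t - x))\<bar>"
      using ne by eventually_elim (simp add: abs_mult)
    ultimately have "((\<lambda>t. \<bar>\<nu> \<bullet> ((1 / t) *\<^sub>R (\<alpha> t - x))\<bar>) \<longlongrightarrow> 0) (at 0)"
      using Lim_transform_eventually by force
    moreover have "((\<lambda>t. \<bar>\<nu> \<bullet> ((1 / t) *\<^sub>R (\<alpha> t - x))\<bar>) \<longlongrightarrow> \<bar>\<nu> \<bullet> \<tau>\<bar>) (at 0)"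
      using q by (intro tendsto_intros)
    ultimately have "\<bar>\<nu> \<bullet> \<tau>\<bar> = 0" using tendsto_unique[of "at (0::real)"] by force
    moreover have "\<nu> \<bullet> \<tau> = \<tau> \<bullet> \<tau>"
      using \<tau>N by (simp add: \<tau>_def inner_diff_left inner_diff_right inner_commute)
    ultimately show False using \<tau>0 by simp
  qed
qed

text \<open>Orthogonality determines the normal up to sign, and the side on which the domain lies determines the sign.\<close>

lemma outer_normal_chart:
  assumes c: "chart \<Omega> p r i s \<gamma>" and x: "x \<in> ball p r" "x \<in> frontier \<Omega>"
  shows "outer_normal \<Omega> x = chart_normal i s \<gamma> x"
  unfolding outer_normal_def
proof (rule the_equality)
  note C = chartD[OF c]
  have xi: "x $ i = \<gamma> x" using chart_frontier_iff[OF c] x by blast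
  define N where "N = chart_normal i s \<gamma> x"
  have N1: "norm N = 1" using norm_chart_normal[OF C(4,3), of x] by (simp add: N_def)
  note cross = chart_normal_cross[OF c x(1) xi, folded N_def]
  show "norm (chart_normal i s \<gamma> x) = 1 \<and>
    ((\<lambda>y. chart_normal i s \<gamma> x \<bullet> (y - x) / norm (y - x)) \<longlongrightarrow> 0) (at x within frontier \<Omega>) \<and>
    (\<forall>\<^sub>F t in at_right 0. x - t *\<^sub>R chart_normal i s \<gamma> x \<in> \<Omega> \<and> x + t *\<^sub>R chart_normal i s \<gamma> x \<notin> closure \<Omega>)"
    using cross N1 chart_normal_orthogonal[OF c x(1) xi] by (simp add: N_def)
  fix \<nu>
  assume \<nu>: "norm \<nu> = 1 \<and> ((\<lambda>y. \<nu> \<bullet> (y - x) / norm (y - x)) \<longlongrightarrow> 0) (at x within frontier \<Omega>) \<and>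
    (\<forall>\<^sub>F t in at_right 0. x - t *\<^sub>R \<nu> \<in> \<Omega> \<and> x + t *\<^sub>R \<nu> \<notin> closure \<Omega>)"
  have par: "\<nu> = (\<nu> \<bullet> N) *\<^sub>R N"
    using orthogonal_limit_imp_parallel[OF c x(1) xi] \<nu> unfolding N_def by blast
  then have "\<bar>\<nu> \<bullet> N\<bar> = 1" using N1 \<nu> by (metis mult.right_neutral norm_scaleR)
  then consider "\<nu> = N" | "\<nu> = - N" using par by (metis abs_eq_iff' abs_1 scaleR_minus1_left scaleR_one)
  then show "\<nu> = chart_normal i s \<gamma> x"
  proof cases
    case 2
    then have "\<forall>\<^sub>F t in at_right 0. x + t *\<^sub>R N \<in> \<Omega>" using \<nu> by (auto elim!: eventually_mono)
    with cross have "\<forall>\<^sub>F t in at_right (0::real). False"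
      by eventually_elim (use closure_subset in auto)
    then show ?thesis by simp
  qed (simp add: N_def)
qed

section \<open>The surface measure of a graph\<close>

definition graph_measure :: "'n::finite \<Rightarrow> (real^'n \<Rightarrow> real) \<Rightarrow> (real^'n) measure" where
  "graph_measure i \<gamma> = distr (density (hplane_measure i)
     (\<lambda>z. ennreal (sqrt (1 + (norm (grad \<gamma> (hyper i z)))\<^sup>2)))) borel (graph_point i \<gamma>)"

lemma sets_graph_measure [simp, measurable_cong]: "sets (graph_measure i \<gamma>) = sets borel"
  by (simp add: graph_measure_def)

lemma space_graph_measure [simp]: "space (graph_measure i \<gamma>) = UNIV"
  by (simp add: graph_measure_def)

lemma continuous_area_factor:
  assumes "smooth_height i \<gamma>"
  shows "continuous_on S (\<lambda>x. sqrt (1 + (norm (grad \<gamma> x))\<^sup>2))"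
proof -
  have "continuous_on S (partial_deriv j \<gamma>)" for j
    using smooth_heightD(1)[OF assms, of 1] continuous_on_subset by auto
  then have "continuous_on S (grad \<gamma>)" unfolding grad_def by (intro continuous_on_vec_lambda)
  then show ?thesis by (intro continuous_intros)
qed

lemma area_factor_measurable:
  assumes "smooth_height i \<gamma>"
  shows "(\<lambda>z. sqrt (1 + (norm (grad \<gamma> (hyper i z)))\<^sup>2)) \<in> borel_measurable (hplane_measure i)"
  using measurable_compose[OF hyper_measurable borel_measurable_continuous_onI[OF continuous_area_factor[OF assms]]] .

lemma graph_point_measurable:
  assumes "smooth_height i \<gamma>"
  shows "graph_point i \<gamma> \<in> borel_measurable (hplane_measure i)"
proof -
  have "continuous_on UNIV (\<lambda>x. x + \<gamma> x *\<^sub>R axis i 1)"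
    by (intro continuous_intros continuous_on_smooth_height[OF assms])
  from measurable_compose[OF hyper_measurable borel_measurable_continuous_onI[OF this]]
  show ?thesis unfolding graph_point_def[abs_def] .
qed

lemma emeasure_graph_measure:
  assumes "smooth_height i \<gamma>" "A \<in> sets borel"
  shows "emeasure (graph_measure i \<gamma>) A =
    (\<integral>\<^sup>+ z. indicator A (graph_point i \<gamma> z) * ennreal (sqrt (1 + (norm (grad \<gamma> (hyper i z)))\<^sup>2)) \<partial>hplane_measure i)"
proof -
  note [measurable] = graph_point_measurable[OF assms(1)] area_factor_measurable[OF assms(1)] assms(2)
  have "emeasure (graph_measure i \<gamma>) A
     = (\<integral>\<^sup>+ z. ennreal (sqrt (1 + (norm (grad \<gamma> (hyper i z)))\<^sup>2)) *
         indicator (graph_point i \<gamma> -` A \<inter> space (hplane_measure i)) z \<partial>hplane_measure i)"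
    unfolding graph_measure_def
    by (subst emeasure_distr; (subst emeasure_density)?) (auto intro: measurable_sets)
  also have "\<dots> = (\<integral>\<^sup>+ z. indicator A (graph_point i \<gamma> z) * ennreal (sqrt (1 + (norm (grad \<gamma> (hyper i z)))\<^sup>2)) \<partial>hplane_measure i)"
    by (intro nn_integral_cong) (auto simp: indicator_def)
  finally show ?thesis .
qed

lemma AE_graph_measure:
  assumes "smooth_height i \<gamma>"
  shows "AE x in graph_measure i \<gamma>. x $ i = \<gamma> x"
proof (rule AE_I')
  have c: "closed {x. x $ i = \<gamma> x}"
    by (intro closed_Collect_eq continuous_intros continuous_on_smooth_height[OF assms])
  then have m: "{x. x $ i \<noteq> \<gamma> x} \<in> sets borel"
    using borel_closed[OF c] by (metis (no_types) Collect_neg_eq borel_comp)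
  have "graph_point i \<gamma> z $ i = \<gamma> (graph_point i \<gamma> z)" for z
    by (subst smooth_height_hyper(1)[OF assms]) (simp add: graph_point_def hyper_def)
  then have "emeasure (graph_measure i \<gamma>) {x. x $ i \<noteq> \<gamma> x} = 0"
    by (subst emeasure_graph_measure[OF assms m]) simp
  then show "{x. x $ i \<noteq> \<gamma> x} \<in> null_sets (graph_measure i \<gamma>)" using m by (auto simp: null_sets_def)
qed auto

lemma integral_graph_measure:
  fixes f :: "real^'n \<Rightarrow> real"
  assumes \<gamma>: "smooth_height i \<gamma>" and f: "f \<in> borel_measurable borel"
  shows "(\<integral>x. f x \<partial>graph_measure i \<gamma>)
    = (\<integral>z. sqrt (1 + (norm (grad \<gamma> (hyper i z)))\<^sup>2) * f (graph_point i \<gamma> z) \<partial>hplane_measure i)"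
proof -
  note [measurable] = graph_point_measurable[OF assms(1)] area_factor_measurable[OF assms(1)] f
  show ?thesis unfolding graph_measure_def
    by (subst integral_distr; (subst integral_density)?) (auto simp: add_nonneg_nonneg)
qed

text \<open>The part of the graph in a ball lies over a bounded box, and the area factor is bounded on the ball.\<close>

lemma emeasure_graph_measure_cball:
  fixes p :: "real^'n"
  assumes \<gamma>: "smooth_height i \<gamma>"
  shows "emeasure (graph_measure i \<gamma>) (cball p r) < \<infinity>"
proof -
  have "bounded ((\<lambda>x. sqrt (1 + (norm (grad \<gamma> x))\<^sup>2)) ` cball p r)"
    by (intro compact_imp_bounded compact_continuous_image continuous_area_factor[OF \<gamma>] compact_cball)
  then obtain B where B: "\<And>x. x \<in> cball p r \<Longrightarrow> norm (sqrt (1 + (norm (grad \<gamma> x))\<^sup>2)) \<le> B"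
    unfolding bounded_iff by blast
  define Q where "Q = (\<Pi>\<^sub>E j\<in>UNIV - {i}. {p $ j - r .. p $ j + r})"
  have Qm: "Q \<in> sets (hplane_measure i)" unfolding Q_def by (intro sets_PiM_I_finite) auto
  have "emeasure (hplane_measure i) Q = (\<Prod>j\<in>UNIV - {i}. emeasure lborel {p $ j - r .. p $ j + r})"
    unfolding Q_def by (subst lborel_product.emeasure_PiM) auto
  also have "\<dots> < \<infinity>" by (simp add: ennreal_prod_eq_top less_top[symmetric] emeasure_lborel_Icc_eq)
  finally have Qf: "emeasure (hplane_measure i) Q < \<infinity>" .
  have "emeasure (graph_measure i \<gamma>) (cball p r) \<le> (\<integral>\<^sup>+ z. ennreal B * indicator Q z \<partial>hplane_measure i)"
  proof (subst emeasure_graph_measure[OF \<gamma>], simp, rule nn_integral_mono)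
    fix z assume z: "z \<in> space (hplane_measure i)"
    show "indicator (cball p r) (graph_point i \<gamma> z) * ennreal (sqrt (1 + (norm (grad \<gamma> (hyper i z)))\<^sup>2))
       \<le> ennreal B * indicator Q z"
    proof (cases "graph_point i \<gamma> z \<in> cball p r")
      case True
      have zj: "\<bar>p $ j - z j\<bar> \<le> r" if "j \<noteq> i" for j
        using component_le_norm_cart[of "p - graph_point i \<gamma> z" j] True that
        by (simp add: dist_norm graph_point_def hyper_def axis_def)
      have "z \<in> Q" unfolding Q_def
      proof (rule PiE_I)
        show "z j \<in> {p $ j - r .. p $ j + r}" if "j \<in> UNIV - {i}" for j
          using zj[of j] that by (simp add: abs_le_iff)
        show "z j = undefined" if "j \<notin> UNIV - {i}" for j
          using z that unfolding space_PiM by (rule PiE_arb)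
      qed
      moreover have "sqrt (1 + (norm (grad \<gamma> (hyper i z)))\<^sup>2) \<le> B"
        using B[OF True] by (simp add: smooth_height_hyper(2)[OF \<gamma>])
      ultimately show ?thesis using True by (simp add: ennreal_leI)
    qed simp
  qed
  also have "\<dots> = ennreal B * emeasure (hplane_measure i) Q" using Qm by (simp add: nn_integral_cmult)
  also have "\<dots> < \<infinity>" using Qf by (simp add: ennreal_mult_less_top)
  finally show ?thesis .
qed

lemma integrable_graph_measure:
  fixes f :: "real^'n \<Rightarrow> real"
  assumes \<gamma>: "smooth_height i \<gamma>" and f: "continuous_on UNIV f" and K: "\<And>x. x \<notin> cball p r \<Longrightarrow> f x = 0"
  shows "integrable (graph_measure i \<gamma>) f"
proof -
  have "bounded (f ` cball p r)"
    using f by (intro compact_imp_bounded compact_continuous_image compact_cball) (auto intro: continuous_on_subset)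
  then obtain B where B: "\<And>x. x \<in> cball p r \<Longrightarrow> norm (f x) \<le> B"
    unfolding bounded_iff by blast
  show ?thesis
    by (rule integrableI_bounded_set[of "cball p r" _ _ B])
       (use B K emeasure_graph_measure_cball[OF \<gamma>, of p r] borel_measurable_continuous_onI[OF f] in
        \<open>auto cong: measurable_cong_sets\<close>)
qed

text \<open>The area factor cancels the normalization of the normal.\<close>

lemma gauss_chart:
  fixes F :: "real^'n \<Rightarrow> real^'n"
  assumes c: "chart \<Omega> p r i s \<gamma>" and F: "\<And>j. Ck_on 1 UNIV (\<lambda>x. F x $ j)"
    and K: "cball q \<rho> \<subseteq> ball p r" "\<And>x. x \<notin> cball q \<rho> \<Longrightarrow> F x = 0"
  shows "(\<integral>x. indicator \<Omega> x * divergence F x \<partial>lborel) = (\<integral>x. F x \<bullet> chart_normal i s \<gamma> x \<partial>graph_measure i \<gamma>)"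
proof -
  note C = chartD[OF c]
  let ?E = "{x. s * x $ i > s * \<gamma> x}"
  have pz: "partial_deriv j (\<lambda>x. F x $ k) x = 0" if "x \<notin> cball q \<rho>" for j k x
    by (rule partial_deriv_zero_off_closed[of "cball q \<rho>"]) (use K(2) that in auto)
  obtain M where M: "cball q \<rho> \<subseteq> ball 0 M" using bounded_subset_ballD[OF bounded_cball, of q \<rho> 0] by blast
  have supp: "F x $ j = 0" if "norm x > M" for x j
    using K(2)[of x] M that by fastforce
  have cp: "continuous_on UNIV (partial_deriv j (\<lambda>x. F x $ j))" for j using F[of j] by simp
  have cF: "continuous_on UNIV (\<lambda>x. F x $ j)" for j using Ck_on_continuous[OF F] .
  have cN: "continuous_on UNIV (\<lambda>x. chart_normal i s \<gamma> x $ j)" for j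
    using Ck_on_continuous[OF Ck_on_chart_normal[OF C(4)]] .
  have i1: "integrable lborel (\<lambda>x. indicator \<Omega> x * partial_deriv j (\<lambda>x. F x $ j) x)" for j
    by (rule integrable_compact_support[OF cp compact_cball[of q \<rho>]]) (use pz C(1) in auto)
  have "(\<integral>x. indicator \<Omega> x * divergence F x \<partial>lborel)
      = (\<integral>x. (\<Sum>j\<in>UNIV. indicator \<Omega> x * partial_deriv j (\<lambda>x. F x $ j) x) \<partial>lborel)"
    by (simp add: divergence_def sum_distrib_left)
  also have "\<dots> = (\<Sum>j\<in>UNIV. \<integral>x. indicator \<Omega> x * partial_deriv j (\<lambda>x. F x $ j) x \<partial>lborel)"
    by (intro Bochner_Integration.integral_sum i1)
  also have "\<dots> = (\<Sum>j\<in>UNIV. \<integral>x. F x $ j * chart_normal i s \<gamma> x $ j \<partial>graph_measure i \<gamma>)"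
  proof (rule sum.cong[OF refl])
    fix j
    have "(\<integral>x. indicator \<Omega> x * partial_deriv j (\<lambda>x. F x $ j) x \<partial>lborel)
      = (\<integral>x. indicator ?E x * partial_deriv j (\<lambda>x. F x $ j) x \<partial>lborel)"
    proof (intro Bochner_Integration.integral_cong refl)
      fix x
      show "indicator \<Omega> x * partial_deriv j (\<lambda>x. F x $ j) x = indicator ?E x * partial_deriv j (\<lambda>x. F x $ j) x"
      proof (cases "x \<in> cball q \<rho>")
        case True
        then have "x \<in> ball p r" using K(1) by blast
        then show ?thesis using C(5) by (simp add: indicator_def)
      qed (simp add: pz)
    qed
    also have "\<dots> = (\<integral>z. s * (grad \<gamma> (hyper i z) - axis i 1) $ j * F (graph_point i \<gamma> z) $ j \<partial>hplane_measure i)"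
      by (rule gauss_graph[OF F supp C(3,4)])
    also have "\<dots> = (\<integral>z. sqrt (1 + (norm (grad \<gamma> (hyper i z)))\<^sup>2) *
         (F (graph_point i \<gamma> z) $ j * chart_normal i s \<gamma> (graph_point i \<gamma> z) $ j) \<partial>hplane_measure i)"
    proof (intro Bochner_Integration.integral_cong refl)
      fix z
      have "sqrt (1 + (norm (grad \<gamma> (hyper i z)))\<^sup>2) \<noteq> 0"
        using sqrt_one_plus_norm_pos[of "grad \<gamma> (hyper i z)"] by simp
      then show "s * (grad \<gamma> (hyper i z) - axis i 1) $ j * F (graph_point i \<gamma> z) $ j
        = sqrt (1 + (norm (grad \<gamma> (hyper i z)))\<^sup>2) *
         (F (graph_point i \<gamma> z) $ j * chart_normal i s \<gamma> (graph_point i \<gamma> z) $ j)"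
        by (simp add: chart_normal_def smooth_height_hyper(2)[OF C(4)] field_simps del: real_sqrt_eq_zero_cancel_iff)
    qed
    also have "\<dots> = (\<integral>x. F x $ j * chart_normal i s \<gamma> x $ j \<partial>graph_measure i \<gamma>)"
      by (rule integral_graph_measure[symmetric, OF C(4)])
         (intro borel_measurable_continuous_onI continuous_intros cF cN)
    finally show "(\<integral>x. indicator \<Omega> x * partial_deriv j (\<lambda>x. F x $ j) x \<partial>lborel)
       = (\<integral>x. F x $ j * chart_normal i s \<gamma> x $ j \<partial>graph_measure i \<gamma>)" .
  qed
  also have "\<dots> = (\<integral>x. (\<Sum>j\<in>UNIV. F x $ j * chart_normal i s \<gamma> x $ j) \<partial>graph_measure i \<gamma>)"
    by (intro Bochner_Integration.integral_sum[symmetric] integrable_graph_measure[OF C(4), where p=q and r=\<rho>])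
       (use K(2) cF cN in \<open>auto intro!: continuous_on_mult\<close>)
  finally show ?thesis by (simp add: inner_vec_def)
qed


section \<open>Independence of the chart and existence of the surface measure\<close>

text \<open>Apply the divergence theorem in both charts to \<open>\<phi>\<close> times the normal of the first chart. The left-hand sides agree,
  and on the boundary the two normals agree.\<close>

lemma graph_measure_test_function:
  fixes \<phi> :: "real^'n \<Rightarrow> real"
  assumes c: "chart \<Omega> p r i s \<gamma>" and c': "chart \<Omega> p' r' i' s' \<gamma>'"
    and q: "cball q \<rho> \<subseteq> ball p r" "cball q \<rho> \<subseteq> ball p' r'"
    and \<phi>: "Ck_on 1 UNIV \<phi>" "\<And>x. x \<notin> cball q \<rho> \<Longrightarrow> \<phi> x = 0"
  shows "(\<integral>x. \<phi> x \<partial>graph_measure i \<gamma>) = (\<integral>x. \<phi> x \<partial>graph_measure i' \<gamma>')"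
proof -
  note C = chartD[OF c] and C' = chartD[OF c']
  let ?N = "chart_normal i s \<gamma>" and ?N' = "chart_normal i' s' \<gamma>'"
  define F where "F x = \<phi> x *\<^sub>R ?N x" for x
  have F: "Ck_on 1 UNIV (\<lambda>x. F x $ j)" for j
    unfolding F_def vector_scaleR_component
    using Ck_on_mult[OF open_UNIV \<phi>(1) Ck_on_chart_normal[OF C(4)]] by simp
  have F0: "\<And>x. x \<notin> cball q \<rho> \<Longrightarrow> F x = 0" using \<phi>(2) by (simp add: F_def)
  have cF: "continuous_on UNIV F"
    using Ck_on_continuous[OF F] continuous_on_vec_lambda[of UNIV "\<lambda>j x. F x $ j"] by simp
  have cN': "continuous_on UNIV ?N'"
    using Ck_on_continuous[OF Ck_on_chart_normal[OF C'(4), of 1 s']]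
      continuous_on_vec_lambda[of UNIV "\<lambda>j x. ?N' x $ j"] by simp
  have "(\<integral>x. \<phi> x \<partial>graph_measure i \<gamma>) = (\<integral>x. F x \<bullet> ?N x \<partial>graph_measure i \<gamma>)"
    using norm_chart_normal[OF C(4,3)] by (simp add: F_def norm_eq_1)
  also have "\<dots> = (\<integral>x. F x \<bullet> ?N' x \<partial>graph_measure i' \<gamma>')"
    using gauss_chart[OF c F q(1) F0] gauss_chart[OF c' F q(2) F0] by simp
  also have "\<dots> = (\<integral>x. \<phi> x \<partial>graph_measure i' \<gamma>')"
  proof (rule integral_cong_AE)
    show "AE x in graph_measure i' \<gamma>'. F x \<bullet> ?N' x = \<phi> x"
      using AE_graph_measure[OF C'(4)]
    proof eventually_elim
      case (elim x)
      show ?case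
      proof (cases "x \<in> cball q \<rho>")
        case True
        then have x: "x \<in> ball p r" "x \<in> ball p' r'" using q by auto
        then have "x \<in> frontier \<Omega>" using chart_frontier_iff[OF c'] elim by blast
        then have "?N x = ?N' x" using outer_normal_chart[OF c x(1)] outer_normal_chart[OF c' x(2)] by simp
        then show ?thesis using norm_chart_normal[OF C'(4,3), of x] by (simp add: F_def norm_eq_1)
      qed (simp add: F0 \<phi>(2))
    qed
  next
    have "(\<lambda>x. F x \<bullet> ?N' x) \<in> borel_measurable borel"
      by (intro borel_measurable_continuous_onI continuous_intros cF cN')
    then show "(\<lambda>x. F x \<bullet> ?N' x) \<in> borel_measurable (graph_measure i' \<gamma>')"
      by (simp cong: measurable_cong_sets)
    show "\<phi> \<in> borel_measurable (graph_measure i' \<gamma>')"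
      using borel_measurable_continuous_onI[OF Ck_on_continuous[OF \<phi>(1)]]
      by (simp cong: measurable_cong_sets)
  qed
  finally show ?thesis .
qed

text \<open>The functions \<open>1 - (1 - m g)\<^sub>+\<^sup>2\<close> approximate the indicator of the set where \<open>g\<close> is positive.\<close>

lemma measure_positivity_set_eq_limit:
  fixes M :: "(real^'n) measure" and g :: "real^'n \<Rightarrow> real"
  assumes M: "sets M = sets borel" "emeasure M (cball q \<rho>) < \<infinity>"
    and g: "continuous_on UNIV g" "\<And>x. g x \<ge> 0" "\<And>x. x \<notin> cball q \<rho> \<Longrightarrow> g x = 0"
  shows "(\<lambda>m. \<integral>x. (1 - (max 0 (1 - real m * g x))\<^sup>2) \<partial>M) \<longlonglongrightarrow> measure M {x. g x > 0}"
proof -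
  have cg: "g \<in> borel_measurable M"
    using borel_measurable_continuous_onI[OF g(1)] M(1) by (simp cong: measurable_cong_sets)
  note [measurable] = cg
  have sp: "space M = UNIV" using sets_eq_imp_space_eq[OF M(1)] by simp
  have "(\<lambda>m. \<integral>x. (1 - (max 0 (1 - real m * g x))\<^sup>2) \<partial>M) \<longlonglongrightarrow> (\<integral>x. indicator {x. g x > 0} x \<partial>M)"
  proof (rule integral_dominated_convergence[where w="indicator (cball q \<rho>)"])
    have "cball q \<rho> \<in> sets M" by (simp add: M(1))
    then show "integrable M (indicator (cball q \<rho>) :: _ \<Rightarrow> real)" using M(2) by simp
    have "{x \<in> space M. g x > 0} \<in> sets M" by measurable
    then show "(indicator {x. g x > 0} :: _ \<Rightarrow> real) \<in> borel_measurable M" using sp by simp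
    show "(\<lambda>x. 1 - (max 0 (1 - real m * g x))\<^sup>2) \<in> borel_measurable M" for m by measurable
    show "AE x in M. (\<lambda>m. 1 - (max 0 (1 - real m * g x))\<^sup>2) \<longlonglongrightarrow> indicator {x. g x > 0} x"
    proof (rule AE_I2)
      fix x
      show "(\<lambda>m. 1 - (max 0 (1 - real m * g x))\<^sup>2) \<longlonglongrightarrow> indicator {x. g x > 0} x"
      proof (cases "g x > 0")
        case True
        obtain k :: nat where k: "1 / g x < real k" using reals_Archimedean2 by blast
        have "1 - (max 0 (1 - real m * g x))\<^sup>2 = 1" if "m \<ge> k" for m
        proof -
          have "1 / g x \<le> real m" using k that by linarith
          then have "1 \<le> real m * g x" using True by (simp add: pos_divide_le_eq)
          then show ?thesis by (simp add: max_def)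
        qed
        then show ?thesis
          using True by (intro tendsto_eventually eventually_sequentiallyI[of k]) simp
      next
        case False
        then have "g x = 0" using g(2)[of x] by simp
        then show ?thesis by simp
      qed
    qed
    show "AE x in M. norm (1 - (max 0 (1 - real m * g x))\<^sup>2) \<le> indicator (cball q \<rho>) x" for m
    proof (rule AE_I2)
      fix x
      have a: "0 \<le> real m * g x" using g(2) by simp
      then have "(max 0 (1 - real m * g x))\<^sup>2 \<le> 1" by (intro power_le_one) auto
      then show "norm (1 - (max 0 (1 - real m * g x))\<^sup>2) \<le> indicator (cball q \<rho>) x"
        using g(3)[of x] by (auto simp: indicator_def)
    qed
  qed
  then show ?thesis by (simp add: sp)
qed

lemma emeasure_density_indicator:
  assumes "B \<in> sets M" "X \<in> sets M"
  shows "emeasure (density M (indicator B)) X = emeasure M (X \<inter> B)"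
proof -
  have "emeasure (density M (indicator B)) X = (\<integral>\<^sup>+x. indicator B x * indicator X x \<partial>M)"
    using assms by (intro emeasure_density) auto
  also have "\<dots> = (\<integral>\<^sup>+x. indicator (X \<inter> B) x \<partial>M)"
    by (simp add: indicator_inter_arith mult.commute)
  finally show ?thesis using assms by simp
qed

text \<open>The intersection of a box with the ball is the positivity set of a \<open>C\<^sup>1\<close> function, so its measure is a limit of
  integrals of test functions. Boxes generate the Borel sets and are stable under intersection.\<close>

lemma graph_measure_chart_independent:
  fixes A :: "(real^'n) set"
  assumes c: "chart \<Omega> p r i s \<gamma>" and c': "chart \<Omega> p' r' i' s' \<gamma>'"
    and q: "cball q \<rho> \<subseteq> ball p r" "cball q \<rho> \<subseteq> ball p' r'"
    and A: "A \<in> sets borel" "A \<subseteq> ball q \<rho>"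
  shows "emeasure (graph_measure i \<gamma>) A = emeasure (graph_measure i' \<gamma>') A"
proof -
  note C = chartD[OF c] and C' = chartD[OF c']
  let ?B = "ball q \<rho>"
  let ?M = "\<lambda>i \<gamma>. density (graph_measure i \<gamma>) (indicator ?B) :: (real^'n) measure"
  have em: "emeasure (?M i \<gamma>) X = emeasure (graph_measure i \<gamma>) (X \<inter> ?B)" if "X \<in> sets borel" for i \<gamma> X
    using that by (intro emeasure_density_indicator) auto
  have fin: "emeasure (graph_measure i \<gamma>) (X \<inter> ?B) < \<infinity>" if "smooth_height i \<gamma>" for i \<gamma> X
    using emeasure_mono[of "X \<inter> ?B" "cball q \<rho>" "graph_measure i \<gamma>"]
      emeasure_graph_measure_cball[OF that, of q \<rho>] ball_subset_cball by fastforce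
  have "?M i \<gamma> = ?M i' \<gamma>'"
  proof (rule measure_eqI_generator_eq)
    let ?E = "range (\<lambda>(a, b). box a b :: (real^'n) set)"
    show "Int_stable ?E" by (auto simp: Int_stable_def box_Int_box)
    show "?E \<subseteq> Pow UNIV" "sets (?M i \<gamma>) = sigma_sets UNIV ?E" "sets (?M i' \<gamma>') = sigma_sets UNIV ?E"
      by (simp_all add: borel_eq_box)
    let ?A = "\<lambda>n::nat. box (- (real n *\<^sub>R One)) (real n *\<^sub>R One) :: (real^'n) set"
    show "range ?A \<subseteq> ?E" "(\<Union>i. ?A i) = UNIV" unfolding UN_box_eq_UNIV by auto
    show "emeasure (?M i \<gamma>) (?A n) \<noteq> \<infinity>" for n using fin[OF C(4), of "?A n"] by (simp add: em)
    fix X assume "X \<in> ?E"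
    then obtain a b where X: "X = box a b" by auto
    define g where "g x = (\<Prod>j\<in>UNIV. (max 0 (x $ j - a $ j)) ^ Suc 1 * (max 0 (b $ j - x $ j)) ^ Suc 1)
        * (max 0 (\<rho>\<^sup>2 - (norm (x - q))\<^sup>2)) ^ Suc 1" for x
    have Cg: "Ck_on 1 UNIV g" unfolding g_def
      by (intro Ck_on_mult Ck_on_prod Ck_on_max0_power Ck_on_diff Ck_on_const Ck_on_nth
          Ck_on_norm_square_diff open_UNIV)
    have g0: "g x \<ge> 0" for x unfolding g_def by (intro mult_nonneg_nonneg prod_nonneg) auto
    have gpos: "g x > 0 \<longleftrightarrow> x \<in> X \<inter> ?B" if "\<rho> > 0" for x
    proof -
      have "g x > 0 \<longleftrightarrow> g x \<noteq> 0" using g0[of x] by auto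
      also have "\<dots> \<longleftrightarrow> (\<forall>j. a $ j < x $ j \<and> x $ j < b $ j) \<and> (norm (x - q))\<^sup>2 < \<rho>\<^sup>2"
      proof -
        have mx: "(max 0 t) ^ Suc 1 = 0 \<longleftrightarrow> \<not> t > 0" for t :: real by (auto simp: max_def)
        have "g x = 0 \<longleftrightarrow> (\<exists>j. \<not> x $ j - a $ j > 0 \<or> \<not> b $ j - x $ j > 0) \<or> \<not> \<rho>\<^sup>2 - (norm (x - q))\<^sup>2 > 0"
          unfolding g_def mult_eq_0_iff prod_zero_iff[OF finite_class.finite_UNIV] mx by blast
        then show ?thesis by auto
      qed
      also have "(norm (x - q))\<^sup>2 < \<rho>\<^sup>2 \<longleftrightarrow> norm (x - q) < \<rho>"
        using that by (metis less_eq_real_def norm_ge_zero not_less power2_le_imp_le power_mono power_strict_mono zero_less_numeral)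
      finally show ?thesis by (auto simp: X mem_box_cart dist_norm norm_minus_commute)
    qed
    show "emeasure (?M i \<gamma>) X = emeasure (?M i' \<gamma>') X"
    proof (cases "\<rho> > 0")
      case True
      have U: "{x. g x > 0} = X \<inter> ?B" using gpos[OF True] by blast
      have gz: "g x = 0" if "x \<notin> cball q \<rho>" for x
        using gpos[OF True, of x] g0[of x] that ball_subset_cball[of q \<rho>] by (metis Int_iff less_eq_real_def subsetD)
      have lim: "(\<lambda>m. \<integral>x. (1 - (max 0 (1 - real m * g x))\<^sup>2) \<partial>graph_measure i \<gamma>)
          \<longlonglongrightarrow> measure (graph_measure i \<gamma>) (X \<inter> ?B)" if "smooth_height i \<gamma>" for i \<gamma>
        using measure_positivity_set_eq_limit[of "graph_measure i \<gamma>" q \<rho> g] Ck_on_continuous[OF Cg]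
          g0 gz emeasure_graph_measure_cball[OF that, of q \<rho>] U by simp
      have "(\<integral>x. (1 - (max 0 (1 - real m * g x))\<^sup>2) \<partial>graph_measure i \<gamma>)
          = (\<integral>x. (1 - (max 0 (1 - real m * g x))\<^sup>2) \<partial>graph_measure i' \<gamma>')" for m
      proof (rule graph_measure_test_function[OF c c' q])
        have "Ck_on 1 UNIV (\<lambda>x. 1 - (max 0 (1 - real m * g x)) ^ Suc 1)"
          by (intro Ck_on_max0_power Ck_on_diff Ck_on_const Ck_on_mult Cg open_UNIV)
        then show "Ck_on 1 UNIV (\<lambda>x. 1 - (max 0 (1 - real m * g x))\<^sup>2)" by (simp add: numeral_2_eq_2)
      qed (simp add: gz)
      then have "measure (graph_measure i \<gamma>) (X \<inter> ?B) = measure (graph_measure i' \<gamma>') (X \<inter> ?B)"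
        using LIMSEQ_unique lim[OF C(4)] lim[OF C'(4)] by simp
      moreover have "X \<in> sets borel" by (simp add: X)
      ultimately show ?thesis
        using fin[OF C(4), of X] fin[OF C'(4), of X] em[of X] by (simp add: emeasure_eq_ennreal_measure)
    qed (use em[of X] X in \<open>simp add: not_less ball_empty\<close>)
  qed
  then show ?thesis using em[OF A(1), of i \<gamma>] em[OF A(1), of i' \<gamma>'] A(2) by (simp add: Int_absorb2)
qed

text \<open>By the Lindelof property, countably many of the given neighbourhoods cover \<open>A\<close>; make them disjoint.\<close>

lemma measure_eq_locally:
  fixes M N :: "'a::second_countable_topology measure"
  assumes sets: "sets M = sets borel" "sets N = sets borel"
    and loc: "\<And>x. x \<in> A \<Longrightarrow> \<exists>U. open U \<and> x \<in> U \<and> (\<forall>B\<in>sets borel. B \<subseteq> A \<inter> U \<longrightarrow> emeasure M B = emeasure N B)"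
    and A: "A \<in> sets borel"
  shows "emeasure M A = emeasure N A"
proof -
  define \<F> where "\<F> = {U. open U \<and> (\<forall>B\<in>sets borel. B \<subseteq> A \<inter> U \<longrightarrow> emeasure M B = emeasure N B)}"
  obtain \<G> where \<G>: "\<G> \<subseteq> \<F>" "countable \<G>" "\<Union>\<G> = \<Union>\<F>"
    using Lindelof[of \<F>] unfolding \<F>_def by auto
  have cov: "A \<subseteq> \<Union>\<G>" using loc unfolding \<G>(3) \<F>_def by blast
  show ?thesis
  proof (cases "\<G> = {}")
    case True
    then show ?thesis using cov by simp
  next
    case False
    define U where "U = from_nat_into \<G>"
    have U: "range U = \<G>" unfolding U_def using range_from_nat_into[OF False \<G>(2)] .
    then have U\<F>: "U n \<in> \<F>" for n using \<G>(1) by blast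
    define D where "D n = A \<inter> disjointed U n" for n
    have Ub: "U n \<in> sets borel" for n using U\<F>[of n] by (simp add: \<F>_def)
    have "range (disjointed U) \<subseteq> sets borel"
      using sets.range_disjointed_sets[of U borel] Ub by auto
    then have Db: "range D \<subseteq> sets borel" using A by (auto simp: D_def)
    have dis: "disjoint_family D"
      using disjoint_family_disjointed[of U] unfolding D_def disjoint_family_on_def by blast
    have un: "(\<Union>n. D n) = A"
      using UN_disjointed_eq[of U] cov U unfolding D_def by auto
    have "emeasure M (D n) = emeasure N (D n)" for n
    proof -
      have "D n \<subseteq> A \<inter> U n" using disjointed_subset[of U n] by (auto simp: D_def)
      then show ?thesis using U\<F>[of n] Db unfolding \<F>_def by auto
    qed
    then have "(\<Sum>n. emeasure M (D n)) = (\<Sum>n. emeasure N (D n))" by simp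
    then show ?thesis
      using suminf_emeasure[of D M] suminf_emeasure[of D N] Db dis un sets by simp
  qed
qed

text \<open>A graph patch of the boundary may be given without reference to the domain. Near each of its
  points the complement of the graph has two connected pieces, and the domain fills exactly one of
  them: not none, since the point is in the closure, and not both, since the outer normal of any
  chart leaves the closure.\<close>

lemma graph_patch_imp_chart:
  assumes c: "chart \<Omega> x r j s' \<gamma>'" and gp: "graph_patch (frontier \<Omega>) i W \<gamma>"
    and x: "x \<in> frontier \<Omega>" "x \<in> W"
  obtains \<rho> s where "ball x \<rho> \<subseteq> W" "chart \<Omega> x \<rho> i s \<gamma>"
proof -
  note C = chartD[OF c]
  have W: "open W" and \<gamma>: "smooth_height i \<gamma>" and SW: "frontier \<Omega> \<inter> W = {y \<in> W. y $ i = \<gamma> y}"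
    using gp unfolding graph_patch_def by blast+
  have fi: "y \<in> frontier \<Omega> \<longleftrightarrow> y $ i = \<gamma> y" if "y \<in> W" for y using SW that by blast
  define \<Psi> where "\<Psi> z = z + \<gamma> z *\<^sub>R axis i 1" for z
  define x0 where "x0 = x - \<gamma> x *\<^sub>R axis i 1"
  have \<gamma>m: "\<gamma> (y - t *\<^sub>R axis i 1) = \<gamma> y" for y t
    using smooth_heightD(2)[OF \<gamma>, of y "-t"] by simp
  have \<Psi>x0: "\<Psi> x0 = x" by (simp add: \<Psi>_def x0_def \<gamma>m)
  have c\<Psi>: "continuous_on S \<Psi>" for S
    unfolding \<Psi>_def by (intro continuous_intros continuous_on_smooth_height[OF \<gamma>])
  have "open (\<Psi> -` W)" using W c\<Psi>[of UNIV] continuous_open_vimage by (metis continuous_on_eq_continuous_at open_UNIV UNIV_I)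
  moreover have "x0 \<in> \<Psi> -` W" using \<Psi>x0 x(2) by simp
  ultimately obtain \<delta> where \<delta>: "\<delta> > 0" "ball x0 \<delta> \<subseteq> \<Psi> -` W" using openE by blast
  have ps: "\<Psi> z $ i = z $ i + \<gamma> (\<Psi> z)" for z by (simp add: \<Psi>_def smooth_heightD(2)[OF \<gamma>])
  have side: "\<Psi> ` {z \<in> ball x0 \<delta>. t * z $ i > 0} \<subseteq> \<Omega> \<or> \<Psi> ` {z \<in> ball x0 \<delta>. t * z $ i > 0} \<inter> \<Omega> = {}"
    if "t \<in> {1,-1}" for t
  proof -
    have e: "{z \<in> ball x0 \<delta>. t * z $ i > 0} = ball x0 \<delta> \<inter> {z. (t *\<^sub>R axis i 1) \<bullet> z > 0}"
      by (auto simp: inner_axis')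
    have "convex (ball x0 \<delta> \<inter> {z. (t *\<^sub>R axis i 1) \<bullet> z > 0})"
      by (intro convex_Int convex_ball convex_halfspace_gt)
    then have "connected (\<Psi> ` {z \<in> ball x0 \<delta>. t * z $ i > 0})"
      unfolding e by (intro connected_continuous_image c\<Psi> convex_connected)
    moreover have "\<Psi> ` {z \<in> ball x0 \<delta>. t * z $ i > 0} \<inter> frontier \<Omega> = {}"
      using \<delta>(2) fi ps by fastforce
    ultimately show ?thesis using connected_Int_frontier by blast
  qed
  let ?V = "(\<lambda>y. y - \<gamma> y *\<^sub>R axis i 1) -` ball x0 \<delta>"
  have "continuous_on UNIV (\<lambda>y. y - \<gamma> y *\<^sub>R axis i 1)"
    by (intro continuous_intros continuous_on_smooth_height[OF \<gamma>])
  then have "open ?V" using open_vimage[OF open_ball] by blast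
  moreover have "x \<in> ?V" using \<delta>(1) by (simp add: x0_def)
  ultimately obtain \<rho>0 where \<rho>0: "\<rho>0 > 0" "ball x \<rho>0 \<subseteq> ?V" using openE by blast
  obtain \<rho>1 where \<rho>1: "\<rho>1 > 0" "ball x \<rho>1 \<subseteq> W" using W x(2) openE by blast
  define \<rho> where "\<rho> = min \<rho>0 \<rho>1"
  have \<rho>: "\<rho> > 0" "ball x \<rho> \<subseteq> ?V" "ball x \<rho> \<subseteq> W" using \<rho>0 \<rho>1 by (auto simp: \<rho>_def subset_iff)
  have im: "y \<in> \<Psi> ` {z \<in> ball x0 \<delta>. t * z $ i > 0}" if "y \<in> ball x \<rho>" "t * y $ i > t * \<gamma> y" for y t
    using \<rho>(2) that
    by (intro image_eqI[of _ _ "y - \<gamma> y *\<^sub>R axis i 1"]) (auto simp: \<Psi>_def \<gamma>m algebra_simps)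
  have notb: "y \<notin> \<Omega>" if "y \<in> ball x \<rho>" "y $ i = \<gamma> y" for y
    using fi[of y] that \<rho>(3) C(1) by (auto simp: frontier_def interior_open)
  let ?P = "\<lambda>t. \<Psi> ` {z \<in> ball x0 \<delta>. t * z $ i > 0}"
  have pos: "y $ i = \<gamma> y \<or> y \<in> ?P t \<and> t * y $ i > t * \<gamma> y \<or> y \<in> ?P (- t) \<and> t * y $ i < t * \<gamma> y"
    if "y \<in> ball x \<rho>" "t \<in> {1, -1}" for y t
    using im[OF that(1), of t] im[OF that(1), of "- t"] that(2) by fastforce
  note patch_chart = that
  have one_sided: thesis if t: "t \<in> {1, -1}" "?P t \<subseteq> \<Omega>" "?P (- t) \<inter> \<Omega> = {}" for t
  proof -
    have iff: "y \<in> \<Omega> \<longleftrightarrow> t * y $ i > t * \<gamma> y" if y: "y \<in> ball x \<rho>" for y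
      using pos[OF y t(1)]
    proof (elim disjE conjE)
      assume "y $ i = \<gamma> y" then show ?thesis using notb y by simp
    next
      assume "y \<in> ?P t" "t * y $ i > t * \<gamma> y" then show ?thesis using t(2) by blast
    next
      assume "y \<in> ?P (- t)" "t * y $ i < t * \<gamma> y"
      then have "y \<notin> \<Omega>" "\<not> t * y $ i > t * \<gamma> y" using t(3) by (blast, linarith)
      then show ?thesis by blast
    qed
    then have "\<Omega> \<inter> ball x \<rho> = {y \<in> ball x \<rho>. t * y $ i > t * \<gamma> y}" by blast
    then have "chart \<Omega> x \<rho> i t \<gamma>" using C(1) \<rho>(1) \<gamma> t(1) unfolding chart_def by blast
    then show thesis by (rule patch_chart[OF \<rho>(3)])
  qed
  consider "?P 1 \<subseteq> \<Omega>" "?P (- 1) \<subseteq> \<Omega>" | "?P 1 \<inter> \<Omega> = {}" "?P (- 1) \<inter> \<Omega> = {}"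
    | "?P 1 \<subseteq> \<Omega>" "?P (- 1) \<inter> \<Omega> = {}" | "?P 1 \<inter> \<Omega> = {}" "?P (- 1) \<subseteq> \<Omega>"
    using side[of 1] side[of "-1"] by blast
  then show ?thesis
  proof cases
    case 1
    have "ball x \<rho> \<subseteq> closure \<Omega>"
    proof
      fix y assume y: "y \<in> ball x \<rho>"
      then have "y $ i = \<gamma> y \<or> y \<in> \<Omega>" using pos[OF y, of 1] 1 by blast
      then show "y \<in> closure \<Omega>"
        using fi[of y] y \<rho>(3) closure_subset[of \<Omega>] by (auto simp: frontier_def)
    qed
    moreover have "((\<lambda>t. x + t *\<^sub>R chart_normal j s' \<gamma>' x) \<longlongrightarrow> x + 0 *\<^sub>R chart_normal j s' \<gamma>' x) (at_right 0)"
      by (intro tendsto_intros)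
    then have "\<forall>\<^sub>F t in at_right 0. x + t *\<^sub>R chart_normal j s' \<gamma>' x \<in> ball x \<rho>"
      using \<rho>(1) by (intro topological_tendstoD[of _ x]) auto
    moreover have xr: "x \<in> ball x r" using C(2) by simp
    then have "\<forall>\<^sub>F t in at_right 0. x + t *\<^sub>R chart_normal j s' \<gamma>' x \<notin> closure \<Omega>"
      using chart_normal_cross[OF c xr] chart_frontier_iff[OF c xr] x(1) by (auto elim!: eventually_mono)
    ultimately have "\<forall>\<^sub>F t in at_right (0::real). False"
      by (smt (verit, best) eventually_elim2 subsetD)
    then show ?thesis by simp
  next
    case 2
    have "y \<notin> \<Omega>" if y: "y \<in> ball x \<rho>" for y
      using pos[OF y, of 1] 2 notb[OF y] by blast
    then have "ball x \<rho> \<inter> closure \<Omega> = {}" using open_Int_closure_eq_empty[OF open_ball] by blast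
    moreover have "x \<in> ball x \<rho>" "x \<in> closure \<Omega>" using x(1) \<rho>(1) by (simp_all add: frontier_def)
    ultimately show ?thesis by blast
  next
    case 3
    then show ?thesis by (intro one_sided[of 1]) auto
  next
    case 4
    then show ?thesis by (intro one_sided[of "-1"]) auto
  qed
qed

definition charted :: "(real^'n) set \<Rightarrow> bool" where
  "charted \<Omega> \<longleftrightarrow> (\<forall>p\<in>frontier \<Omega>. \<exists>r i s \<gamma>. chart \<Omega> p r i s \<gamma>)"

lemma bounded_smooth_domain_charted: "bounded_smooth_domain \<Omega> \<Longrightarrow> charted \<Omega>"
  unfolding bounded_smooth_domain_def smooth_boundary_def charted_def chart_def by meson

lemma graph_measure_patch_independent:
  assumes \<Omega>: "charted \<Omega>"
    and gp: "graph_patch (frontier \<Omega>) i W \<gamma>" "graph_patch (frontier \<Omega>) i' W' \<gamma>'"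
    and A: "A \<in> sets borel" "A \<subseteq> frontier \<Omega> \<inter> W \<inter> W'"
  shows "emeasure (graph_measure i \<gamma>) A = emeasure (graph_measure i' \<gamma>') A"
proof (rule measure_eq_locally)
  fix x assume "x \<in> A"
  then have x: "x \<in> frontier \<Omega>" "x \<in> W" "x \<in> W'" using A by auto
  obtain r j t g where c: "chart \<Omega> x r j t g" using \<Omega> x(1) unfolding charted_def by blast
  obtain \<rho> s where 1: "chart \<Omega> x \<rho> i s \<gamma>" using graph_patch_imp_chart[OF c gp(1) x(1,2)] by metis
  obtain \<rho>' s' where 2: "chart \<Omega> x \<rho>' i' s' \<gamma>'" using graph_patch_imp_chart[OF c gp(2) x(1,3)] by metis
  define e where "e = min \<rho> \<rho>' / 2"
  have e: "e > 0" "cball x e \<subseteq> ball x \<rho>" "cball x e \<subseteq> ball x \<rho>'"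
    using chartD(2)[OF 1] chartD(2)[OF 2] by (auto simp: e_def subset_iff)
  then show "\<exists>U. open U \<and> x \<in> U \<and> (\<forall>B\<in>sets borel. B \<subseteq> A \<inter> U \<longrightarrow>
      emeasure (graph_measure i \<gamma>) B = emeasure (graph_measure i' \<gamma>') B)"
    using graph_measure_chart_independent[OF 1 2 e(2,3)] by (intro exI[of _ "ball x e"]) auto
qed (use A in auto)

lemma sum_of_measures:
  fixes M N :: "'a::topological_space measure"
  assumes "sets M = sets borel" "sets N = sets borel" "D \<in> sets borel"
  obtains L where "sets L = sets borel"
    "\<And>A. A \<in> sets borel \<Longrightarrow> emeasure L A = emeasure M A + emeasure N (A \<inter> D)"
proof -
  define \<mu> where "\<mu> A = emeasure M A + emeasure N (A \<inter> D)" for A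
  define L where "L = measure_of UNIV (sets (borel :: 'a measure)) \<mu>"
  have sL: "sets L = sets borel"
    unfolding L_def using sets.sigma_sets_eq[of "borel :: 'a measure"] sets.space_closed[of "borel :: 'a measure"]
    by (simp add: sets_measure_of)
  have "emeasure L A = \<mu> A" if A: "A \<in> sets borel" for A
  proof (rule emeasure_measure_of[OF L_def])
    show "sets (borel :: 'a measure) \<subseteq> Pow UNIV" by simp
    show "positive (sets L) \<mu>" by (simp add: positive_def \<mu>_def)
    show "countably_additive (sets L) \<mu>"
    proof (rule countably_additiveI)
      fix B :: "nat \<Rightarrow> 'a set"
      assume B: "range B \<subseteq> sets L" "disjoint_family B" "\<Union> (range B) \<in> sets L"
      have B': "range B \<subseteq> sets M" "range (\<lambda>n. B n \<inter> D) \<subseteq> sets N" using B(1) sL assms by auto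
      have d: "disjoint_family (\<lambda>n. B n \<inter> D)" using B(2) unfolding disjoint_family_on_def by blast
      have "(\<Sum>n. \<mu> (B n)) = (\<Sum>n. emeasure M (B n)) + (\<Sum>n. emeasure N (B n \<inter> D))"
        unfolding \<mu>_def by (rule suminf_add[symmetric]) auto
      also have "\<dots> = \<mu> (\<Union> (range B))"
        using suminf_emeasure[OF B'(1) B(2)] suminf_emeasure[OF B'(2) d] by (simp add: \<mu>_def)
      finally show "(\<Sum>n. \<mu> (B n)) = \<mu> (\<Union> (range B))" .
    qed
    show "A \<in> sets L" using that sL by simp
  qed
  then show ?thesis using that[OF sL] \<mu>_def by simp
qed


text \<open>Each step adds the part of the boundary in the new ball that earlier balls have not covered, measured in the
  chart of the new ball. By independence of the chart, this is the measure in every other graph patch as well.\<close>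

lemma surface_measure_glue:
  assumes \<Omega>: "charted \<Omega>" and T: "finite T" "\<And>p. p \<in> T \<Longrightarrow> chart \<Omega> p (r p) (i p) (s p) (g p)"
  shows "\<exists>\<sigma>. sets \<sigma> = sets borel \<and> emeasure \<sigma> UNIV < \<infinity> \<and>
     emeasure \<sigma> (- (frontier \<Omega> \<inter> (\<Union>p\<in>T. ball p (r p)))) = 0 \<and>
     (\<forall>j W \<gamma> A. graph_patch (frontier \<Omega>) j W \<gamma> \<longrightarrow> A \<in> sets borel \<longrightarrow>
        A \<subseteq> frontier \<Omega> \<inter> W \<inter> (\<Union>p\<in>T. ball p (r p)) \<longrightarrow> emeasure \<sigma> A = emeasure (graph_measure j \<gamma>) A)"
  using T
proof (induction T rule: finite_induct)
  case empty
  show ?case by (rule exI[of _ "null_measure borel"]) simp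
next
  case (insert p T)
  let ?S = "frontier \<Omega>"
  let ?U = "\<Union>p\<in>T. ball p (r p)"
  have "\<exists>\<sigma>. sets \<sigma> = sets borel \<and> emeasure \<sigma> UNIV < \<infinity> \<and> emeasure \<sigma> (- (?S \<inter> ?U)) = 0 \<and>
     (\<forall>j W \<gamma> A. graph_patch ?S j W \<gamma> \<longrightarrow> A \<in> sets borel \<longrightarrow> A \<subseteq> ?S \<inter> W \<inter> ?U \<longrightarrow>
       emeasure \<sigma> A = emeasure (graph_measure j \<gamma>) A)"
    by (rule insert.IH) (rule insert.prems, blast)
  then obtain \<sigma> where \<sigma>: "sets \<sigma> = sets borel" "emeasure \<sigma> UNIV < \<infinity>" "emeasure \<sigma> (- (?S \<inter> ?U)) = 0"
    and \<sigma>4: "\<forall>j W \<gamma> A. graph_patch ?S j W \<gamma> \<longrightarrow> A \<in> sets borel \<longrightarrow> A \<subseteq> ?S \<inter> W \<inter> ?U \<longrightarrow>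
       emeasure \<sigma> A = emeasure (graph_measure j \<gamma>) A"
    by (elim exE conjE) (rule that)
  have c: "chart \<Omega> p (r p) (i p) (s p) (g p)" using insert.prems by blast
  note C = chartD[OF c]
  define D where "D = ?S \<inter> ball p (r p) - ?U"
  have Sb: "?S \<in> sets borel" by (simp add: borel_closed)
  have Ub: "?U \<in> sets borel" by (intro borel_open open_UN) auto
  have NU: "- (?S \<inter> ?U) \<in> sets \<sigma>" unfolding \<sigma>(1) by (rule borel_comp[OF sets.Int[OF Sb Ub]])
  have Db: "D \<in> sets borel" unfolding D_def using Sb Ub by auto
  obtain L where L: "sets L = sets borel"
    "\<And>A. A \<in> sets borel \<Longrightarrow> emeasure L A = emeasure \<sigma> A + emeasure (graph_measure (i p) (g p)) (A \<inter> D)"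
    using sum_of_measures[OF \<sigma>(1) sets_graph_measure Db] by blast
  show ?case
  proof (intro exI[of _ L] conjI allI impI)
    show "sets L = sets borel" by (rule L(1))
    have "emeasure (graph_measure (i p) (g p)) (UNIV \<inter> D) \<le> emeasure (graph_measure (i p) (g p)) (cball p (r p))"
      by (rule emeasure_mono) (auto simp: D_def)
    also have "\<dots> < \<infinity>" by (rule emeasure_graph_measure_cball[OF C(4)])
    finally show "emeasure L UNIV < \<infinity>" using \<sigma>(2) L(2)[of UNIV] by simp
    let ?N = "- (?S \<inter> (\<Union>p\<in>insert p T. ball p (r p)))"
    have "open (\<Union>p\<in>insert p T. ball p (r p))" by (intro open_UN) auto
    then have Nb: "?N \<in> sets borel" using Sb by (metis borel_comp borel_open sets.Int)
    have "emeasure \<sigma> ?N \<le> emeasure \<sigma> (- (?S \<inter> ?U))"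
      by (rule emeasure_mono[OF _ NU]) blast
    then have "emeasure \<sigma> ?N = 0" using \<sigma>(3) by simp
    moreover have "?N \<inter> D = {}" by (auto simp: D_def)
    ultimately show "emeasure L ?N = 0" using L(2)[OF Nb] by simp
    fix j W \<gamma> A
    assume gp: "graph_patch ?S j W \<gamma>" and A: "A \<in> sets borel" "A \<subseteq> ?S \<inter> W \<inter> (\<Union>p\<in>insert p T. ball p (r p))"
    have dec: "A = (A \<inter> ?U) \<union> (A \<inter> D)" "(A \<inter> ?U) \<inter> (A \<inter> D) = {}" using A(2) by (auto simp: D_def)
    have "emeasure \<sigma> (A - ?U) \<le> emeasure \<sigma> (- (?S \<inter> ?U))"
      by (rule emeasure_mono[OF _ NU]) blast
    then have z: "emeasure \<sigma> (A - ?U) = 0" using \<sigma>(3) by simp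
    have "emeasure \<sigma> A = emeasure \<sigma> (A \<inter> ?U) + emeasure \<sigma> (A - ?U)"
      using A(1) Ub \<sigma>(1) by (subst plus_emeasure) (auto simp: Int_Diff_Un)
    also have "\<dots> = emeasure (graph_measure j \<gamma>) (A \<inter> ?U)"
    proof -
      have "A \<inter> ?U \<in> sets borel" "A \<inter> ?U \<subseteq> ?S \<inter> W \<inter> ?U" using A Ub by auto
      then show ?thesis using \<sigma>4[rule_format, OF gp] z by simp
    qed
    finally have 1: "emeasure \<sigma> A = emeasure (graph_measure j \<gamma>) (A \<inter> ?U)" .
    have 2: "emeasure (graph_measure (i p) (g p)) (A \<inter> D) = emeasure (graph_measure j \<gamma>) (A \<inter> D)"
      by (rule graph_measure_patch_independent[OF \<Omega> chart_graph_patch[OF c] gp])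
         (use A Db in \<open>auto simp: D_def\<close>)
    have "emeasure L A = emeasure (graph_measure j \<gamma>) (A \<inter> ?U) + emeasure (graph_measure j \<gamma>) (A \<inter> D)"
      using L(2)[OF A(1)] 1 2 by simp
    also have "\<dots> = emeasure (graph_measure j \<gamma>) A"
      using dec A(1) Ub Db by (subst plus_emeasure) auto
    finally show "emeasure L A = emeasure (graph_measure j \<gamma>) A" .
  qed
qed

lemma is_surface_measure_patch:
  assumes \<sigma>: "is_surface_measure S \<sigma>" and gp: "graph_patch S i W \<gamma>" and A: "A \<in> sets borel" "A \<subseteq> S \<inter> W"
  shows "emeasure \<sigma> A = emeasure (graph_measure i \<gamma>) A"
proof -
  have "smooth_height i \<gamma>" using gp by (simp add: graph_patch_def)
  from emeasure_graph_measure[OF this A(1)] show ?thesis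
    using \<sigma> gp A by (simp add: is_surface_measure_def)
qed

lemma is_surface_measure_unique:
  assumes \<Omega>: "charted \<Omega>" and \<sigma>: "is_surface_measure (frontier \<Omega>) \<sigma>" and \<tau>: "is_surface_measure (frontier \<Omega>) \<tau>"
  shows "\<sigma> = \<tau>"
proof (rule measure_eqI)
  let ?S = "frontier \<Omega>"
  have Sb: "?S \<in> sets borel" by (simp add: borel_closed)
  show "sets \<sigma> = sets \<tau>" using \<sigma> \<tau> by (simp add: is_surface_measure_def)
  fix A assume "A \<in> sets \<sigma>"
  then have A: "A \<in> sets borel" using \<sigma> by (simp add: is_surface_measure_def)
  have s: "emeasure M A = emeasure M (A \<inter> ?S)" if M: "is_surface_measure ?S M" for M
  proof -
    have sM: "sets M = sets borel" "emeasure M (- ?S) = 0" using M by (simp_all add: is_surface_measure_def)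
    have "emeasure M (A - ?S) \<le> emeasure M (- ?S)" using Sb sM by (intro emeasure_mono) auto
    then have "emeasure M (A - ?S) = 0" using sM by simp
    then show ?thesis
      using plus_emeasure[of "A \<inter> ?S" M "A - ?S"] A Sb sM by (simp add: Int_Diff_Un Int_Diff_disjoint)
  qed
  have "emeasure \<sigma> (A \<inter> ?S) = emeasure \<tau> (A \<inter> ?S)"
  proof (rule measure_eq_locally)
    fix x assume x: "x \<in> A \<inter> ?S"
    obtain r i s \<gamma> where c: "chart \<Omega> x r i s \<gamma>" using \<Omega> x unfolding charted_def by blast
    note gp = chart_graph_patch[OF c]
    show "\<exists>U. open U \<and> x \<in> U \<and> (\<forall>B\<in>sets borel. B \<subseteq> A \<inter> ?S \<inter> U \<longrightarrow> emeasure \<sigma> B = emeasure \<tau> B)"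
    proof (intro exI[of _ "ball x r"] conjI ballI impI)
      fix B :: "(real^'a) set" assume B: "B \<in> sets borel" "B \<subseteq> A \<inter> ?S \<inter> ball x r"
      then have "B \<subseteq> ?S \<inter> ball x r" by blast
      then show "emeasure \<sigma> B = emeasure \<tau> B"
        using is_surface_measure_patch[OF \<sigma> gp B(1)] is_surface_measure_patch[OF \<tau> gp B(1)] by simp
    qed (use chartD(2)[OF c] in auto)
  qed (use \<sigma> \<tau> A Sb in \<open>auto simp: is_surface_measure_def\<close>)
  then show "emeasure \<sigma> A = emeasure \<tau> A" using s[OF \<sigma>] s[OF \<tau>] by simp
qed

lemma surface_measure_exists:
  assumes \<Omega>: "charted \<Omega>" and b: "bounded \<Omega>"
  shows "\<exists>\<sigma>. is_surface_measure (frontier \<Omega>) \<sigma> \<and> emeasure \<sigma> UNIV < \<infinity>"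
proof -
  let ?S = "frontier \<Omega>"
  obtain r i s g where c: "\<And>p. p \<in> ?S \<Longrightarrow> chart \<Omega> p (r p) (i p) (s p) (g p)"
    using \<Omega> unfolding charted_def by metis
  have "compact ?S" using b by (rule compact_frontier_bounded)
  then obtain T where T: "T \<subseteq> ?S" "finite T" "?S \<subseteq> (\<Union>p\<in>T. ball p (r p))"
    by (rule compactE_image[where f="\<lambda>p. ball p (r p)"]) (use c[THEN chartD(2)] in \<open>auto intro!: UN_I\<close>)
  obtain \<sigma> where \<sigma>: "sets \<sigma> = sets borel" "emeasure \<sigma> UNIV < \<infinity>"
     "emeasure \<sigma> (- (?S \<inter> (\<Union>p\<in>T. ball p (r p)))) = 0"
     "\<forall>j W \<gamma> A. graph_patch ?S j W \<gamma> \<longrightarrow> A \<in> sets borel \<longrightarrow>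
        A \<subseteq> ?S \<inter> W \<inter> (\<Union>p\<in>T. ball p (r p)) \<longrightarrow> emeasure \<sigma> A = emeasure (graph_measure j \<gamma>) A"
    using surface_measure_glue[OF \<Omega> T(2), of r i s g] T(1) c by blast
  have e: "?S \<inter> (\<Union>p\<in>T. ball p (r p)) = ?S" "?S \<inter> W \<inter> (\<Union>p\<in>T. ball p (r p)) = ?S \<inter> W" for W using T(3) by auto
  have "is_surface_measure ?S \<sigma>"
    unfolding is_surface_measure_def
  proof (intro conjI allI impI)
    fix j W \<gamma> A assume gp: "graph_patch ?S j W \<gamma>" and A: "A \<in> sets borel" "A \<subseteq> ?S \<inter> W"
    have "smooth_height j \<gamma>" using gp by (simp add: graph_patch_def)
    from emeasure_graph_measure[OF this A(1)]
    show "emeasure \<sigma> A = (\<integral>\<^sup>+ z. indicator A (graph_point j \<gamma> z) *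
        ennreal (sqrt (1 + (norm (grad \<gamma> (hyper j z)))\<^sup>2)) \<partial>hplane_measure j)"
      using \<sigma>(4)[unfolded e, rule_format, OF gp A] by simp
  qed (use \<sigma>(1,3) e in auto)
  then show ?thesis using \<sigma>(2) by blast
qed

lemma surface_measure_is_surface_measure:
  assumes \<Omega>: "charted \<Omega>" and b: "bounded \<Omega>"
  shows "is_surface_measure (frontier \<Omega>) (surface_measure (frontier \<Omega>))"
    "emeasure (surface_measure (frontier \<Omega>)) UNIV < \<infinity>"
proof -
  obtain \<sigma> where \<sigma>: "is_surface_measure (frontier \<Omega>) \<sigma>" "emeasure \<sigma> UNIV < \<infinity>"
    using surface_measure_exists[OF assms] by blast
  have "surface_measure (frontier \<Omega>) = \<sigma>"
    unfolding surface_measure_def using \<sigma>(1) is_surface_measure_unique[OF \<Omega> _ \<sigma>(1)] by (intro the_equality)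
  then show "is_surface_measure (frontier \<Omega>) (surface_measure (frontier \<Omega>))"
    "emeasure (surface_measure (frontier \<Omega>)) UNIV < \<infinity>" using \<sigma> by auto
qed

lemma sets_surface_measure [simp]:
  "charted \<Omega> \<Longrightarrow> bounded \<Omega> \<Longrightarrow> sets (surface_measure (frontier \<Omega>)) = sets borel"
  using surface_measure_is_surface_measure(1)[of \<Omega>] by (simp add: is_surface_measure_def)

lemma space_surface_measure [simp]:
  "charted \<Omega> \<Longrightarrow> bounded \<Omega> \<Longrightarrow> space (surface_measure (frontier \<Omega>)) = UNIV"
  using sets_eq_imp_space_eq[OF sets_surface_measure] by simp

lemma AE_surface_measure:
  assumes \<Omega>: "charted \<Omega>" and b: "bounded \<Omega>"
  shows "AE x in surface_measure (frontier \<Omega>). x \<in> frontier \<Omega>"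
proof (rule AE_I')
  have "emeasure (surface_measure (frontier \<Omega>)) (- frontier \<Omega>) = 0"
    using surface_measure_is_surface_measure(1)[OF assms] by (simp add: is_surface_measure_def)
  then show "- frontier \<Omega> \<in> null_sets (surface_measure (frontier \<Omega>))"
    using assms by (auto simp: null_sets_def intro!: borel_comp borel_closed)
qed auto

lemma integral_surface_measure_chart:
  fixes f :: "real^'n \<Rightarrow> real"
  assumes \<Omega>: "charted \<Omega>" and b: "bounded \<Omega>" and c: "chart \<Omega> p r i s \<gamma>"
    and f: "f \<in> borel_measurable borel" "\<And>x. x \<notin> ball p r \<Longrightarrow> f x = 0"
  shows "(\<integral>x. f x \<partial>surface_measure (frontier \<Omega>)) = (\<integral>x. f x \<partial>graph_measure i \<gamma>)"
proof -
  let ?S = "frontier \<Omega>" and ?B = "ball p r" and ?\<sigma> = "surface_measure (frontier \<Omega>)" and ?\<mu> = "graph_measure i \<gamma>"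
  note C = chartD[OF c]
  have Sb: "?S \<in> sets borel" by (simp add: borel_closed)
  have sm: "is_surface_measure ?S ?\<sigma>" using surface_measure_is_surface_measure(1)[OF \<Omega> b] .
  have ss: "sets ?\<sigma> = sets borel" using \<Omega> b by simp
  have eq: "density ?\<sigma> (indicator ?B) = density ?\<mu> (indicator ?B)"
  proof (rule measure_eqI)
    fix A assume "A \<in> sets (density ?\<sigma> (indicator ?B))"
    then have A: "A \<in> sets borel" using ss by simp
    have "emeasure ?\<sigma> (A \<inter> ?B - ?S) \<le> emeasure ?\<sigma> (- ?S)" using Sb ss by (intro emeasure_mono) auto
    then have z1: "emeasure ?\<sigma> (A \<inter> ?B - ?S) = 0" using sm by (simp add: is_surface_measure_def)
    have m: "A \<inter> ?B - ?S \<in> sets ?\<mu>" using A Sb by auto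
    have "AE x in ?\<mu>. x \<notin> A \<inter> ?B - ?S"
      using AE_graph_measure[OF C(4)] chart_frontier_iff[OF c] by (auto elim!: AE_mp)
    then have z2: "emeasure ?\<mu> (A \<inter> ?B - ?S) = 0" 
      by (subst (asm) AE_iff_measurable[OF m]) auto
    have "emeasure ?\<sigma> (A \<inter> ?B) = emeasure ?\<sigma> (A \<inter> ?B \<inter> ?S)"
      using plus_emeasure[of "A \<inter> ?B \<inter> ?S" ?\<sigma> "A \<inter> ?B - ?S"] A Sb ss z1 by (simp add: Int_Diff_Un Int_Diff_disjoint)
    also have "\<dots> = emeasure ?\<mu> (A \<inter> ?B \<inter> ?S)"
    proof -
      have "A \<inter> ?B \<inter> ?S \<in> sets borel" "A \<inter> ?B \<inter> ?S \<subseteq> ?S \<inter> ?B" using A Sb by auto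
      then show ?thesis by (rule is_surface_measure_patch[OF sm chart_graph_patch[OF c]])
    qed
    also have "\<dots> = emeasure ?\<mu> (A \<inter> ?B)"
      using plus_emeasure[of "A \<inter> ?B \<inter> ?S" ?\<mu> "A \<inter> ?B - ?S"] A Sb z2 by (simp add: Int_Diff_Un Int_Diff_disjoint)
    finally show "emeasure (density ?\<sigma> (indicator ?B)) A = emeasure (density ?\<mu> (indicator ?B)) A"
      using A ss by (simp add: emeasure_density_indicator)
  qed (simp add: ss)
  have fB: "f = (\<lambda>x. indicator ?B x *\<^sub>R f x)" using f(2) by (auto simp: indicator_def fun_eq_iff)
  have d: "(\<integral>x. f x \<partial>M) = (\<integral>x. f x \<partial>density M (indicator ?B))" if "sets M = sets borel" for M
  proof -
    have fm: "f \<in> borel_measurable M" "?B \<in> sets M" using f(1) that by (simp_all cong: measurable_cong_sets)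
    have "(\<integral>x. f x \<partial>density M (indicator ?B)) = (\<integral>x. f x \<partial>density M (\<lambda>x. ennreal (indicator ?B x)))"
      by (simp add: ennreal_indicator)
    also have "\<dots> = (\<integral>x. indicator ?B x *\<^sub>R f x \<partial>M)"
      using fm by (intro integral_density) auto
    finally show ?thesis using fB by simp
  qed
  show ?thesis using d[of ?\<sigma>] d[of ?\<mu>] ss eq by simp
qed

lemma integrable_surface_measure:
  fixes f :: "real^'n \<Rightarrow> real"
  assumes \<Omega>: "charted \<Omega>" and b: "bounded \<Omega>" and f: "continuous_on (frontier \<Omega>) f"
  shows "set_integrable (surface_measure (frontier \<Omega>)) (frontier \<Omega>) f"
proof -
  let ?S = "frontier \<Omega>"
  have cS: "compact ?S" using b by (rule compact_frontier_bounded)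
  then have Sb: "?S \<in> sets borel" by (simp add: borel_closed)
  have "bounded (f ` ?S)" using f cS by (intro compact_imp_bounded compact_continuous_image)
  then obtain B where B: "\<And>x. x \<in> ?S \<Longrightarrow> norm (f x) \<le> B" unfolding bounded_iff by blast
  have m: "(\<lambda>x. indicator ?S x *\<^sub>R f x) \<in> borel_measurable borel"
    using borel_measurable_continuous_on_indicator[OF Sb f] .
  show ?thesis unfolding set_integrable_def
    by (rule integrableI_bounded_set[of ?S _ _ B])
       (use B Sb m surface_measure_is_surface_measure(2)[OF \<Omega> b] assms in
        \<open>auto cong: measurable_cong_sets intro: le_less_trans[OF emeasure_mono]\<close>)
qed

section \<open>The divergence theorem\<close>

lemma divergence_cong:
  assumes "open U" "x \<in> U" "\<And>y. y \<in> U \<Longrightarrow> F y = G y"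
  shows "divergence F x = divergence G x"
  unfolding divergence_def using assms by (intro sum.cong refl partial_deriv_cong[of U]) auto

lemma ball_inside_disjoint_frontier:
  assumes "open \<Omega>" "ball p r \<subseteq> \<Omega>" shows "ball p r \<inter> frontier \<Omega> = {}"
  using assms by (auto simp: frontier_def interior_open)

lemma gauss_interior:
  fixes F :: "real^'n \<Rightarrow> real^'n"
  assumes F: "\<And>j. Ck_on 1 UNIV (\<lambda>x. F x $ j)" and K: "\<And>x. x \<notin> cball q \<rho> \<Longrightarrow> F x = 0"
  shows "(\<integral>x. divergence F x \<partial>lborel) = 0"
proof -
  obtain M where M: "cball q \<rho> \<subseteq> ball 0 M" "M > 0" using bounded_subset_ballD[OF bounded_cball, of q \<rho> 0] by blast
  have pz: "partial_deriv j (\<lambda>x. F x $ k) x = 0" if "x \<notin> cball q \<rho>" for j k x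
    by (rule partial_deriv_zero_off_closed[of "cball q \<rho>"]) (use K that in auto)
  have cp: "continuous_on UNIV (partial_deriv j (\<lambda>x. F x $ j))" for j using F[of j] by simp
  have i1: "integrable lborel (partial_deriv j (\<lambda>x. F x $ j))" for j
    using integrable_compact_support[OF cp compact_cball[of q \<rho>], of _ UNIV] pz by simp
  have z: "(\<integral>x. partial_deriv j (\<lambda>x. F x $ j) x \<partial>lborel) = 0" for j
  proof -
    have sh: "smooth_height j (\<lambda>x. - M)"
      by (auto simp: smooth_height_def smooth_on_def intro!: exI[of _ UNIV])
    have supp: "F x $ j = 0" if "norm x > M" for x using K[of x] M that by fastforce
    have "(\<integral>x. partial_deriv j (\<lambda>x. F x $ j) x \<partial>lborel)
        = (\<integral>x. indicator {x. 1 * x $ j > 1 * (- M)} x * partial_deriv j (\<lambda>x. F x $ j) x \<partial>lborel)"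
    proof (intro Bochner_Integration.integral_cong refl)
      fix x
      show "partial_deriv j (\<lambda>x. F x $ j) x = indicator {x. 1 * x $ j > 1 * (- M)} x * partial_deriv j (\<lambda>x. F x $ j) x"
        using pz[of x j j] M component_le_norm_cart[of x j] by (fastforce simp: indicator_def)
    qed
    also have "\<dots> = (\<integral>z. 1 * (grad (\<lambda>x. - M) (hyper j z) - axis j 1) $ j * F (graph_point j (\<lambda>x. - M) z) $ j \<partial>hplane_measure j)"
      by (rule gauss_graph[OF F supp _ sh]) auto
    also have "\<dots> = (\<integral>z. 0 \<partial>hplane_measure j)"
    proof (intro Bochner_Integration.integral_cong refl)
      fix z
      have "\<bar>graph_point j (\<lambda>x. - M) z $ j\<bar> = M" using M by (simp add: graph_point_def hyper_def)
      then have "norm (graph_point j (\<lambda>x. - M) z) \<ge> M" using component_le_norm_cart by metis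
      then have "graph_point j (\<lambda>x. - M) z \<notin> cball q \<rho>" using M(1) by (metis mem_ball_0 not_le subsetD)
      then show "1 * (grad (\<lambda>x. - M) (hyper j z) - axis j 1) $ j * F (graph_point j (\<lambda>x. - M) z) $ j = 0"
        using K by simp
    qed
    finally show ?thesis by simp
  qed
  show ?thesis unfolding divergence_def using z i1 by (simp add: Bochner_Integration.integral_sum)
qed

text \<open>The statement is linear in the field, so it may be localized: multiplying by cut-off functions,
  one after the other, splits the field into pieces supported in balls that lie either inside the domain
  or in a single chart.\<close>

theorem divergence_theorem:
  fixes F N :: "real^'n \<Rightarrow> real^'n"
  assumes \<Omega>: "open \<Omega>" "charted \<Omega>" "bounded \<Omega>"
    and V: "open V" "closure \<Omega> \<subseteq> V" and F: "\<And>j. Ck_on 1 V (\<lambda>x. F x $ j)"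
    and N: "continuous_on (frontier \<Omega>) N" "\<And>x. x \<in> frontier \<Omega> \<Longrightarrow> N x = outer_normal \<Omega> x"
  shows "(LINT x:\<Omega>|lborel. divergence F x) = (LINT x:frontier \<Omega>|surface_measure (frontier \<Omega>). F x \<bullet> N x)"
proof -
  let ?S = "frontier \<Omega>" and ?\<sigma> = "surface_measure (frontier \<Omega>)"
  let ?K = "closure \<Omega>"
  have compK: "compact ?K" using \<Omega>(3) by (simp add: compact_closure)
  have SK: "?S \<subseteq> ?K" "\<Omega> \<subseteq> ?K" by (auto simp: frontier_def closure_subset[THEN subsetD])
  define C1 :: "(real^'n \<Rightarrow> real^'n) \<Rightarrow> bool" where "C1 F \<longleftrightarrow> (\<forall>j. Ck_on 1 V (\<lambda>x. F x $ j))" for F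
  define \<Lambda> where "\<Lambda> F \<longleftrightarrow> (LINT x:\<Omega>|lborel. divergence F x) = (LINT x:?S|?\<sigma>. F x \<bullet> N x)" for F
  have cdiv: "continuous_on ?K (divergence F)" if "C1 F" for F
  proof -
    have "continuous_on V (partial_deriv i (\<lambda>y. F y $ i))" for i using that by (simp add: C1_def)
    then show ?thesis unfolding divergence_def[abs_def]
      using continuous_on_subset[OF _ V(2)] by (intro continuous_on_sum) blast
  qed
  have cF: "continuous_on ?K F" if "C1 F" for F
  proof -
    have "continuous_on V (\<lambda>x. F x $ j)" for j using that Ck_on_continuous unfolding C1_def by blast
    then have "continuous_on V F" using continuous_on_vec_lambda[of V "\<lambda>j x. F x $ j"] by simp
    then show ?thesis using V(2) continuous_on_subset by blast
  qed
  have i1: "set_integrable lborel \<Omega> (divergence F)" if "C1 F" for F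
    by (rule set_integrable_subset[of _ ?K])
       (use borel_integrable_compact[OF compK cdiv[OF that]] SK \<Omega>(1) in \<open>auto simp: set_integrable_def\<close>)
  have i2: "set_integrable ?\<sigma> ?S (\<lambda>x. F x \<bullet> N x)" if "C1 F" for F
    using continuous_on_subset[OF cF[OF that] SK(1)] N(1)
    by (intro integrable_surface_measure \<Omega> continuous_intros)
  have add: "\<Lambda> (\<lambda>x. F x + G x)" if "C1 F" "C1 G" "\<Lambda> F" "\<Lambda> G" for F G
  proof -
    have "(LINT x:\<Omega>|lborel. divergence (\<lambda>x. F x + G x) x) = (LINT x:\<Omega>|lborel. divergence F x + divergence G x)"
    proof (rule set_lebesgue_integral_cong)
      show "\<forall>x. x \<in> \<Omega> \<longrightarrow> divergence (\<lambda>x. F x + G x) x = divergence F x + divergence G x"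
      proof (intro allI impI)
        fix x assume "x \<in> \<Omega>"
        then have x: "x \<in> V" using SK V by auto
        have "partial_deriv j (\<lambda>x. (F x + G x) $ j) x = partial_deriv j (\<lambda>x. F x $ j) x + partial_deriv j (\<lambda>x. G x $ j) x" for j
        proof -
          have "((\<lambda>x. F x $ j + G x $ j) has_derivative (\<lambda>h. grad (\<lambda>x. F x $ j) x \<bullet> h + grad (\<lambda>x. G x $ j) x \<bullet> h)) (at x)"
            using that(1,2) V(1) x unfolding C1_def
            by (intro has_derivative_add Ck_on_has_derivative[of 0 V]) auto
          from partial_deriv_eq[OF this] show ?thesis by (simp add: inner_axis)
        qed
        then show "divergence (\<lambda>x. F x + G x) x = divergence F x + divergence G x"
          by (simp add: divergence_def sum.distrib)
      qed
    qed (use \<Omega>(1) in auto)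
    also have "\<dots> = (LINT x:\<Omega>|lborel. divergence F x) + (LINT x:\<Omega>|lborel. divergence G x)"
      by (rule set_integral_add(2)[OF i1[OF that(1)] i1[OF that(2)]])
    also have "\<dots> = (LINT x:?S|?\<sigma>. F x \<bullet> N x) + (LINT x:?S|?\<sigma>. G x \<bullet> N x)"
      using that(3,4) by (simp add: \<Lambda>_def)
    also have "\<dots> = (LINT x:?S|?\<sigma>. (F x + G x) \<bullet> N x)"
      using set_integral_add(2)[OF i2[OF that(1)] i2[OF that(2)]] by (simp add: inner_add_left)
    finally show ?thesis by (simp add: \<Lambda>_def)
  qed
  have loc: "\<exists>r>0. \<forall>F. C1 F \<longrightarrow> (\<forall>x. x \<notin> ball p r \<longrightarrow> F x = 0) \<longrightarrow> \<Lambda> F" if p: "p \<in> ?K" for p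
  proof -
    obtain rV where rV: "rV > 0" "ball p rV \<subseteq> V" using V p openE by blast
    have glob: "C1' " if "C1' = (\<forall>j. Ck_on 1 UNIV (\<lambda>x. F x $ j))" "C1 F" "\<forall>x. x \<notin> ball p (rV/2) \<longrightarrow> F x = 0" for F C1'
    proof -
      have "Ck_on 1 UNIV (\<lambda>x. F x $ j)" for j
      proof -
        have "Ck_on 1 UNIV (\<lambda>x. if x \<in> ball p rV then F x $ j else 0)"
          by (rule Ck_on_zero_extension[of 1 p rV _ "rV/2"])
             (use that Ck_on_subset[OF _ rV(2)] rV(1) in \<open>auto simp: C1_def simp del: Ck_on.simps One_nat_def\<close>)
        moreover have "(\<lambda>x. if x \<in> ball p rV then F x $ j else 0) = (\<lambda>x. F x $ j)"
          using that(3) rV(1) by (force simp: fun_eq_iff)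
        ultimately show ?thesis by simp
      qed
      then show ?thesis using that(1) by simp
    qed
    show ?thesis
    proof (cases "p \<in> ?S")
      case True
      then obtain r i s \<gamma> where c: "chart \<Omega> p r i s \<gamma>" using \<Omega>(2) unfolding charted_def by blast
      note C = chartD[OF c]
      define e where "e = min (rV / 2) (r / 2)"
      have e: "e > 0" "e \<le> rV / 2" "cball p e \<subseteq> ball p r" using rV(1) C(2) by (auto simp: e_def)
      show ?thesis
      proof (intro exI[of _ e] conjI allI impI)
        fix F assume F: "C1 F" and F0: "\<forall>x. x \<notin> ball p e \<longrightarrow> F x = 0"
        have F1: "Ck_on 1 UNIV (\<lambda>x. F x $ j)" for j
          using glob[OF refl F] F0 e(2) by (auto simp del: Ck_on.simps One_nat_def)
        have F0': "x \<notin> cball p e \<Longrightarrow> F x = 0" for x using F0 ball_subset_cball by blast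
        have cFu: "continuous_on UNIV F"
          using Ck_on_continuous[OF F1] continuous_on_vec_lambda[of UNIV "\<lambda>j x. F x $ j"] by simp
        have cN: "continuous_on UNIV (chart_normal i s \<gamma>)"
          using Ck_on_continuous[OF Ck_on_chart_normal[OF C(4), of 1 s]]
            continuous_on_vec_lambda[of UNIV "\<lambda>j x. chart_normal i s \<gamma> x $ j"] by simp
        have m: "(\<lambda>x. F x \<bullet> chart_normal i s \<gamma> x) \<in> borel_measurable borel"
          by (intro borel_measurable_continuous_onI continuous_intros cFu cN)
        have "(LINT x:\<Omega>|lborel. divergence F x) = (\<integral>x. F x \<bullet> chart_normal i s \<gamma> x \<partial>graph_measure i \<gamma>)"
          using gauss_chart[OF c F1 e(3) F0'] by (simp add: set_lebesgue_integral_def)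
        also have "\<dots> = (\<integral>x. F x \<bullet> chart_normal i s \<gamma> x \<partial>?\<sigma>)"
          using e(3) F0' by (intro integral_surface_measure_chart[symmetric, OF \<Omega>(2,3) c m]) force
        also have "\<dots> = (LINT x:?S|?\<sigma>. F x \<bullet> N x)"
          unfolding set_lebesgue_integral_def
        proof (rule integral_cong_AE)
          show "(\<lambda>x. F x \<bullet> chart_normal i s \<gamma> x) \<in> borel_measurable ?\<sigma>"
            using m \<Omega> by (simp cong: measurable_cong_sets)
          show "(\<lambda>x. indicator ?S x *\<^sub>R (F x \<bullet> N x)) \<in> borel_measurable ?\<sigma>"
            using i2[OF F] unfolding set_integrable_def by auto
          show "AE x in ?\<sigma>. F x \<bullet> chart_normal i s \<gamma> x = indicator ?S x *\<^sub>R (F x \<bullet> N x)"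
            using AE_surface_measure[OF \<Omega>(2,3)]
          proof eventually_elim
            case (elim x)
            show ?case
            proof (cases "x \<in> cball p e")
              case True
              then have "x \<in> ball p r" using e(3) by blast
              then show ?thesis using outer_normal_chart[OF c _ elim] N(2)[OF elim] elim by simp
            qed (simp add: F0')
          qed
        qed
        finally show "\<Lambda> F" by (simp add: \<Lambda>_def)
      qed (rule e(1))
    next
      case False
      then have "p \<in> \<Omega>" using p \<Omega>(1) by (auto simp: frontier_def interior_open)
      then obtain r where r: "r > 0" "ball p r \<subseteq> \<Omega>" using \<Omega>(1) openE by blast
      define e where "e = min (rV / 2) (r / 2)"
      have e: "e > 0" "e \<le> rV / 2" "cball p e \<subseteq> ball p r" using rV(1) r(1) by (auto simp: e_def)
      show ?thesis
      proof (intro exI[of _ e] conjI allI impI)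
        fix F assume F: "C1 F" and F0: "\<forall>x. x \<notin> ball p e \<longrightarrow> F x = 0"
        have F1: "Ck_on 1 UNIV (\<lambda>x. F x $ j)" for j
          using glob[OF refl F] F0 e(2) by (auto simp del: Ck_on.simps One_nat_def)
        have F0': "x \<notin> cball p e \<Longrightarrow> F x = 0" for x using F0 ball_subset_cball by blast
        have "divergence F x = 0" if "x \<notin> cball p e" for x
          unfolding divergence_def
          by (intro sum.neutral ballI partial_deriv_zero_off_closed[of "cball p e"]) (use F0' that in auto)
        then have ind: "indicator \<Omega> x *\<^sub>R divergence F x = divergence F x" for x
          using e(3) r(2) by (cases "x \<in> cball p e") (auto simp: indicator_def subset_iff)
        have "(LINT x:\<Omega>|lborel. divergence F x) = 0"
          unfolding set_lebesgue_integral_def ind by (rule gauss_interior[OF F1 F0'])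
        moreover have "F x = 0" if "x \<in> ?S" for x
        proof -
          have "x \<notin> ball p r" using ball_inside_disjoint_frontier[OF \<Omega>(1) r(2)] that by blast
          then show ?thesis using F0' e(3) by blast
        qed
        then have "(LINT x:?S|?\<sigma>. F x \<bullet> N x) = 0"
          unfolding set_lebesgue_integral_def
          by (intro integral_eq_zero_AE AE_I2) (auto simp: indicator_def)
        ultimately show "\<Lambda> F" by (simp add: \<Lambda>_def)
      qed (rule e(1))
    qed
  qed
  obtain r where r: "\<And>p. p \<in> ?K \<Longrightarrow> r p > 0"
    "\<And>p F. p \<in> ?K \<Longrightarrow> C1 F \<Longrightarrow> (\<forall>x. x \<notin> ball p (r p) \<longrightarrow> F x = 0) \<Longrightarrow> \<Lambda> F"
    using loc by metis
  have ind: "\<Lambda> F" if "finite T" "T \<subseteq> ?K" "C1 F" "\<forall>x\<in>?K. x \<notin> (\<Union>p\<in>T. ball p (r p / 2)) \<longrightarrow> F x = 0" for T F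
    using that
  proof (induction T arbitrary: F rule: finite_induct)
    case empty
    then have z: "F x = 0" if "x \<in> ?K" for x using that by simp
    have "divergence F x = divergence (\<lambda>_. 0) x" if "x \<in> \<Omega>" for x
      using z SK that by (intro divergence_cong[OF \<Omega>(1)]) auto
    then have "divergence F x = 0" if "x \<in> \<Omega>" for x
      using that by (simp add: divergence_def partial_deriv_def)
    then have "(LINT x:\<Omega>|lborel. divergence F x) = 0" unfolding set_lebesgue_integral_def
      by (intro integral_eq_zero_AE AE_I2) (auto simp: indicator_def)
    moreover have "(LINT x:?S|?\<sigma>. F x \<bullet> N x) = 0" unfolding set_lebesgue_integral_def
      by (intro integral_eq_zero_AE AE_I2) (use z SK in \<open>auto simp: indicator_def\<close>)
    ultimately show ?case by (simp add: \<Lambda>_def)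
  next
    case (insert p T)
    have p: "p \<in> ?K" using insert.prems by blast
    obtain \<psi> :: "real^'n \<Rightarrow> real" where \<psi>: "Ck_on 1 UNIV \<psi>" "\<And>x. x \<in> ball p (r p/2) \<Longrightarrow> \<psi> x = 1"
      "\<And>x. x \<notin> ball p (r p) \<Longrightarrow> \<psi> x = 0" using cutoff_exists[OF r(1)[OF p], where k=1 and p=p] by metis
    have C\<psi>: "Ck_on 1 V \<psi>" using Ck_on_subset[OF \<psi>(1)] by blast
    let ?F1 = "\<lambda>x. \<psi> x *\<^sub>R F x" and ?F2 = "\<lambda>x. (1 - \<psi> x) *\<^sub>R F x"
    have C: "C1 ?F1" "C1 ?F2"
      using insert.prems(2) C\<psi> V(1) unfolding C1_def vector_scaleR_component
      by (auto intro!: Ck_on_mult Ck_on_diff Ck_on_const simp del: Ck_on.simps One_nat_def)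
    have "\<Lambda> ?F1" by (rule r(2)[OF p C(1)]) (simp add: \<psi>(3))
    moreover have "\<Lambda> ?F2"
      by (rule insert.IH) (use insert.prems C(2) \<psi>(2) in auto)
    ultimately have "\<Lambda> (\<lambda>x. ?F1 x + ?F2 x)" using add C by blast
    then show ?case by (simp add: algebra_simps)
  qed
  obtain T where T: "T \<subseteq> ?K" "finite T" "?K \<subseteq> (\<Union>p\<in>T. ball p (r p / 2))"
    using compK by (rule compactE_image[where f="\<lambda>p. ball p (r p / 2)"]) (use r(1) in \<open>auto intro!: UN_I\<close>)
  have "\<Lambda> F" using ind[OF T(2,1), of F] T(3) F unfolding C1_def by blast
  then show ?thesis by (simp add: \<Lambda>_def)
qed


section \<open>Vector fields along the boundary\<close>

definition jac :: "(real^'n \<Rightarrow> real^'n) \<Rightarrow> real^'n \<Rightarrow> real^'n \<Rightarrow> real^'n" where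
  "jac F x h = (\<chi> j. grad (\<lambda>y. F y $ j) x \<bullet> h)"

lemma jac_nth [simp]: "jac F x h $ j = grad (\<lambda>y. F y $ j) x \<bullet> h"
  by (simp add: jac_def)

lemma linear_jac: "linear (jac F x)"
  by (rule linearI) (auto simp: vec_eq_iff inner_add_right)

lemma has_derivative_vecI:
  fixes F :: "'a::real_normed_vector \<Rightarrow> real^'n"
  assumes "\<And>j. ((\<lambda>x. F x $ j) has_derivative (\<lambda>h. D h $ j)) (at x within S)"
  shows "(F has_derivative D) (at x within S)"
  using assms by (subst has_derivative_componentwise_within) (auto simp: Basis_vec_def inner_axis)

lemma has_derivative_jac:
  assumes "\<And>j. Ck_on (Suc k) U (\<lambda>x. F x $ j)" "open U" "x \<in> U"
  shows "(F has_derivative jac F x) (at x within S)"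
  using Ck_on_has_derivative[OF assms]
  by (intro has_derivative_vecI) (rule has_derivative_at_withinI, simp)

lemma divergence_eq_trace_jac: "divergence F x = (\<Sum>j\<in>UNIV. jac F x (axis j 1) $ j)"
  by (simp add: divergence_def inner_axis)

lemma jac_eq_sum: "jac F x h $ j = (\<Sum>k\<in>UNIV. partial_deriv k (\<lambda>y. F y $ j) x * h $ k)"
  by (simp add: inner_vec_def)

text \<open>The chart normals are defined on the whole space and agree on the boundary wherever both are normals. Blending
  them with cut-off functions therefore leaves the boundary values unchanged.\<close>

lemma normal_extension:
  fixes \<Omega> :: "(real^'n) set"
  assumes \<Omega>: "charted \<Omega>" "bounded \<Omega>"
  obtains N :: "real^'n \<Rightarrow> real^'n" where "\<And>j. Ck_on k UNIV (\<lambda>x. N x $ j)"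
    "\<And>x. x \<in> frontier \<Omega> \<Longrightarrow> N x = outer_normal \<Omega> x"
proof -
  let ?S = "frontier \<Omega>"
  obtain r i s g where c: "\<And>p. p \<in> ?S \<Longrightarrow> chart \<Omega> p (r p) (i p) (s p) (g p)"
    using \<Omega>(1) unfolding charted_def by metis
  have r: "r p > 0" if "p \<in> ?S" for p using chartD(2)[OF c[OF that]] .
  have ind: "\<exists>N::real^'n \<Rightarrow> real^'n. (\<forall>j. Ck_on k UNIV (\<lambda>x. N x $ j)) \<and>
      (\<forall>x\<in>?S \<inter> (\<Union>p\<in>T. ball p (r p / 2)). N x = outer_normal \<Omega> x)" if "finite T" "T \<subseteq> ?S" for T
    using that
  proof (induction T rule: finite_induct)
    case empty
    show ?case by (intro exI[of _ "\<lambda>x. 0"]) auto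
  next
    case (insert p T)
    then obtain N :: "real^'n \<Rightarrow> real^'n" where N: "\<And>j. Ck_on k UNIV (\<lambda>x. N x $ j)"
      "\<And>x. x \<in> ?S \<inter> (\<Union>p\<in>T. ball p (r p / 2)) \<Longrightarrow> N x = outer_normal \<Omega> x" by blast
    have p: "p \<in> ?S" using insert.prems by blast
    obtain \<psi> :: "real^'n \<Rightarrow> real" where \<psi>: "Ck_on k UNIV \<psi>" "\<And>x. x \<in> ball p (r p/2) \<Longrightarrow> \<psi> x = 1"
      "\<And>x. x \<notin> ball p (r p) \<Longrightarrow> \<psi> x = 0" using cutoff_exists[OF r[OF p], where k=k and p=p] by metis
    let ?C = "chart_normal (i p) (s p) (g p)"
    define M where "M x = \<psi> x *\<^sub>R ?C x + (1 - \<psi> x) *\<^sub>R N x" for x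
    have "Ck_on k UNIV (\<lambda>x. M x $ j)" for j
      unfolding M_def vector_add_component vector_scaleR_component real_scaleR_def
      by (intro Ck_on_add Ck_on_mult Ck_on_diff Ck_on_const \<psi>(1) N(1)
          Ck_on_chart_normal[OF chartD(4)[OF c[OF p]]] open_UNIV)
    moreover have "M x = outer_normal \<Omega> x" if x: "x \<in> ?S" "x \<in> (\<Union>p\<in>insert p T. ball p (r p / 2))" for x
    proof -
      have C: "?C x = outer_normal \<Omega> x" if "\<psi> x \<noteq> 0"
        using outer_normal_chart[OF c[OF p] _ x(1)] \<psi>(3)[of x] that by force
      show ?thesis
      proof (cases "x \<in> ball p (r p / 2)")
        case True
        then show ?thesis using C \<psi>(2)[OF True] by (simp add: M_def)
      next
        case False
        then have "N x = outer_normal \<Omega> x" using N(2) x by blast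
        then show ?thesis using C by (cases "\<psi> x = 0") (auto simp: M_def algebra_simps)
      qed
    qed
    ultimately show ?case by blast
  qed
  have "compact ?S" using \<Omega>(2) by (rule compact_frontier_bounded)
  then obtain T where T: "T \<subseteq> ?S" "finite T" "?S \<subseteq> (\<Union>p\<in>T. ball p (r p / 2))"
    by (rule compactE_image[where f="\<lambda>p. ball p (r p / 2)"]) (use r in \<open>auto intro!: UN_I\<close>)
  obtain N :: "real^'n \<Rightarrow> real^'n" where N: "\<forall>j. Ck_on k UNIV (\<lambda>x. N x $ j)"
      "\<forall>x\<in>?S \<inter> (\<Union>p\<in>T. ball p (r p / 2)). N x = outer_normal \<Omega> x"
    using ind[OF T(2,1)] by (elim exE conjE) (rule that)
  show ?thesis
  proof (rule that[of N])
    show "N x = outer_normal \<Omega> x" if "x \<in> ?S" for x using N(2) T(3) that by blast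
  qed (use N(1) in blast)
qed

lemma norm_outer_normal:
  assumes "charted \<Omega>" "x \<in> frontier \<Omega>"
  shows "norm (outer_normal \<Omega> x) = 1"
proof -
  obtain r i s \<gamma> where c: "chart \<Omega> x r i s \<gamma>" using assms unfolding charted_def by blast
  have x: "x \<in> ball x r" using chartD(2)[OF c] by simp
  show ?thesis
    using outer_normal_chart[OF c x assms(2)] norm_chart_normal[OF chartD(4)[OF c] chartD(3)[OF c]] by simp
qed

text \<open>On a tangent vector, a derivative within the boundary is the velocity of the function along a boundary curve.\<close>

lemma tangential_derivative_unique:
  fixes f :: "real^'n \<Rightarrow> 'b::real_normed_vector"
  assumes \<Omega>: "charted \<Omega>" and x: "x \<in> frontier \<Omega>" and \<tau>: "\<tau> \<bullet> outer_normal \<Omega> x = 0"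
    and L: "(f has_derivative L) (at x within frontier \<Omega>)" and M: "(g has_derivative M) (at x within frontier \<Omega>)"
    and fg: "\<And>y. y \<in> frontier \<Omega> \<Longrightarrow> f y = g y"
  shows "L \<tau> = M \<tau>"
proof -
  obtain r i s \<gamma> where c: "chart \<Omega> x r i s \<gamma>" using \<Omega> x unfolding charted_def by blast
  have xb: "x \<in> ball x r" using chartD(2)[OF c] by simp
  obtain \<alpha> where \<alpha>: "\<alpha> 0 = x" "(\<alpha> has_vector_derivative \<tau>) (at 0)" "\<forall>\<^sub>F t in at 0. \<alpha> t \<in> frontier \<Omega>"
    using chart_tangent_curve[OF c xb, of \<tau>] \<tau> outer_normal_chart[OF c xb x]
      chart_frontier_iff[OF c xb] x by metis
  obtain U where U: "open U" "0 \<in> U" and U': "\<forall>t\<in>U. t \<noteq> 0 \<longrightarrow> \<alpha> t \<in> frontier \<Omega>"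
    using \<alpha>(3) unfolding eventually_at_topological by auto
  have U3: "\<alpha> t \<in> frontier \<Omega>" if "t \<in> U" for t
    using U' x \<alpha>(1) that by (cases "t = 0") auto
  have w: "at 0 within U = at 0" using U(1,2) by (rule at_within_open[rotated])
  have D: "((\<lambda>t. f (\<alpha> t)) has_derivative (\<lambda>h. P (h *\<^sub>R \<tau>))) (at 0)"
    if "(f has_derivative P) (at x within frontier \<Omega>)" for f :: "real^'n \<Rightarrow> 'b" and P
  proof -
    have "(\<alpha> has_derivative (\<lambda>h. h *\<^sub>R \<tau>)) (at 0 within U)"
      using \<alpha>(2) w by (simp add: has_vector_derivative_def)
    moreover have "(f has_derivative P) (at (\<alpha> 0) within \<alpha> ` U)"
      unfolding \<alpha>(1) by (rule has_derivative_subset[OF that]) (use U3 in blast)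
    ultimately show ?thesis using has_derivative_in_compose[of \<alpha> _ 0 U f P] w by simp
  qed
  have M': "(f has_derivative M) (at x within frontier \<Omega>)"
    by (rule has_derivative_transform[OF x fg M])
  from has_derivative_unique[OF D[OF L] D[OF M']] show ?thesis
    by (metis scaleR_one)
qed

section \<open>Principal directions\<close>

text \<open>The spectral theorem for an operator that is self-adjoint on an invariant subspace: a maximizer
  of the quadratic form on the unit sphere is an eigenvector, and its orthogonal complement is again
  invariant.\<close>

lemma eigenvector_of_maximum:
  fixes f :: "'a::euclidean_space \<Rightarrow> 'a"
  assumes f: "linear f" and V: "subspace V" and inv: "\<And>v. v \<in> V \<Longrightarrow> f v \<in> V"
    and adj: "\<And>v w. v \<in> V \<Longrightarrow> w \<in> V \<Longrightarrow> f v \<bullet> w = v \<bullet> f w"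
    and e: "e \<in> V" "norm e = 1" "\<And>v. v \<in> V \<Longrightarrow> norm v = 1 \<Longrightarrow> f v \<bullet> v \<le> f e \<bullet> e"
  shows "f e = (f e \<bullet> e) *\<^sub>R e"
proof -
  define l where "l = f e \<bullet> e"
  have ee: "e \<bullet> e = 1" using e(2) by (simp add: norm_eq_1)
  have le: "f v \<bullet> v \<le> l * (v \<bullet> v)" if v: "v \<in> V" for v
  proof (cases "v = 0")
    case True then show ?thesis using linear_0[OF f] by simp
  next
    case False
    define u where "u = (1 / norm v) *\<^sub>R v"
    have u: "u \<in> V" "norm u = 1" using v V False by (auto simp: u_def subspace_scale)
    have vu: "v = norm v *\<^sub>R u" using False by (simp add: u_def)
    have "f v \<bullet> v = (norm v)\<^sup>2 * (f u \<bullet> u)"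
      by (subst (1 2) vu) (simp add: linear_scale[OF f] power2_eq_square)
    also have "\<dots> \<le> (norm v)\<^sup>2 * l" using e(3)[OF u] by (intro mult_left_mono) (auto simp: l_def)
    finally show ?thesis by (simp add: power2_norm_eq_inner mult.commute)
  qed
  define w where "w = f e - l *\<^sub>R e"
  have w: "w \<in> V" unfolding w_def using e(1) inv V by (intro subspace_diff subspace_scale)
  have we: "w \<bullet> e = 0" using ee by (simp add: w_def inner_diff_left l_def)
  have few: "f e \<bullet> w = w \<bullet> w"
    using we by (simp add: w_def inner_diff_left inner_diff_right inner_commute)
  have poly: "2 * t * (w \<bullet> w) \<le> t\<^sup>2 * (l * (w \<bullet> w) - f w \<bullet> w)" for t :: real
  proof -
    have "e + t *\<^sub>R w \<in> V" using e(1) w V by (intro subspace_add subspace_scale)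
    from le[OF this] have "f e \<bullet> e + 2 * t * (f e \<bullet> w) + t\<^sup>2 * (f w \<bullet> w) \<le> l * (1 + t\<^sup>2 * (w \<bullet> w))"
      using adj[OF e(1) w] we ee
      by (simp add: linear_add[OF f] linear_scale[OF f] inner_add_left inner_add_right power2_eq_square
          inner_commute algebra_simps)
    then show ?thesis by (simp add: few l_def algebra_simps)
  qed
  have "w \<bullet> w \<le> 0"
  proof (rule ccontr)
    assume "\<not> w \<bullet> w \<le> 0"
    then have pos: "w \<bullet> w > 0" by (simp only: not_le)
    define c where "c = l * (w \<bullet> w) - f w \<bullet> w"
    define t where "t = (w \<bullet> w) / (\<bar>c\<bar> + 1)"
    have t: "t > 0" using pos by (simp add: t_def)
    have "2 * t * (w \<bullet> w) \<le> t * (t * c)" using poly[of t] by (simp add: c_def power2_eq_square mult.assoc)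
    then have "2 * (w \<bullet> w) \<le> t * c" using t by simp
    also have "\<dots> \<le> t * (\<bar>c\<bar> + 1)" using t by (intro mult_left_mono) auto
    also have "\<dots> = w \<bullet> w" by (simp add: t_def)
    finally show False using pos by simp
  qed
  then have "w = 0" by (metis inner_eq_zero_iff inner_ge_zero order_antisym)
  then show ?thesis by (simp add: w_def l_def)
qed

lemma self_adjoint_orthonormal_eigenbasis:
  fixes f :: "'a::euclidean_space \<Rightarrow> 'a"
  assumes f: "linear f"
  shows "subspace V \<Longrightarrow> (\<And>v. v \<in> V \<Longrightarrow> f v \<in> V) \<Longrightarrow>
    (\<And>v w. v \<in> V \<Longrightarrow> w \<in> V \<Longrightarrow> f v \<bullet> w = v \<bullet> f w) \<Longrightarrow>
    \<exists>B. pairwise orthogonal B \<and> (\<forall>b\<in>B. norm b = 1) \<and> span B = V \<and> (\<forall>b\<in>B. f b = (f b \<bullet> b) *\<^sub>R b)"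
proof (induction "dim V" arbitrary: V rule: less_induct)
  case less
  note V = less.prems(1) and inv = less.prems(2) and adj = less.prems(3)
  show ?case
  proof (cases "V = {0}")
    case True
    then show ?thesis by (intro exI[of _ "{}"]) (auto simp: span_empty)
  next
    case False
    then obtain v where v: "v \<in> V" "v \<noteq> 0" using subspace_0[OF V] by blast
    let ?K = "V \<inter> sphere 0 1"
    have "closed V" using V by (rule closed_subspace)
    then have K: "compact ?K" by (intro closed_Int_compact compact_sphere)
    have "(1 / norm v) *\<^sub>R v \<in> ?K" using v V by (auto simp: subspace_scale)
    then have "?K \<noteq> {}" by blast
    moreover have "continuous_on ?K (\<lambda>v. f v \<bullet> v)"
      by (intro continuous_intros linear_continuous_on f linear_conv_bounded_linear[THEN iffD1])
    ultimately obtain e where e: "e \<in> ?K" "\<And>v. v \<in> ?K \<Longrightarrow> f v \<bullet> v \<le> f e \<bullet> e"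
      using continuous_attains_sup[OF K] by blast
    have eV: "e \<in> V" "norm e = 1" using e(1) by auto
    have ee: "e \<bullet> e = 1" using eV(2) by (simp add: norm_eq_1)
    have fe: "f e = (f e \<bullet> e) *\<^sub>R e"
      by (rule eigenvector_of_maximum[OF f V inv adj eV]) (use e(2) in auto)
    define W where "W = {w \<in> V. w \<bullet> e = 0}"
    have W: "subspace W" unfolding W_def
      using V by (auto simp: subspace_def inner_add_left)
    have Winv: "f w \<in> W" if "w \<in> W" for w
    proof -
      have "f w \<bullet> e = w \<bullet> f e" using adj that eV by (auto simp: W_def)
      also have "\<dots> = 0" using that by (subst fe) (simp add: W_def)
      finally show ?thesis using inv that by (simp add: W_def)
    qed
    have "e \<notin> W" using ee by (simp add: W_def)
    moreover have "W \<subseteq> V" by (auto simp: W_def)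
    ultimately have "W \<subset> V" using eV(1) by blast
    then have "span W \<subset> span V" using W V by (metis span_eq_iff)
    then have "dim W < dim V" by (rule dim_psubset)
    from less.hyps[OF this W Winv] adj obtain B where B: "pairwise orthogonal B" "\<forall>b\<in>B. norm b = 1"
      "span B = W" "\<forall>b\<in>B. f b = (f b \<bullet> b) *\<^sub>R b" unfolding W_def by blast
    have BW: "B \<subseteq> W" using B(3) span_superset by blast
    show ?thesis
    proof (intro exI[of _ "insert e B"] conjI)
      have "b \<bullet> e = 0" if "b \<in> B" for b using BW that by (auto simp: W_def)
      then show "pairwise orthogonal (insert e B)"
        using B(1) by (auto simp: pairwise_insert orthogonal_def inner_commute)
      show "\<forall>b\<in>insert e B. norm b = 1" using B(2) eV by auto
      show "\<forall>b\<in>insert e B. f b = (f b \<bullet> b) *\<^sub>R b" using B(4) fe by auto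
      show "span (insert e B) = V"
      proof
        have "insert e B \<subseteq> V" using BW eV by (auto simp: W_def)
        then show "span (insert e B) \<subseteq> V" using V by (rule span_minimal)
        show "V \<subseteq> span (insert e B)"
        proof
          fix x assume x: "x \<in> V"
          have "x - (x \<bullet> e) *\<^sub>R e \<in> W"
            using x eV V ee by (auto simp: W_def inner_diff_left intro: subspace_diff subspace_scale)
          then show "x \<in> span (insert e B)" using B(3) unfolding span_insert by blast
        qed
      qed
    qed
  qed
qed

text \<open>Together with \<open>\<nu>\<close>, the set \<open>B\<close> is an orthonormal basis of the whole space, and the trace can be computed in any
  orthonormal basis.\<close>

lemma trace_orthonormal_basis:
  fixes L :: "real^'n \<Rightarrow> real^'n"
  assumes L: "linear L" and B: "pairwise orthogonal B" "\<And>b. b \<in> B \<Longrightarrow> norm b = 1" "span B = {v. v \<bullet> \<nu> = 0}"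
    and \<nu>: "norm \<nu> = 1"
  shows "finite B" "(\<Sum>b\<in>B. b \<bullet> L b) = (\<Sum>j\<in>UNIV. L (axis j 1) $ j) - \<nu> \<bullet> L \<nu>"
proof -
  have \<nu>1: "\<nu> \<bullet> \<nu> = 1" using \<nu> by (simp add: norm_eq_1)
  have B\<nu>: "b \<bullet> \<nu> = 0" if "b \<in> B" for b using B(3) span_base[OF that] by blast
  then have \<nu>B: "\<nu> \<notin> B" using \<nu>1 by force
  let ?C = "insert \<nu> B"
  have C: "pairwise orthogonal ?C" "\<And>b. b \<in> ?C \<Longrightarrow> norm b = 1"
    using B B\<nu> \<nu> by (auto simp: pairwise_insert orthogonal_def inner_commute)
  have "0 \<notin> ?C" using C(2) by force
  then have "independent ?C" using C(1) pairwise_orthogonal_independent by blast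
  then have fC: "finite ?C" by (rule independent_bound[THEN conjunct1])
  then show fB: "finite B" by simp
  have sp: "x \<in> span ?C" for x
  proof -
    have "x - (x \<bullet> \<nu>) *\<^sub>R \<nu> \<in> span B" unfolding B(3) using \<nu>1 by (simp add: inner_diff_left)
    then show ?thesis unfolding span_insert by blast
  qed
  have ex: "(\<Sum>b\<in>?C. (x \<bullet> b) *\<^sub>R b) = x" for x
    by (rule orthonormal_basis_expand[OF C(1,2) sp fC])
  have "L (axis j 1) $ j = (\<Sum>b\<in>?C. b $ j * L b $ j)" for j
  proof -
    have "L (axis j 1) = L (\<Sum>b\<in>?C. (axis j 1 \<bullet> b) *\<^sub>R b)" using ex by simp
    also have "\<dots> = (\<Sum>b\<in>?C. (b $ j) *\<^sub>R L b)" using L by (simp add: linear_sum linear_scale inner_axis')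
    finally show ?thesis by simp
  qed
  then have "(\<Sum>j\<in>UNIV. L (axis j 1) $ j) = (\<Sum>b\<in>?C. \<Sum>j\<in>UNIV. b $ j * L b $ j)"
    by (simp add: sum.swap[of _ ?C])
  also have "\<dots> = (\<Sum>b\<in>?C. b \<bullet> L b)" by (simp add: inner_vec_def)
  also have "\<dots> = \<nu> \<bullet> L \<nu> + (\<Sum>b\<in>B. b \<bullet> L b)" using fB \<nu>B by simp
  finally show "(\<Sum>b\<in>B. b \<bullet> L b) = (\<Sum>j\<in>UNIV. L (axis j 1) $ j) - \<nu> \<bullet> L \<nu>" by simp
qed

text \<open>Up to a term in the normal direction, the derivative of a chart normal is a multiple of the
  Hessian of the height function, hence symmetric on tangent vectors.\<close>

lemma jac_chart_normal_symmetric: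
  assumes \<gamma>: "smooth_height i \<gamma>" and s: "s \<in> {1, -1}"
    and a: "a \<bullet> chart_normal i s \<gamma> x = 0" and b: "b \<bullet> chart_normal i s \<gamma> x = 0"
  shows "jac (chart_normal i s \<gamma>) x a \<bullet> b = a \<bullet> jac (chart_normal i s \<gamma>) x b"
proof -
  define k where "k x = s * inverse (sqrt (1 + (norm (grad \<gamma> x))\<^sup>2))" for x
  define m where "m x = grad \<gamma> x - axis i 1" for x
  have N: "chart_normal i s \<gamma> = (\<lambda>x. k x *\<^sub>R m x)"
    by (simp add: fun_eq_iff chart_normal_def k_def m_def divide_inverse)
  have p: "Ck_on 1 UNIV (partial_deriv j \<gamma>)" for j
    using smooth_heightD(1)[OF \<gamma>, of 2] by (simp add: numeral_2_eq_2)
  have "Ck_on 1 UNIV (\<lambda>x. 1 + (\<Sum>j\<in>UNIV. partial_deriv j \<gamma> x * partial_deriv j \<gamma> x))"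
    by (intro Ck_on_add Ck_on_const Ck_on_sum Ck_on_mult p open_UNIV)
  then have "Ck_on 1 UNIV (\<lambda>x. 1 + (norm (grad \<gamma> x))\<^sup>2)"
    by (simp add: power2_norm_eq_inner inner_vec_def)
  moreover have sq: "1 + (norm (grad \<gamma> x))\<^sup>2 > 0" "sqrt (1 + (norm (grad \<gamma> x))\<^sup>2) \<noteq> 0" for x
    using sqrt_one_plus_norm_pos[of "grad \<gamma> x"] by (simp add: add_pos_nonneg, linarith)
  ultimately have k: "Ck_on 1 UNIV k"
    unfolding k_def by (intro Ck_on_mult Ck_on_inverse Ck_on_sqrt Ck_on_const open_UNIV)
  have "m x \<bullet> c = 0" if "c \<bullet> chart_normal i s \<gamma> x = 0" for c
    using that s sq(2)[of x] by (auto simp: N k_def inner_commute)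
  then have mab: "m x \<bullet> a = 0" "m x \<bullet> b = 0" using a b by auto
  have "grad (\<lambda>y. chart_normal i s \<gamma> y $ j) x \<bullet> h
     = k x * (grad (partial_deriv j \<gamma>) x \<bullet> h) + (grad k x \<bullet> h) * m x $ j" for j h
  proof -
    have dk: "(k has_derivative (\<lambda>h. grad k x \<bullet> h)) (at x)"
      using Ck_on_has_derivative[of 0 UNIV k x] k by simp
    have dp: "(partial_deriv j \<gamma> has_derivative (\<lambda>h. grad (partial_deriv j \<gamma>) x \<bullet> h)) (at x)"
      using Ck_on_has_derivative[of 0 UNIV "partial_deriv j \<gamma>" x] p by simp
    have "((\<lambda>y. k y * (partial_deriv j \<gamma> y - axis i 1 $ j)) has_derivative
        (\<lambda>h. k x * (grad (partial_deriv j \<gamma>) x \<bullet> h) + (grad k x \<bullet> h) * m x $ j)) (at x)"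
      by (auto intro!: derivative_eq_intros dk dp simp: m_def)
    moreover have "(\<lambda>h. k x * (grad (partial_deriv j \<gamma>) x \<bullet> h) + (grad k x \<bullet> h) * m x $ j)
       = (\<lambda>h. (k x *\<^sub>R grad (partial_deriv j \<gamma>) x + (m x $ j) *\<^sub>R grad k x) \<bullet> h)"
      by (simp add: fun_eq_iff inner_add_left mult.commute)
    ultimately have "grad (\<lambda>y. k y * (partial_deriv j \<gamma> y - axis i 1 $ j)) x
       = k x *\<^sub>R grad (partial_deriv j \<gamma>) x + (m x $ j) *\<^sub>R grad k x" by (metis grad_eqI)
    then show ?thesis by (simp add: N m_def inner_add_left mult.commute)
  qed
  then have J: "jac (chart_normal i s \<gamma>) x h \<bullet> c = k x * (\<Sum>j\<in>UNIV. (grad (partial_deriv j \<gamma>) x \<bullet> h) * c $ j)"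
    if "m x \<bullet> c = 0" for h c
    using that by (simp add: inner_vec_def[of "jac _ _ _"] distrib_right sum.distrib sum_distrib_left[symmetric]
        mult.assoc inner_vec_def[of "m x" c])
  have "(\<Sum>j\<in>UNIV. (grad (partial_deriv j \<gamma>) x \<bullet> a) * b $ j) = (\<Sum>j\<in>UNIV. (grad (partial_deriv j \<gamma>) x \<bullet> b) * a $ j)"
  proof -
    have "(\<Sum>j\<in>UNIV. (grad (partial_deriv j \<gamma>) x \<bullet> a) * b $ j)
       = (\<Sum>j\<in>UNIV. \<Sum>l\<in>UNIV. partial_deriv l (partial_deriv j \<gamma>) x * a $ l * b $ j)"
      by (simp add: inner_vec_def sum_distrib_right)
    also have "\<dots> = (\<Sum>l\<in>UNIV. \<Sum>j\<in>UNIV. partial_deriv j (partial_deriv l \<gamma>) x * b $ j * a $ l)"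
      by (subst sum.swap, intro sum.cong refl)
         (simp add: partial_deriv_commute[OF open_UNIV smooth_heightD(1)[OF \<gamma>]] mult.assoc mult.commute[of "a $ _"])
    also have "\<dots> = (\<Sum>j\<in>UNIV. (grad (partial_deriv j \<gamma>) x \<bullet> b) * a $ j)"
      by (simp add: inner_vec_def sum_distrib_right)
    finally show ?thesis .
  qed
  then show ?thesis using J[OF mab(2), of a] J[OF mab(1), of b] by (simp add: inner_commute[of a])
qed

text \<open>The length of \<open>N\<close> is constant along the boundary.\<close>

lemma jac_unit_normal_tangential:
  fixes N :: "real^'n \<Rightarrow> real^'n"
  assumes \<Omega>: "charted \<Omega>" and x: "x \<in> frontier \<Omega>"
    and N: "\<And>j. Ck_on 1 UNIV (\<lambda>x. N x $ j)" "\<And>x. x \<in> frontier \<Omega> \<Longrightarrow> N x = outer_normal \<Omega> x"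
    and v: "v \<bullet> outer_normal \<Omega> x = 0"
  shows "N x \<bullet> jac N x v = 0"
proof -
  have dN: "(N has_derivative jac N x) (at x within frontier \<Omega>)"
    using N(1) by (intro has_derivative_jac[of 0 UNIV]) auto
  have "((\<lambda>y. N y \<bullet> N y) has_derivative (\<lambda>h. N x \<bullet> jac N x h + jac N x h \<bullet> N x)) (at x within frontier \<Omega>)"
    by (intro has_derivative_inner dN)
  moreover have "((\<lambda>y. 1::real) has_derivative (\<lambda>h. 0)) (at x within frontier \<Omega>)" by simp
  moreover have "N y \<bullet> N y = 1" if "y \<in> frontier \<Omega>" for y
    using norm_outer_normal[OF \<Omega> that] N(2)[OF that] by (simp add: norm_eq_1)
  ultimately have "N x \<bullet> jac N x v + jac N x v \<bullet> N x = 0"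
    using tangential_derivative_unique[OF \<Omega> x v] by blast
  then show ?thesis by (simp add: inner_commute)
qed

lemma shape_operator_frame:
  fixes N :: "real^'n \<Rightarrow> real^'n"
  assumes \<Omega>: "charted \<Omega>" and x: "x \<in> frontier \<Omega>"
    and N: "\<And>j. Ck_on 1 UNIV (\<lambda>x. N x $ j)" "\<And>x. x \<in> frontier \<Omega> \<Longrightarrow> N x = outer_normal \<Omega> x"
  obtains B \<kappa> where "principal_curvature_frame \<Omega> x B \<kappa>"
proof -
  obtain r i s \<gamma> where c: "chart \<Omega> x r i s \<gamma>" using \<Omega> x unfolding charted_def by blast
  note C = chartD[OF c]
  have xb: "x \<in> ball x r" using C(2) by simp
  let ?\<nu> = "outer_normal \<Omega> x"
  let ?C = "chart_normal i s \<gamma>"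
  have \<nu>C: "?\<nu> = ?C x" by (rule outer_normal_chart[OF c xb x])
  have dN: "(N has_derivative jac N x) (at x within frontier \<Omega>)"
    using N(1) by (intro has_derivative_jac[of 0 UNIV]) auto
  have dC: "(?C has_derivative jac ?C x) (at x within frontier \<Omega>)"
    using Ck_on_chart_normal[OF C(4), of 1 s] by (intro has_derivative_jac[of 0 UNIV]) auto
  have dC': "(outer_normal \<Omega> has_derivative jac ?C x) (at x within frontier \<Omega>)"
    by (rule has_derivative_transform_within[OF dC C(2) x])
       (use outer_normal_chart[OF c] in \<open>auto simp: dist_commute\<close>)
  have dN': "(outer_normal \<Omega> has_derivative jac N x) (at x within frontier \<Omega>)"
    by (rule has_derivative_transform[OF x _ dN]) (simp add: N(2))
  let ?V = "{v. v \<bullet> ?\<nu> = 0}"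
  have V: "subspace ?V" by (auto simp: subspace_def inner_add_left)
  have eq: "jac N x v = jac ?C x v" if "v \<in> ?V" for v
    using tangential_derivative_unique[OF \<Omega> x _ dN' dC'] that by blast
  have inv: "jac N x v \<in> ?V" if v: "v \<in> ?V" for v
    using jac_unit_normal_tangential[OF \<Omega> x N, of v] v N(2)[OF x] by (simp add: inner_commute)
  have adj: "jac N x v \<bullet> w = v \<bullet> jac N x w" if "v \<in> ?V" "w \<in> ?V" for v w
    using jac_chart_normal_symmetric[OF C(4,3), of v x w] that eq \<nu>C by simp
  obtain B where B: "pairwise orthogonal B" "\<forall>b\<in>B. norm b = 1" "span B = ?V"
      "\<forall>b\<in>B. jac N x b = (jac N x b \<bullet> b) *\<^sub>R b"
    using self_adjoint_orthonormal_eigenbasis[OF linear_jac V inv adj] by blast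
  then have "principal_curvature_frame \<Omega> x B (\<lambda>b. jac N x b \<bullet> b)"
    unfolding principal_curvature_frame_def using dN' by blast
  then show ?thesis using that by blast
qed

lemma frame_sum_principal_curvatures:
  fixes N :: "real^'n \<Rightarrow> real^'n"
  assumes \<Omega>: "charted \<Omega>" and x: "x \<in> frontier \<Omega>"
    and N: "\<And>j. Ck_on 1 UNIV (\<lambda>x. N x $ j)" "\<And>x. x \<in> frontier \<Omega> \<Longrightarrow> N x = outer_normal \<Omega> x"
    and fr: "principal_curvature_frame \<Omega> x B \<kappa>"
  shows "(\<Sum>b\<in>B. \<kappa> b) = divergence N x - N x \<bullet> jac N x (N x)"
proof -
  obtain L where B: "pairwise orthogonal B" "\<forall>b\<in>B. norm b = 1" "span B = {v. v \<bullet> outer_normal \<Omega> x = 0}"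
    and L: "(outer_normal \<Omega> has_derivative L) (at x within frontier \<Omega>)" "\<And>b. b \<in> B \<Longrightarrow> L b = \<kappa> b *\<^sub>R b"
    using fr unfolding principal_curvature_frame_def by blast
  have dN: "(N has_derivative jac N x) (at x within frontier \<Omega>)"
    using N(1) by (intro has_derivative_jac[of 0 UNIV]) auto
  have "\<kappa> b = b \<bullet> jac N x b" if b: "b \<in> B" for b
  proof -
    have "b \<bullet> outer_normal \<Omega> x = 0" using B(3) span_base[OF b] by blast
    then have "L b = jac N x b"
      using tangential_derivative_unique[OF \<Omega> x _ L(1) dN] N(2) by metis
    then have "b \<bullet> jac N x b = \<kappa> b * (b \<bullet> b)" using L(2)[OF b] by (metis inner_scaleR_right)
    then show ?thesis using B(2) b by (simp add: norm_eq_1)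
  qed
  then have "(\<Sum>b\<in>B. \<kappa> b) = (\<Sum>b\<in>B. b \<bullet> jac N x b)" by simp
  also have "\<dots> = divergence N x - outer_normal \<Omega> x \<bullet> jac N x (outer_normal \<Omega> x)"
    unfolding divergence_eq_trace_jac
    using trace_orthonormal_basis(2)[OF linear_jac B(1) _ B(3) norm_outer_normal[OF \<Omega> x]] B(2) by blast
  finally show ?thesis using N(2)[OF x] by simp
qed

lemma mean_curvature_eq:
  fixes N :: "real^'n \<Rightarrow> real^'n"
  assumes \<Omega>: "charted \<Omega>" and x: "x \<in> frontier \<Omega>"
    and N: "\<And>j. Ck_on 1 UNIV (\<lambda>x. N x $ j)" "\<And>x. x \<in> frontier \<Omega> \<Longrightarrow> N x = outer_normal \<Omega> x"
  shows "mean_curvature \<Omega> x = (divergence N x - N x \<bullet> jac N x (N x)) / (real CARD('n) - 1)"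
  unfolding mean_curvature_def
proof (rule the_equality)
  obtain B \<kappa> where "principal_curvature_frame \<Omega> x B \<kappa>" by (rule shape_operator_frame[OF \<Omega> x N])
  then show "\<exists>B \<kappa>. principal_curvature_frame \<Omega> x B \<kappa> \<and>
     (divergence N x - N x \<bullet> jac N x (N x)) / (real CARD('n) - 1) = (\<Sum>b\<in>B. \<kappa> b) / (real CARD('n) - 1)"
    using frame_sum_principal_curvatures[OF \<Omega> x N] by (intro exI conjI) auto
next
  fix H assume "\<exists>B \<kappa>. principal_curvature_frame \<Omega> x B \<kappa> \<and> H = (\<Sum>b\<in>B. \<kappa> b) / (real CARD('n) - 1)"
  then obtain B \<kappa> where "principal_curvature_frame \<Omega> x B \<kappa>" "H = (\<Sum>b\<in>B. \<kappa> b) / (real CARD('n) - 1)"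
    by blast
  then show "H = (divergence N x - N x \<bullet> jac N x (N x)) / (real CARD('n) - 1)"
    using frame_sum_principal_curvatures[OF \<Omega> x N] by simp
qed

text \<open>The tangential divergence of a field that is normal along the boundary only sees the curvature:
  derivatives of its length contribute in the normal direction only.\<close>

lemma tangential_divergence_normal_field:
  fixes F N :: "real^'n \<Rightarrow> real^'n"
  assumes n2: "CARD('n) \<ge> 2" and \<Omega>: "charted \<Omega>" and x: "x \<in> frontier \<Omega>"
    and N: "\<And>j. Ck_on 1 UNIV (\<lambda>x. N x $ j)" "\<And>x. x \<in> frontier \<Omega> \<Longrightarrow> N x = outer_normal \<Omega> x"
    and F: "\<And>j. Ck_on 1 V (\<lambda>x. F x $ j)" "open V" "frontier \<Omega> \<subseteq> V"
    and FN: "\<And>y. y \<in> frontier \<Omega> \<Longrightarrow> F y = (F y \<bullet> N y) *\<^sub>R N y"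
  shows "divergence F x - N x \<bullet> jac F x (N x) = (F x \<bullet> N x) * ((real CARD('n) - 1) * mean_curvature \<Omega> x)"
proof -
  let ?\<nu> = "outer_normal \<Omega> x"
  obtain B \<kappa> where fr: "principal_curvature_frame \<Omega> x B \<kappa>" by (rule shape_operator_frame[OF \<Omega> x N])
  then have B: "pairwise orthogonal B" "\<And>b. b \<in> B \<Longrightarrow> norm b = 1" "span B = {v. v \<bullet> ?\<nu> = 0}"
    unfolding principal_curvature_frame_def by blast+
  have dN: "(N has_derivative jac N x) (at x within frontier \<Omega>)"
    using N(1) by (intro has_derivative_jac[of 0 UNIV]) auto
  have dF: "(F has_derivative jac F x) (at x within frontier \<Omega>)"
    using F x by (intro has_derivative_jac[of 0 V]) auto
  have "b \<bullet> jac F x b = (F x \<bullet> N x) * (b \<bullet> jac N x b)" if b: "b \<in> B" for b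
  proof -
    have b\<nu>: "b \<bullet> ?\<nu> = 0" using B(3) span_base[OF b] by blast
    have "((\<lambda>y. (F y \<bullet> N y) *\<^sub>R N y) has_derivative
       (\<lambda>h. (F x \<bullet> N x) *\<^sub>R jac N x h + (F x \<bullet> jac N x h + jac F x h \<bullet> N x) *\<^sub>R N x)) (at x within frontier \<Omega>)"
      by (intro has_derivative_scaleR has_derivative_inner dN dF)
    from tangential_derivative_unique[OF \<Omega> x b\<nu> dF this FN]
    have "b \<bullet> jac F x b = b \<bullet> ((F x \<bullet> N x) *\<^sub>R jac N x b + (F x \<bullet> jac N x b + jac F x b \<bullet> N x) *\<^sub>R N x)" by metis
    also have "\<dots> = (F x \<bullet> N x) * (b \<bullet> jac N x b)"
      using b\<nu> N(2)[OF x] by (simp add: inner_add_right)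
    finally show ?thesis .
  qed
  then have "(\<Sum>b\<in>B. b \<bullet> jac F x b) = (F x \<bullet> N x) * (\<Sum>b\<in>B. b \<bullet> jac N x b)"
    by (simp add: sum_distrib_left)
  moreover have tr: "(\<Sum>b\<in>B. b \<bullet> jac G x b) = divergence G x - N x \<bullet> jac G x (N x)" for G
    unfolding divergence_eq_trace_jac
    using trace_orthonormal_basis(2)[OF linear_jac B norm_outer_normal[OF \<Omega> x]] N(2)[OF x] by simp
  moreover have "(real CARD('n) - 1) * mean_curvature \<Omega> x = divergence N x - N x \<bullet> jac N x (N x)"
    using mean_curvature_eq[OF \<Omega> x N] n2 by simp
  ultimately show ?thesis by simp
qed


section \<open>Symmetric functions of the eigenvalues\<close>

text \<open>In the Leibniz expansion, a permutation other than the identity picks at least one constant entry, so only the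
  identity contributes to the top degree.\<close>

lemma charpoly_degree:
  fixes A :: "real^'n^'n"
  shows "degree (charpoly A) = CARD('n)" "lead_coeff (charpoly A) = 1"
proof -
  define M :: "complex poly^'n^'n" where
    "M = (\<chi> i j. (if i = j then [:0, 1:] else 0) - [:complex_of_real (A $ i $ j):])"
  define leib where "leib p = of_int (sign p) * (\<Prod>i\<in>UNIV. M $ i $ p i)" for p
  let ?P = "{p. p permutes (UNIV :: 'n set)}"
  have fin: "finite ?P" by (simp add: finite_permutations)
  have Mii: "M $ i $ i = [:- complex_of_real (A $ i $ i), 1:]" for i by (simp add: M_def)
  have d1: "degree (M $ i $ j) \<le> 1" for i j by (simp add: M_def)
  have d0: "degree (M $ i $ j) = 0" if "i \<noteq> j" for i j using that by (simp add: M_def)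
  have id: "degree (leib id) = CARD('n)" "lead_coeff (leib id) = 1"
  proof -
    have l: "leib id = (\<Prod>i\<in>UNIV. [:- complex_of_real (A $ i $ i), 1:])"
      by (simp add: leib_def sign_id Mii)
    show "degree (leib id) = CARD('n)" unfolding l by (subst degree_prod_eq_sum_degree) auto
    show "lead_coeff (leib id) = 1" unfolding l by (subst lead_coeff_prod) simp
  qed
  have lt: "degree (leib p) < CARD('n)" if p: "p \<in> ?P - {id}" for p
  proof -
    obtain k where k: "p k \<noteq> k" using p by (auto simp: fun_eq_iff)
    have "degree (leib p) \<le> degree (\<Prod>i\<in>UNIV. M $ i $ p i)"
      unfolding leib_def of_int_poly
      by (rule order_trans[OF degree_mult_le]) simp
    also have "\<dots> \<le> (\<Sum>i\<in>UNIV. degree (M $ i $ p i))"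
      using degree_prod_sum_le[of UNIV "\<lambda>i. M $ i $ p i"] by (simp add: o_def)
    also have "\<dots> = (\<Sum>i\<in>UNIV - {k}. degree (M $ i $ p i))"
      using k d0[of k "p k"] by (subst sum.remove[of _ k]) auto
    also have "\<dots> \<le> (\<Sum>i\<in>UNIV - {k}. 1)" by (intro sum_mono d1)
    also have "\<dots> < CARD('n)" by (simp add: card_Diff_singleton card_gt_0_iff)
    finally show ?thesis .
  qed
  have "charpoly A = (\<Sum>p\<in>?P. leib p)"
    by (simp add: charpoly_def det_def leib_def M_def)
  also have "\<dots> = (\<Sum>p\<in>?P - {id}. leib p) + leib id"
    using fin by (subst sum.remove[of _ id]) (auto simp: permutes_id)
  finally have e: "charpoly A = (\<Sum>p\<in>?P - {id}. leib p) + leib id" .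
  have "degree (\<Sum>p\<in>?P - {id}. leib p) < CARD('n)"
    by (rule degree_sum_less) (use lt in auto)
  then show "degree (charpoly A) = CARD('n)" "lead_coeff (charpoly A) = 1"
    unfolding e using id by (simp_all add: degree_add_eq_right coeff_eq_0)
qed

lemma charpoly_eigenvalues:
  fixes A :: "real^'n^'n"
  shows "charpoly A = (\<Prod>i\<in>UNIV. [:- eigenvalues A i, 1:])"
proof -
  obtain root where root: "smult (lead_coeff (charpoly A)) (\<Prod>i<degree (charpoly A). [:- root i, 1:]) = charpoly A"
    by (rule complex_poly_decompose')
  obtain h where h: "bij_betw h (UNIV :: 'n set) {0..<CARD('n)}"
    using ex_bij_betw_finite_nat[of "UNIV :: 'n set"] by auto
  have "charpoly A = (\<Prod>k\<in>{0..<CARD('n)}. [:- root k, 1:])"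
    using root charpoly_degree[of A] by (simp add: atLeast0LessThan)
  also have "\<dots> = (\<Prod>i\<in>UNIV. [:- root (h i), 1:])"
    by (rule prod.reindex_bij_betw[OF h, symmetric])
  finally have "\<exists>l :: 'n \<Rightarrow> complex. charpoly A = (\<Prod>i\<in>UNIV. [:- l i, 1:])" by (rule exI[of _ "\<lambda>i. root (h i)"])
  then show ?thesis unfolding eigenvalues_def by (rule someI_ex)
qed

definition id_minus :: "complex \<Rightarrow> complex^'n^'n \<Rightarrow> complex^'n^'n" where
  "id_minus t M = (\<chi> i j. (if i = j then 1 else 0) - t * M $ i $ j)"

text \<open>A permutation other than the identity moves at least two indices. Its product in the Leibniz expansion has two
  factors that vanish at \<open>t = 0\<close>, hence zero derivative there.\<close>

lemma det_id_minus_deriv: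
  fixes M :: "complex^'n^'n"
  shows "((\<lambda>t. det (id_minus t M)) has_field_derivative - trace M) (at 0)"
proof -
  let ?P = "{p. p permutes (UNIV :: 'n set)}"
  let ?d = "\<lambda>i j::'n. (if i = j then 1 else 0) :: complex"
  define D where "D p = (\<Sum>i\<in>UNIV. (- M $ i $ p i) * (\<Prod>j\<in>UNIV - {i}. ?d j (p j)))" for p
  have fin: "finite ?P" by (simp add: finite_permutations)
  have "((\<lambda>t. \<Prod>i\<in>UNIV. (?d i (p i) - t * M $ i $ p i)) has_field_derivative
     (\<Sum>i\<in>UNIV. (- M $ i $ p i) * (\<Prod>j\<in>UNIV - {i}. (?d j (p j) - 0 * M $ j $ p j)))) (at 0)" for p
    by (rule has_field_derivative_prod) (auto intro!: derivative_eq_intros)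
  then have "((\<lambda>t. \<Prod>i\<in>UNIV. (?d i (p i) - t * M $ i $ p i)) has_field_derivative D p) (at 0)" for p
    by (simp add: D_def)
  then have "((\<lambda>t. \<Sum>p\<in>?P. of_int (sign p) * (\<Prod>i\<in>UNIV. (?d i (p i) - t * M $ i $ p i)))
      has_field_derivative (\<Sum>p\<in>?P. of_int (sign p) * D p)) (at 0)"
    by (intro DERIV_sum DERIV_cmult)
  moreover have "D p = 0" if p: "p \<in> ?P - {id}" for p
  proof -
    obtain k where k: "p k \<noteq> k" using p by (auto simp: fun_eq_iff)
    have inj: "inj p" using p permutes_inj by blast
    have kk: "p (p k) \<noteq> p k" using k inj by (auto dest: injD)
    have "(\<Prod>j\<in>UNIV - {i}. ?d j (p j)) = 0" for i
    proof (cases "i = k")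
      case True
      then show ?thesis using k kk by (intro prod_zero) (auto intro!: bexI[of _ "p k"])
    next
      case False
      then show ?thesis using k by (intro prod_zero) (auto intro!: bexI[of _ k])
    qed
    then show ?thesis unfolding D_def by (intro sum.neutral ballI) (simp only: mult_zero_right)
  qed
  then have "(\<Sum>p\<in>?P. of_int (sign p) * D p) = of_int (sign id) * D id"
    using fin by (subst sum.remove[of _ id]) (auto simp: permutes_id)
  moreover have "D id = - trace M" by (simp add: D_def trace_def sum_negf)
  ultimately show ?thesis
    by (simp add: det_def id_minus_def)
qed

lemma prod_deriv:
  fixes l :: "'n::finite \<Rightarrow> complex"
  shows "((\<lambda>t. \<Prod>i\<in>UNIV. 1 - t * l i) has_field_derivative - (\<Sum>i\<in>UNIV. l i)) (at 0)"
proof -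
  have "((\<lambda>t. \<Prod>i\<in>UNIV. 1 - t * l i) has_field_derivative
     (\<Sum>i\<in>UNIV. (- l i) * (\<Prod>j\<in>UNIV - {i}. 1 - 0 * l j))) (at 0)"
    by (rule has_field_derivative_prod) (auto intro!: derivative_eq_intros)
  then show ?thesis by (simp add: sum_negf)
qed

definition cmat :: "real^'n^'n \<Rightarrow> complex^'n^'n" where
  "cmat A = (\<chi> i j. complex_of_real (A $ i $ j))"

lemma det_id_minus_eigenvalues:
  fixes A :: "real^'n^'n"
  shows "det (id_minus t (cmat A)) = (\<Prod>i\<in>UNIV. 1 - t * eigenvalues A i)"
proof (cases "t = 0")
  case True
  have "id_minus 0 (cmat A) = mat 1" by (simp add: id_minus_def mat_def vec_eq_iff)
  then show ?thesis using True by simp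
next
  case False
  define z where "z = 1 / t"
  have tz: "t * z = 1" using False by (simp add: z_def)
  let ?P = "{p. p permutes (UNIV :: 'n set)}"
  have "det (id_minus t (cmat A))
     = (\<Sum>p\<in>?P. of_int (sign p) * (\<Prod>i\<in>UNIV. t * ((if i = p i then z else 0) - complex_of_real (A $ i $ p i))))"
    unfolding det_def id_minus_def cmat_def
    by (intro sum.cong refl arg_cong2[where f="(*)"] prod.cong) (auto simp: right_diff_distrib tz)
  also have "\<dots> = t ^ CARD('n) * (\<Sum>p\<in>?P. of_int (sign p) * (\<Prod>i\<in>UNIV. ((if i = p i then z else 0) - complex_of_real (A $ i $ p i))))"
    by (simp add: prod.distrib sum_distrib_left mult_ac)
  also have "(\<Sum>p\<in>?P. of_int (sign p) * (\<Prod>i\<in>UNIV. ((if i = p i then z else 0) - complex_of_real (A $ i $ p i))))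
      = poly (charpoly A) z"
    unfolding charpoly_def det_def poly_sum poly_mult poly_prod
    by (intro sum.cong refl arg_cong2[where f="(*)"] prod.cong) auto
  also have "\<dots> = (\<Prod>i\<in>UNIV. z - eigenvalues A i)"
    by (subst charpoly_eigenvalues) (simp add: poly_prod)
  also have "t ^ CARD('n) * \<dots> = (\<Prod>i\<in>UNIV. t * (z - eigenvalues A i))"
    by (simp add: prod.distrib)
  finally show ?thesis by (simp add: right_diff_distrib tz)
qed

lemma sum_eigenvalues:
  fixes A :: "real^'n^'n"
  shows "(\<Sum>i\<in>UNIV. eigenvalues A i) = complex_of_real (trace A)"
proof -
  have "((\<lambda>t. det (id_minus t (cmat A))) has_field_derivative - (\<Sum>i\<in>UNIV. eigenvalues A i)) (at 0)"
    unfolding det_id_minus_eigenvalues by (rule prod_deriv)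
  then have "- (\<Sum>i\<in>UNIV. eigenvalues A i) = - trace (cmat A)"
    using det_id_minus_deriv DERIV_unique by blast
  then show ?thesis by (simp add: trace_def cmat_def)
qed

text \<open>Squares of eigenvalues are eigenvalues of the square, in the form
  \<open>det (I - t A) det (I + t A) = det (I - t\<^sup>2 A\<^sup>2)\<close>.\<close>

lemma sum_eigenvalues_square:
  fixes A :: "real^'n^'n"
  shows "(\<Sum>i\<in>UNIV. (eigenvalues A i)\<^sup>2) = complex_of_real (trace (A ** A))"
proof -
  have "id_minus t M ** id_minus (- t) M = id_minus (t\<^sup>2) (M ** M)" for t and M :: "complex^'n^'n"
  proof -
    have "(\<Sum>k\<in>UNIV. ((if i = k then 1 else 0) - t * M $ i $ k) * ((if k = j then 1 else 0) + t * M $ k $ j))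
        = (if i = j then 1 else 0) - t\<^sup>2 * (\<Sum>k\<in>UNIV. M $ i $ k * M $ k $ j)" for i j
    proof -
      have "((if i = k then 1 else 0) - t * M $ i $ k) * ((if k = j then 1 else 0) + t * M $ k $ j)
         = (if i = k then (if k = j then 1 else 0) + t * M $ k $ j else 0)
           - (if k = j then t * M $ i $ k else 0) - t\<^sup>2 * (M $ i $ k * M $ k $ j)" for k
        by (simp add: algebra_simps power2_eq_square)
      then show ?thesis by (simp add: sum_subtractf sum_distrib_left)
    qed
    then show ?thesis by (simp add: id_minus_def matrix_matrix_mult_def vec_eq_iff)
  qed
  then have d: "det (id_minus (t\<^sup>2) (M ** M)) = det (id_minus t M) * det (id_minus (- t) M)" for t and M :: "complex^'n^'n"
    by (metis det_mul)
  have "det (id_minus s (cmat A ** cmat A)) = (\<Prod>i\<in>UNIV. 1 - s * (eigenvalues A i)\<^sup>2)" for s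
  proof -
    have "det (id_minus ((csqrt s)\<^sup>2) (cmat A ** cmat A))
       = (\<Prod>i\<in>UNIV. (1 - csqrt s * eigenvalues A i) * (1 + csqrt s * eigenvalues A i))"
      unfolding d det_id_minus_eigenvalues by (simp add: prod.distrib)
    also have "\<dots> = (\<Prod>i\<in>UNIV. 1 - (csqrt s)\<^sup>2 * (eigenvalues A i)\<^sup>2)"
      by (intro prod.cong) (auto simp: algebra_simps power2_eq_square)
    finally show ?thesis by simp
  qed
  then have "((\<lambda>t. det (id_minus t (cmat A ** cmat A))) has_field_derivative - (\<Sum>i\<in>UNIV. (eigenvalues A i)\<^sup>2)) (at 0)"
    by (simp only: prod_deriv)
  then have "- (\<Sum>i\<in>UNIV. (eigenvalues A i)\<^sup>2) = - trace (cmat A ** cmat A)"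
    using det_id_minus_deriv DERIV_unique by blast
  then show ?thesis by (simp add: trace_def cmat_def matrix_matrix_mult_def)
qed

lemma sum_pairs:
  fixes l :: "'a \<Rightarrow> complex"
  assumes "finite S"
  shows "2 * (\<Sum>I | I \<subseteq> S \<and> card I = 2. \<Prod>i\<in>I. l i) = (\<Sum>i\<in>S. l i)\<^sup>2 - (\<Sum>i\<in>S. (l i)\<^sup>2)"
  using assms
proof (induction S rule: finite_induct)
  case empty
  have "{I :: 'a set. I \<subseteq> {} \<and> card I = 2} = {}" by auto
  then show ?case by simp
next
  case (insert a S)
  have e: "{I. I \<subseteq> insert a S \<and> card I = 2} = {I. I \<subseteq> S \<and> card I = 2} \<union> (\<lambda>i. {a, i}) ` S"
  proof (intro equalityI subsetI)
    fix I assume I: "I \<in> {I. I \<subseteq> insert a S \<and> card I = 2}"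
    show "I \<in> {I. I \<subseteq> S \<and> card I = 2} \<union> (\<lambda>i. {a, i}) ` S"
    proof (cases "a \<in> I")
      case True
      then obtain b where "I = {a, b}" "a \<noteq> b" using I by (auto simp: card_2_iff)
      then show ?thesis using I by auto
    qed (use I in auto)
  qed (use insert.hyps in \<open>auto simp: card_insert_if\<close>)
  have inj: "inj_on (\<lambda>i. {a, i}) S" using insert.hyps(2) by (auto simp: inj_on_def doubleton_eq_iff)
  have "(\<Sum>I | I \<subseteq> insert a S \<and> card I = 2. \<Prod>i\<in>I. l i)
     = (\<Sum>I | I \<subseteq> S \<and> card I = 2. \<Prod>i\<in>I. l i) + (\<Sum>I\<in>(\<lambda>i. {a, i}) ` S. \<Prod>i\<in>I. l i)"
    unfolding e by (rule sum.union_disjoint) (use insert.hyps in auto)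
  also have "(\<Sum>I\<in>(\<lambda>i. {a, i}) ` S. \<Prod>i\<in>I. l i) = (\<Sum>i\<in>S. l a * l i)"
    unfolding sum.reindex[OF inj] o_def using insert.hyps(2) by (intro sum.cong refl prod.insert[THEN trans]) auto
  also have "\<dots> = l a * (\<Sum>i\<in>S. l i)" by (simp add: sum_distrib_left)
  finally show ?case
    using insert.IH insert.hyps by (simp add: distrib_left power2_sum)
qed

lemma eig_sym_1: "eig_sym 1 A = trace A"
proof -
  have "{I :: 'a set. card I = 1} = (\<lambda>i. {i}) ` UNIV" by (auto simp: card_1_singleton_iff)
  then have "(\<Sum>I | card I = 1. \<Prod>i\<in>I. eigenvalues A i) = (\<Sum>i\<in>UNIV. eigenvalues A i)"
    by (simp add: sum.reindex inj_on_def)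
  then show ?thesis by (simp add: eig_sym_def sum_eigenvalues)
qed

lemma eig_sym_2: "2 * eig_sym 2 A = (trace A)\<^sup>2 - trace (A ** A)"
proof -
  have "2 * (\<Sum>I | card I = 2. \<Prod>i\<in>I. eigenvalues A i) = complex_of_real ((trace A)\<^sup>2 - trace (A ** A))"
    using sum_pairs[of "UNIV :: 'a set" "eigenvalues A"] by (simp add: sum_eigenvalues sum_eigenvalues_square)
  from arg_cong[OF this, of Re] show ?thesis by (simp add: eig_sym_def)
qed


section \<open>A divergence identity\<close>

lemma partial_deriv_mult:
  assumes "f differentiable (at x)" "g differentiable (at x)"
  shows "partial_deriv i (\<lambda>x. f x * g x) x = f x * partial_deriv i g x + partial_deriv i f x * g x"
  by (subst partial_deriv_eq[OF has_derivative_mult[OF assms[THEN has_derivative_grad]]]) (simp add: inner_axis)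

lemma partial_deriv_diff:
  assumes "f differentiable (at x)" "g differentiable (at x)"
  shows "partial_deriv i (\<lambda>x. f x - g x) x = partial_deriv i f x - partial_deriv i g x"
  by (subst partial_deriv_eq[OF has_derivative_diff[OF assms[THEN has_derivative_grad]]]) (simp add: inner_axis)

lemma partial_deriv_sum:
  assumes "\<And>a. a \<in> A \<Longrightarrow> f a differentiable (at x)"
  shows "partial_deriv i (\<lambda>x. \<Sum>a\<in>A. f a x) x = (\<Sum>a\<in>A. partial_deriv i (f a) x)"
  by (subst partial_deriv_eq[OF has_derivative_sum[where f'="\<lambda>a h. grad (f a) x \<bullet> h"]])
     (auto simp: inner_axis intro: has_derivative_grad assms)

lemma Ck_on_divergence:
  assumes "open V" "\<And>j. Ck_on (Suc k) V (\<lambda>x. Y x $ j)"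
  shows "Ck_on k V (divergence Y)"
  unfolding divergence_def[abs_def] using assms by (intro Ck_on_sum) auto

lemma Ck_on_jac:
  assumes "open V" "\<And>j. Ck_on (Suc k) V (\<lambda>x. Y x $ j)" "\<And>j. Ck_on k V (\<lambda>x. X x $ j)"
  shows "Ck_on k V (\<lambda>x. jac Y x (X x) $ j)"
  unfolding jac_eq_sum using assms by (intro Ck_on_sum Ck_on_mult) auto

lemma Ck_on_newton_field:
  assumes "open V" "\<And>j. Ck_on (Suc k) V (\<lambda>x. Y x $ j)" "\<And>j. Ck_on k V (\<lambda>x. X x $ j)"
  shows "Ck_on k V (\<lambda>x. (divergence Y x *\<^sub>R X x - jac Y x (X x)) $ j)"
  unfolding vector_minus_component vector_scaleR_component real_scaleR_def
  by (intro Ck_on_diff Ck_on_mult Ck_on_divergence Ck_on_jac assms)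

text \<open>The second derivatives cancel because they commute.\<close>

lemma divergence_newton_field:
  fixes X Y :: "real^'n \<Rightarrow> real^'n"
  assumes V: "open V" "x \<in> V" and X: "\<And>j. Ck_on 1 V (\<lambda>x. X x $ j)" and Y: "\<And>j. Ck_on 2 V (\<lambda>x. Y x $ j)"
  shows "divergence (\<lambda>y. divergence Y y *\<^sub>R X y - jac Y y (X y)) x
    = divergence X x * divergence Y x
      - (\<Sum>i\<in>UNIV. \<Sum>k\<in>UNIV. partial_deriv i (\<lambda>y. X y $ k) x * partial_deriv k (\<lambda>y. Y y $ i) x)"
proof -
  let ?X = "\<lambda>k y. X y $ k" and ?Y = "\<lambda>k y. Y y $ k"
  have dX: "?X k differentiable (at x)" for k using Ck_on_differentiable[of 0 V] X V by simp
  have pY: "Ck_on 1 V (partial_deriv k (?Y j))" for k j using Y[of j] by (simp add: numeral_2_eq_2)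
  have dpY: "partial_deriv k (?Y j) differentiable (at x)" for k j
    using Ck_on_differentiable[of 0 V] pY V by simp
  have Y': "\<And>j. Ck_on (Suc 1) V (\<lambda>x. Y x $ j)" using Y by (simp add: numeral_2_eq_2)
  have "Ck_on 1 V (divergence Y)" using V(1) Y' by (rule Ck_on_divergence)
  then have ddY: "divergence Y differentiable (at x)" using Ck_on_differentiable[of 0 V] V by simp
  have djY: "(\<lambda>y. \<Sum>k\<in>UNIV. partial_deriv k (?Y i) y * ?X k y) differentiable (at x)" for i
  proof -
    have "Ck_on 1 V (\<lambda>y. \<Sum>k\<in>UNIV. partial_deriv k (?Y i) y * ?X k y)"
      by (intro Ck_on_sum Ck_on_mult V pY X)
    then show ?thesis using Ck_on_differentiable[of 0 V] V by simp
  qed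
  have pm: "(\<lambda>y. f y * g y) differentiable (at x)" if "f differentiable (at x)" "g differentiable (at x)"
    for f g :: "real^'n \<Rightarrow> real" using that by (rule differentiable_mult)
  have i: "partial_deriv i (\<lambda>y. (divergence Y y *\<^sub>R X y - jac Y y (X y)) $ i) x
     = divergence Y x * partial_deriv i (?X i) x + (\<Sum>k\<in>UNIV. X x $ i * partial_deriv i (partial_deriv k (?Y k)) x)
       - (\<Sum>k\<in>UNIV. partial_deriv i (?X k) x * partial_deriv k (?Y i) x)
       - (\<Sum>k\<in>UNIV. X x $ k * partial_deriv i (partial_deriv k (?Y i)) x)" for i
  proof -
    have "partial_deriv i (\<lambda>y. (divergence Y y *\<^sub>R X y - jac Y y (X y)) $ i) x
       = partial_deriv i (\<lambda>y. divergence Y y * ?X i y - (\<Sum>k\<in>UNIV. partial_deriv k (?Y i) y * ?X k y)) x"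
      by (simp add: jac_eq_sum del: jac_nth)
    also have "\<dots> = divergence Y x * partial_deriv i (?X i) x + partial_deriv i (divergence Y) x * X x $ i
        - (\<Sum>k\<in>UNIV. partial_deriv k (?Y i) x * partial_deriv i (?X k) x + partial_deriv i (partial_deriv k (?Y i)) x * X x $ k)"
      by (simp add: partial_deriv_diff pm ddY dX djY partial_deriv_mult partial_deriv_sum dpY)
    also have "partial_deriv i (divergence Y) x = (\<Sum>k\<in>UNIV. partial_deriv i (partial_deriv k (?Y k)) x)"
      unfolding divergence_def[abs_def] by (rule partial_deriv_sum) (rule dpY)
    finally show ?thesis by (simp add: sum.distrib sum_distrib_left sum_distrib_right mult_ac)
  qed
  have "(\<Sum>i\<in>UNIV. \<Sum>k\<in>UNIV. X x $ k * partial_deriv i (partial_deriv k (?Y i)) x)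
     = (\<Sum>i\<in>UNIV. \<Sum>k\<in>UNIV. X x $ i * partial_deriv i (partial_deriv k (?Y k)) x)"
    by (subst sum.swap) (simp add: partial_deriv_commute[OF V(1) Y V(2)])
  then show ?thesis
    unfolding divergence_def[of "\<lambda>y. divergence Y y *\<^sub>R X y - jac Y y (X y)"] i
    by (simp add: sum.distrib sum_subtractf sum_distrib_left divergence_def[of X] mult.commute)
qed

section \<open>An inequality for the shape operator\<close>

text \<open>With \<open>g = I / w + d d\<^sup>T / w\<^sup>3\<close>, whose inverse is \<open>w (I - d d\<^sup>T)\<close>, the matrix is \<open>A = B g\<close>. Writing
  \<open>A - I = C g\<close> with the symmetric \<open>C = B - g\<^sup>-\<^sup>1\<close>, the trace of \<open>C g\<close> vanishes, so that \<open>tr A\<^sup>2 - n\<close> is the trace of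
  \<open>(C g)\<^sup>2\<close>, which is a sum of squares.\<close>

lemma trace_square_shape:
  fixes A B :: "real^'n^'n" and d :: "real^'n"
  assumes w: "w > 0" "w\<^sup>2 = 1 - d \<bullet> d" and B: "\<And>i j. B $ i $ j = B $ j $ i"
    and A: "\<And>i j. A $ i $ j = B $ i $ j / w + (\<Sum>k\<in>UNIV. B $ i $ k * d $ k) * d $ j / w ^ 3"
    and tr: "trace A = real CARD('n)"
  shows "real CARD('n) \<le> trace (A ** A)" "trace (A ** A) = real CARD('n) \<Longrightarrow> A = mat 1"
proof -
  define I :: "'n \<Rightarrow> 'n \<Rightarrow> real" where "I i j = (if i = j then 1 else 0)" for i j
  define C where "C i j = B $ i $ j - w * (I i j - d $ i * d $ j)" for i j
  define e where "e i = (\<Sum>k\<in>UNIV. C i k * d $ k)" for i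
  define M where "M i j = C i j / w + e i * d $ j / w ^ 3" for i j
  have Csym: "C i j = C j i" for i j using B[of i j] by (simp add: C_def I_def)
  have dd: "(\<Sum>k\<in>UNIV. d $ k * d $ k) = 1 - w\<^sup>2" using w by (simp add: inner_vec_def)
  have e: "e i = (\<Sum>k\<in>UNIV. B $ i $ k * d $ k) - w ^ 3 * d $ i" for i
  proof -
    have "e i = (\<Sum>k\<in>UNIV. B $ i $ k * d $ k) - w * ((\<Sum>k\<in>UNIV. I i k * d $ k) - d $ i * (\<Sum>k\<in>UNIV. d $ k * d $ k))"
      by (simp add: e_def C_def left_diff_distrib right_diff_distrib sum_subtractf sum_distrib_left mult_ac)
    also have "(\<Sum>k\<in>UNIV. I i k * d $ k) = (\<Sum>k\<in>UNIV. if k = i then d $ k else 0)"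
      by (intro sum.cong) (auto simp: I_def)
    also have "\<dots> = d $ i" by simp
    finally show ?thesis unfolding dd by (simp add: algebra_simps power2_eq_square power3_eq_cube)
  qed
  have AM: "A $ i $ j = M i j + I i j" for i j
    using w(1) unfolding A M_def e C_def by (simp add: field_simps power3_eq_cube)
  have trM: "(\<Sum>i\<in>UNIV. M i i) = 0"
    using tr by (simp add: trace_def AM sum.distrib I_def)
  have "trace (A ** A) = (\<Sum>i\<in>UNIV. \<Sum>j\<in>UNIV. (M i j + I i j) * (M j i + I j i))"
    by (simp add: trace_def matrix_matrix_mult_def AM)
  also have "\<dots> = (\<Sum>i\<in>UNIV. \<Sum>j\<in>UNIV. M i j * M j i + (if i = j then M i i + M i i + 1 else 0))"
    by (intro sum.cong refl) (auto simp: I_def algebra_simps)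
  also have "\<dots> = (\<Sum>i\<in>UNIV. \<Sum>j\<in>UNIV. M i j * M j i) + real CARD('n)"
    using trM by (simp add: sum.distrib sum_distrib_left[symmetric])
  finally have trA: "trace (A ** A) = (\<Sum>i\<in>UNIV. \<Sum>j\<in>UNIV. M i j * M j i) + real CARD('n)" .
  define a b where "a = 1 / w" and "b = 1 / w ^ 3"
  have ab: "a > 0" "b > 0" using w(1) by (auto simp: a_def b_def)
  have M: "M i j = a * C i j + b * (e i * d $ j)" for i j by (simp add: M_def a_def b_def)
  have "(\<Sum>i\<in>UNIV. \<Sum>j\<in>UNIV. M i j * M j i)
     = a\<^sup>2 * (\<Sum>i\<in>UNIV. \<Sum>j\<in>UNIV. (C i j)\<^sup>2) + 2 * a * b * (\<Sum>j\<in>UNIV. (e j)\<^sup>2) + b\<^sup>2 * (\<Sum>i\<in>UNIV. e i * d $ i)\<^sup>2"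
  proof -
    have "M i j * M j i = a\<^sup>2 * (C i j)\<^sup>2 + a * b * (e j * (C j i * d $ i)) + a * b * (e i * (C i j * d $ j))
        + b\<^sup>2 * ((e i * d $ i) * (e j * d $ j))" for i j
      unfolding M by (subst (2) Csym) (simp add: Csym[of j i] algebra_simps power2_eq_square)
    then have "(\<Sum>i\<in>UNIV. \<Sum>j\<in>UNIV. M i j * M j i)
       = a\<^sup>2 * (\<Sum>i\<in>UNIV. \<Sum>j\<in>UNIV. (C i j)\<^sup>2)
        + a * b * (\<Sum>i\<in>UNIV. \<Sum>j\<in>UNIV. e j * (C j i * d $ i))
        + a * b * (\<Sum>i\<in>UNIV. \<Sum>j\<in>UNIV. e i * (C i j * d $ j))
        + b\<^sup>2 * (\<Sum>i\<in>UNIV. \<Sum>j\<in>UNIV. (e i * d $ i) * (e j * d $ j))"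
      by (simp add: sum.distrib sum_distrib_left)
    also have "(\<Sum>i\<in>UNIV. \<Sum>j\<in>UNIV. e j * (C j i * d $ i)) = (\<Sum>j\<in>UNIV. (e j)\<^sup>2)"
      by (subst sum.swap) (simp add: e_def sum_distrib_left[symmetric] power2_eq_square)
    also have "(\<Sum>i\<in>UNIV. \<Sum>j\<in>UNIV. e i * (C i j * d $ j)) = (\<Sum>j\<in>UNIV. (e j)\<^sup>2)"
      by (simp add: e_def sum_distrib_left[symmetric] power2_eq_square)
    also have "(\<Sum>i\<in>UNIV. \<Sum>j\<in>UNIV. (e i * d $ i) * (e j * d $ j)) = (\<Sum>i\<in>UNIV. e i * d $ i)\<^sup>2"
      by (simp add: power2_eq_square sum_product)
    finally show ?thesis by simp
  qed
  moreover have "(\<Sum>j\<in>UNIV. (e j)\<^sup>2) \<ge> 0" "(\<Sum>i\<in>UNIV. \<Sum>j\<in>UNIV. (C i j)\<^sup>2) \<ge> 0" by (auto intro!: sum_nonneg)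
  ultimately have ge: "(\<Sum>i\<in>UNIV. \<Sum>j\<in>UNIV. M i j * M j i) \<ge> a\<^sup>2 * (\<Sum>i\<in>UNIV. \<Sum>j\<in>UNIV. (C i j)\<^sup>2)"
    and ge0: "a\<^sup>2 * (\<Sum>i\<in>UNIV. \<Sum>j\<in>UNIV. (C i j)\<^sup>2) \<ge> 0"
    using ab by (auto intro!: add_nonneg_nonneg mult_nonneg_nonneg)
  show "real CARD('n) \<le> trace (A ** A)" using ge ge0 trA by linarith
  assume "trace (A ** A) = real CARD('n)"
  then have "a\<^sup>2 * (\<Sum>i\<in>UNIV. \<Sum>j\<in>UNIV. (C i j)\<^sup>2) = 0" using ge ge0 trA by linarith
  then have "(\<Sum>i\<in>UNIV. \<Sum>j\<in>UNIV. (C i j)\<^sup>2) = 0" using ab by simp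
  then have "\<forall>i. (\<Sum>j\<in>UNIV. (C i j)\<^sup>2) = 0" by (subst (asm) sum_nonneg_eq_0_iff) (auto intro: sum_nonneg)
  then have C0: "C i j = 0" for i j by (metis (no_types, lifting) UNIV_I finite_class.finite_UNIV power_eq_0_iff sum_nonneg_eq_0_iff zero_le_power2)
  show "A = mat 1" by (simp add: vec_eq_iff AM M C0 e_def mat_def I_def)
qed

section \<open>Balls and vanishing integrals\<close>

text \<open>The open ball and the exterior of the closed ball are connected and do not meet the boundary, so the domain contains
  or misses each of them. Being bounded, it misses the exterior. In dimension one the exterior is not connected.\<close>

lemma domain_bounded_by_sphere_is_ball:
  fixes \<Omega> :: "'a::euclidean_space set"
  assumes dim: "DIM('a) \<ge> 2" and \<Omega>: "open \<Omega>" "bounded \<Omega>" "\<Omega> \<noteq> {}" and S: "frontier \<Omega> \<subseteq> sphere a r"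
  shows "r > 0 \<and> \<Omega> = ball a r"
proof -
  have "connected (- cball a r)"
    using dim by (intro connected_complement_bounded_convex) auto
  moreover have "- cball a r \<inter> frontier \<Omega> = {}" using S by auto
  ultimately have "- cball a r \<inter> \<Omega> = {} \<or> - cball a r - \<Omega> = {}"
    using connected_Int_frontier by blast
  moreover have "\<not> (- cball a r - \<Omega> = {})"
  proof
    assume "- cball a r - \<Omega> = {}"
    then have "UNIV = cball a r \<union> \<Omega>" by blast
    then show False using \<Omega>(2) bounded_cball not_bounded_UNIV by (metis bounded_Un)
  qed
  ultimately have "\<Omega> \<subseteq> cball a r" by blast
  then have sub: "\<Omega> \<subseteq> ball a r" using \<Omega>(1) interior_maximal interior_cball by metis
  then have r: "r > 0" using \<Omega>(3) by (metis ball_empty leI subset_empty)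
  have "ball a r \<inter> frontier \<Omega> = {}" using S by auto
  then have "ball a r - \<Omega> = {}"
    using connected_Int_frontier[OF connected_ball, of a r \<Omega>] sub \<Omega>(3) by blast
  then show ?thesis using r sub by blast
qed

lemma continuous_nonneg_integral_zero:
  fixes f :: "'a::euclidean_space \<Rightarrow> real"
  assumes \<Omega>: "open \<Omega>" and f: "continuous_on \<Omega> f" "\<And>x. x \<in> \<Omega> \<Longrightarrow> f x \<ge> 0"
    and i: "set_integrable lborel \<Omega> f" "(LINT x:\<Omega>|lborel. f x) \<le> 0" and x: "x \<in> \<Omega>"
  shows "f x = 0"
proof -
  have nn: "indicator \<Omega> x *\<^sub>R f x \<ge> 0" for x using f(2) by (simp add: indicator_def)
  have "(LINT x:\<Omega>|lborel. f x) \<ge> 0"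
    unfolding set_lebesgue_integral_def using nn by (intro Bochner_Integration.integral_nonneg) auto
  then have z: "(\<integral>x. indicator \<Omega> x *\<^sub>R f x \<partial>lborel) = 0" using i(2) by (simp add: set_lebesgue_integral_def)
  have "AE x in lborel. indicator \<Omega> x *\<^sub>R f x = 0"
    using integral_nonneg_eq_0_iff_AE[OF i(1)[unfolded set_integrable_def]] nn z by simp
  let ?U = "\<Omega> \<inter> f -` (- {0})"
  have o: "open ?U" using f(1) \<Omega> by (intro continuous_open_preimage) auto
  have "AE x in lborel. x \<notin> ?U"
    using \<open>AE x in lborel. indicator \<Omega> x *\<^sub>R f x = 0\<close> by eventually_elim auto
  then have "?U \<in> null_sets lborel" using o by (subst (asm) AE_iff_null_sets[symmetric]) auto
  then have "negligible ?U" by (simp add: negligible_iff_null_sets null_sets_completionI)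
  then have "?U = {}" using o open_not_negligible by blast
  then show ?thesis using x by blast
qed


section \<open>Space-like graphs of constant mean curvature over a domain\<close>

text \<open>On the neighbourhood \<open>V\<close> of the closure \<open>u\<close> is smooth and space-like, so that \<open>w\<close> is smooth and positive. The field \<open>N\<close>
  extends the outer normal to the whole space.\<close>

locale cmc_graph =
  fixes \<Omega> :: "(real^'n) set" and u :: "real^'n \<Rightarrow> real" and c :: real
    and V :: "(real^'n) set" and N :: "real^'n \<Rightarrow> real^'n" and n :: real
  assumes n_eq: "n = real CARD('n)" and card: "CARD('n) \<ge> 2"
    and \<Omega>: "open \<Omega>" "connected \<Omega>" "\<Omega> \<noteq> {}" "bounded \<Omega>" "charted \<Omega>"
    and V: "open V" "closure \<Omega> \<subseteq> V"
    and u_smooth: "\<And>k. Ck_on k V u"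
    and spacelike: "\<And>x. x \<in> V \<Longrightarrow> norm (grad u x) < 1"
    and pde: "\<And>x. x \<in> \<Omega> \<Longrightarrow> divergence (\<lambda>y. (1 / w_fun u y) *\<^sub>R grad u y) x = n"
    and u_boundary: "\<And>x. x \<in> frontier \<Omega> \<Longrightarrow> u x = c"
    and N_smooth: "\<And>j. Ck_on 2 UNIV (\<lambda>x. N x $ j)"
    and N_normal: "\<And>x. x \<in> frontier \<Omega> \<Longrightarrow> N x = outer_normal \<Omega> x"
begin

abbreviation "S \<equiv> frontier \<Omega>"
abbreviation "\<sigma> \<equiv> surface_measure S"
abbreviation "H \<equiv> mean_curvature \<Omega>"
abbreviation "w \<equiv> w_fun u"

definition v :: "real^'n \<Rightarrow> real^'n" where "v y = (1 / w y) *\<^sub>R grad u y"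

text \<open>The boundary value of \<open>|Du| / w\<close>, with the sign that makes \<open>v = q N\<close>.\<close>

definition q :: "real^'n \<Rightarrow> real" where "q x = v x \<bullet> N x"

definition tr2 :: "real^'n \<Rightarrow> real" where "tr2 x = trace (shape_matrix u x ** shape_matrix u x)"

lemma n2: "n \<ge> 2"
  using card by (simp add: n_eq)

lemma S_subset: "S \<subseteq> V" "\<Omega> \<subseteq> V" "S \<subseteq> closure \<Omega>"
  using V closure_subset by (auto simp: frontier_def)

lemma N1: "\<And>j. Ck_on 1 UNIV (\<lambda>x. N x $ j)"
  using N_smooth Ck_on_le one_le_numeral by blast

lemma continuous_N: "continuous_on X N"
  using continuous_on_vec_lambda[of UNIV "\<lambda>j x. N x $ j"] Ck_on_continuous[OF N1] continuous_on_subset[of UNIV N X]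
  by simp

lemma norm_N: "x \<in> S \<Longrightarrow> norm (N x) = 1"
  using norm_outer_normal[OF \<Omega>(5)] N_normal by simp

lemma N_N: "x \<in> S \<Longrightarrow> N x \<bullet> N x = 1"
  using norm_N by (simp add: norm_eq_1)

lemma w_pos: "x \<in> V \<Longrightarrow> w x > 0" "x \<in> V \<Longrightarrow> (w x)\<^sup>2 = 1 - grad u x \<bullet> grad u x"
proof -
  assume "x \<in> V"
  then have "(norm (grad u x))\<^sup>2 < 1" using spacelike[of x] by (simp add: abs_square_less_1)
  then show "w x > 0" "(w x)\<^sup>2 = 1 - grad u x \<bullet> grad u x"
    by (simp_all add: w_fun_def power2_norm_eq_inner)
qed

lemma Ck_u_partial: "Ck_on k V (partial_deriv j u)"
  using u_smooth[of "Suc k"] by simp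

lemma Ck_w: "Ck_on k V w"
proof -
  have "Ck_on k V (\<lambda>x. 1 - (\<Sum>j\<in>UNIV. partial_deriv j u x * partial_deriv j u x))"
    by (intro Ck_on_diff Ck_on_const Ck_on_sum Ck_on_mult Ck_u_partial V(1))
  moreover have "0 < 1 - (\<Sum>j\<in>UNIV. partial_deriv j u x * partial_deriv j u x)" if "x \<in> V" for x
  proof -
    have "(w x)\<^sup>2 > 0" using w_pos(1)[OF that] by simp
    then show ?thesis unfolding w_pos(2)[OF that] by (simp add: inner_vec_def)
  qed
  ultimately show ?thesis
    unfolding w_fun_def[abs_def] power2_norm_eq_inner inner_vec_def grad_nth inner_real_def
    by (intro Ck_on_sqrt V(1))
qed

lemma Ck_v: "Ck_on k V (\<lambda>x. v x $ j)"
proof -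
  have "Ck_on k V (\<lambda>x. inverse (w x) * partial_deriv j u x)"
    using w_pos(1) by (intro Ck_on_mult Ck_on_inverse Ck_w Ck_u_partial V(1)) force
  then show ?thesis by (simp add: v_def divide_inverse)
qed

lemma continuous_v: "continuous_on V v"
  using continuous_on_vec_lambda[of V "\<lambda>j x. v x $ j"] Ck_on_continuous[OF Ck_v] by simp

lemma shape_matrix_nth: "shape_matrix u x $ i $ j = partial_deriv i (\<lambda>y. v y $ j) x"
  by (simp add: shape_matrix_def v_def)

lemma trace_shape: "trace (shape_matrix u x) = divergence v x"
  by (simp add: trace_def shape_matrix_nth divergence_def)

lemma trace_shape_interior: "x \<in> \<Omega> \<Longrightarrow> trace (shape_matrix u x) = n"
  using pde[of x] by (simp add: trace_shape v_def[abs_def])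

lemma tr2_eq: "tr2 x = (\<Sum>i\<in>UNIV. \<Sum>k\<in>UNIV. partial_deriv i (\<lambda>y. v y $ k) x * partial_deriv k (\<lambda>y. v y $ i) x)"
  by (simp add: tr2_def trace_def matrix_matrix_mult_def shape_matrix_nth)

lemma Ck_tr2: "Ck_on k V tr2"
  unfolding tr2_eq[abs_def] using Ck_v[of "Suc k"] by (intro Ck_on_sum Ck_on_mult V(1)) auto

text \<open>Differentiating \<open>w\<^sup>2 = 1 - |Du|\<^sup>2\<close> and \<open>w v = Du\<close>.\<close>

lemma shape_matrix_formula:
  assumes x: "x \<in> V"
  defines "B \<equiv> (\<chi> i j. partial_deriv i (partial_deriv j u) x)"
  shows "shape_matrix u x $ i $ j = B $ i $ j / w x + (\<Sum>k\<in>UNIV. B $ i $ k * grad u x $ k) * grad u x $ j / w x ^ 3"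
proof -
  have d: "f differentiable (at x)" if "Ck_on 1 V f" for f
    using Ck_on_differentiable[of 0 V f] that V(1) x by simp
  have dw: "w differentiable (at x)" by (rule d[OF Ck_w])
  have dv: "(\<lambda>y. v y $ j) differentiable (at x)" by (rule d[OF Ck_v])
  have du: "partial_deriv k u differentiable (at x)" for k by (rule d[OF Ck_u_partial])
  have dus: "(\<lambda>y. partial_deriv k u y * partial_deriv k u y) differentiable (at x)" for k
    using du du by (rule differentiable_mult)
  have wpos: "w x > 0" by (rule w_pos(1)[OF x])
  have "partial_deriv i (\<lambda>y. w y * w y) x
      = partial_deriv i (\<lambda>y. 1 - (\<Sum>k\<in>UNIV. partial_deriv k u y * partial_deriv k u y)) x"
    by (rule partial_deriv_cong[OF V(1) x]) (use w_pos(2) in \<open>simp add: power2_eq_square inner_vec_def\<close>)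
  also have "\<dots> = 0 - (\<Sum>k\<in>UNIV. 2 * (B $ i $ k * grad u x $ k))"
  proof (subst partial_deriv_diff)
    show "(\<lambda>y. \<Sum>k\<in>UNIV. partial_deriv k u y * partial_deriv k u y) differentiable (at x)"
      using dus by (intro differentiable_sum) auto
    show "partial_deriv i (\<lambda>y. 1) x - partial_deriv i (\<lambda>y. \<Sum>k\<in>UNIV. partial_deriv k u y * partial_deriv k u y) x
       = 0 - (\<Sum>k\<in>UNIV. 2 * (B $ i $ k * grad u x $ k))"
      by (simp add: partial_deriv_sum dus partial_deriv_mult du B_def partial_deriv_def[of i "\<lambda>y. 1"] mult.commute)
  qed simp
  finally have two: "2 * (w x * partial_deriv i w x) = - 2 * (\<Sum>k\<in>UNIV. B $ i $ k * grad u x $ k)"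
    by (simp add: partial_deriv_mult dw sum_distrib_left[symmetric])
  define X where "X = (\<Sum>k\<in>UNIV. B $ i $ k * grad u x $ k)"
  have "w x * partial_deriv i w x = - X" using two unfolding X_def[symmetric] by simp
  then have pw: "partial_deriv i w x = - X / w x"
    using wpos by (metis less_irrefl nonzero_mult_div_cancel_left)
  have "partial_deriv i (\<lambda>y. w y * v y $ j) x = partial_deriv i (partial_deriv j u) x"
    by (rule partial_deriv_cong[OF V(1) x]) (use w_pos(1) in \<open>force simp: v_def\<close>)
  then have "w x * shape_matrix u x $ i $ j + partial_deriv i w x * v x $ j = B $ i $ j"
    by (simp add: partial_deriv_mult dw dv shape_matrix_nth B_def)
  then have "w x * shape_matrix u x $ i $ j = B $ i $ j + X * grad u x $ j / (w x * w x)"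
    unfolding pw by (simp add: v_def)
  then have "shape_matrix u x $ i $ j = (B $ i $ j + X * grad u x $ j / (w x * w x)) / w x"
    using wpos by (simp add: eq_divide_eq mult.commute)
  then show ?thesis
    unfolding X_def[symmetric] by (simp add: add_divide_distrib power3_eq_cube)
qed

lemma tr2_ge: "x \<in> \<Omega> \<Longrightarrow> tr2 x \<ge> n"
  and shape_matrix_eq_id: "x \<in> \<Omega> \<Longrightarrow> tr2 x = n \<Longrightarrow> shape_matrix u x = mat 1"
proof -
  assume x: "x \<in> \<Omega>"
  then have xV: "x \<in> V" using S_subset by blast
  define B where "B = (\<chi> i j. partial_deriv i (partial_deriv j u) x)"
  have sym: "B $ i $ j = B $ j $ i" for i j
    by (simp add: B_def partial_deriv_commute[OF V(1) u_smooth xV])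
  note * = trace_square_shape[OF w_pos[OF xV] sym shape_matrix_formula[OF xV, folded B_def]
      trace_shape_interior[OF x, unfolded n_eq], folded n_eq]
  show "tr2 x \<ge> n" using *(1) by (simp add: tr2_def)
  show "shape_matrix u x = mat 1" if "tr2 x = n" using *(2) that by (simp add: tr2_def)
qed

lemma u_has_derivative: "x \<in> V \<Longrightarrow> (u has_derivative (\<lambda>h. grad u x \<bullet> h)) (at x within X)"
  using Ck_on_has_derivative[OF u_smooth[of "Suc 0"] V(1)] by (rule has_derivative_at_withinI)

text \<open>At an interior maximum the equation reads \<open>\<Delta>u = n > 0\<close>, which is incompatible with a maximum.\<close>

lemma no_interior_maximum:
  assumes x: "x \<in> \<Omega>" and max: "\<And>y. y \<in> \<Omega> \<Longrightarrow> u y \<le> u x"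
  shows False
proof -
  have xV: "x \<in> V" using S_subset x by blast
  have d: "u differentiable (at y)" if "y \<in> V" for y
    using u_has_derivative[OF that, of UNIV] by (auto simp: differentiable_def)
  obtain r where r: "r > 0" "ball x r \<subseteq> \<Omega>" using \<Omega>(1) x openE by blast
  have inb: "x + t *\<^sub>R axis i 1 \<in> \<Omega>" if "\<bar>t\<bar> < r" for t i
    using r(2) that by (auto simp: subset_iff dist_norm)
  have du: "((\<lambda>t. u (x + t *\<^sub>R axis i 1)) has_real_derivative partial_deriv i u (x + t *\<^sub>R axis i 1)) (at t)"
    if "\<bar>t\<bar> < r" for t i
    using partial_deriv_has_real_derivative[OF d, of x t "axis i 1"] inb[OF that] S_subset(2) by (auto simp: inner_axis)
  have g0: "partial_deriv i u x = 0" for i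
    using DERIV_local_max[OF du[of 0 i], of r] r(1) inb max by auto
  then have gz: "grad u x = 0" by (simp add: vec_eq_iff)
  have w1: "w x = 1" by (simp add: w_fun_def gz)
  have "n = trace (shape_matrix u x)" using trace_shape_interior[OF x] by simp
  also have "\<dots> = (\<Sum>i\<in>UNIV. partial_deriv i (partial_deriv i u) x)"
    unfolding trace_def shape_matrix_formula[OF xV] by (simp add: gz g0 w1)
  finally have s: "n = (\<Sum>i\<in>UNIV. partial_deriv i (partial_deriv i u) x)" .
  have "\<exists>i. partial_deriv i (partial_deriv i u) x > 0"
  proof (rule ccontr)
    assume "\<nexists>i. partial_deriv i (partial_deriv i u) x > 0"
    then have "(\<Sum>i\<in>UNIV. partial_deriv i (partial_deriv i u) x) \<le> 0" by (intro sum_nonpos) (auto simp: not_less)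
    then show False using s n2 by simp
  qed
  then obtain i where i: "partial_deriv i (partial_deriv i u) x > 0" by blast
  have "partial_deriv i u differentiable (at (x + 0 *\<^sub>R axis i 1))"
    using Ck_on_differentiable[of 0 V, OF _ V(1)] Ck_u_partial[of 1 i] xV by simp
  from partial_deriv_has_real_derivative[OF this]
  have "((\<lambda>t. partial_deriv i u (x + t *\<^sub>R axis i 1)) has_real_derivative partial_deriv i (partial_deriv i u) x) (at 0)"
    by (simp add: inner_axis)
  from DERIV_pos_inc_right[OF this i] obtain e where e: "e > 0"
    "\<And>h. h > 0 \<Longrightarrow> h < e \<Longrightarrow> partial_deriv i u (x + h *\<^sub>R axis i 1) > 0"
    using g0 by auto
  define t where "t = min e r / 2"
  have t: "t > 0" "t < e" "t < r" using e(1) r(1) by (auto simp: t_def)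
  obtain z where z: "0 < z" "z < t"
    "u (x + t *\<^sub>R axis i 1) - u (x + 0 *\<^sub>R axis i 1) = (t - 0) * partial_deriv i u (x + z *\<^sub>R axis i 1)"
    using MVT2[OF t(1) du[of _ i]] t by fastforce
  have "t * partial_deriv i u (x + z *\<^sub>R axis i 1) > 0" using z e(2)[of z] t by (intro mult_pos_pos) auto
  then have "u (x + t *\<^sub>R axis i 1) > u x" using z(3) by simp
  then show False using max[OF inb[of t i]] t by simp
qed

lemma u_le: "x \<in> closure \<Omega> \<Longrightarrow> u x \<le> c"
proof -
  assume x: "x \<in> closure \<Omega>"
  have "continuous_on (closure \<Omega>) u"
    using Ck_on_continuous[OF u_smooth[of 0]] V(2) continuous_on_subset by blast
  moreover have "compact (closure \<Omega>)" "closure \<Omega> \<noteq> {}" using \<Omega>(3,4) by simp_all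
  ultimately have "\<exists>m\<in>closure \<Omega>. \<forall>y\<in>closure \<Omega>. u y \<le> u m" by (intro continuous_attains_sup)
  then obtain m where m: "m \<in> closure \<Omega>" "\<And>y. y \<in> closure \<Omega> \<Longrightarrow> u y \<le> u m" by blast
  have "m \<notin> \<Omega>" using no_interior_maximum[of m] m(2) closure_subset by blast
  then have "u m = c" using m(1) u_boundary \<Omega>(1) by (auto simp: frontier_def interior_open)
  then show ?thesis using m(2)[OF x] by simp
qed

text \<open>The tangential derivatives of \<open>u\<close> vanish because \<open>u\<close> is constant on the boundary. The sign comes from
  \<open>u \<le> c\<close> along the inward normal ray.\<close>

lemma grad_u_boundary:
  assumes x: "x \<in> S"
  shows "grad u x = (grad u x \<bullet> N x) *\<^sub>R N x" "grad u x \<bullet> N x \<ge> 0"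
proof -
  have xV: "x \<in> V" using S_subset x by blast
  define \<tau> where "\<tau> = grad u x - (grad u x \<bullet> N x) *\<^sub>R N x"
  have \<tau>N: "\<tau> \<bullet> N x = 0" using N_N[OF x] by (simp add: \<tau>_def inner_diff_left)
  have "((\<lambda>y. c) has_derivative (\<lambda>h. 0)) (at x within S)" by simp
  from tangential_derivative_unique[OF \<Omega>(5) x _ u_has_derivative[OF xV] this u_boundary, of \<tau>]
  have "grad u x \<bullet> \<tau> = 0" using \<tau>N N_normal[OF x] by simp
  then have "\<tau> \<bullet> \<tau> = 0" using \<tau>N by (simp add: \<tau>_def inner_diff_left inner_commute)
  then show "grad u x = (grad u x \<bullet> N x) *\<^sub>R N x" by (simp add: \<tau>_def)
  show "grad u x \<bullet> N x \<ge> 0"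
  proof (rule ccontr)
    assume neg: "\<not> grad u x \<bullet> N x \<ge> 0"
    have "u differentiable (at (x + 0 *\<^sub>R (- N x)))"
      using u_has_derivative[OF xV, of UNIV] by (auto simp: differentiable_def)
    from partial_deriv_has_real_derivative[OF this]
    have "((\<lambda>t. u (x + t *\<^sub>R (- N x))) has_real_derivative - (grad u x \<bullet> N x)) (at 0)" by simp
    from DERIV_pos_inc_right[OF this] neg obtain e where e: "e > 0"
      "\<And>h. h > 0 \<Longrightarrow> h < e \<Longrightarrow> u (x + h *\<^sub>R (- N x)) > u x" by auto
    obtain r i s \<gamma> where ch: "chart \<Omega> x r i s \<gamma>" using \<Omega>(5) x unfolding charted_def by blast
    have xb: "x \<in> ball x r" using chartD(2)[OF ch] by simp
    have Nc: "N x = chart_normal i s \<gamma> x" using outer_normal_chart[OF ch xb x] N_normal[OF x] by simp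
    have "\<forall>\<^sub>F t in at_right 0. x - t *\<^sub>R N x \<in> \<Omega>"
      using chart_normal_cross[OF ch xb] chart_frontier_iff[OF ch xb] x unfolding Nc
      by (auto elim!: eventually_mono)
    moreover have "\<forall>\<^sub>F t in at_right 0. 0 < t \<and> t < e"
      using e(1) by (intro eventually_at_rightI[of 0 e]) auto
    ultimately have "\<forall>\<^sub>F t in at_right (0::real). False"
    proof eventually_elim
      case (elim t)
      have "x - t *\<^sub>R N x \<in> closure \<Omega>" using elim(1) closure_subset by blast
      from u_le[OF this] have "u (x - t *\<^sub>R N x) \<le> u x" using u_boundary[OF x] by simp
      then show ?case using e(2)[of t] elim(2) by simp
    qed
    then show False by simp
  qed
qed

lemma v_boundary:
  assumes x: "x \<in> S"
  shows "v x = q x *\<^sub>R N x" "norm (grad u x) / w x = q x"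
proof -
  have qx: "q x = (grad u x \<bullet> N x) / w x" by (simp add: q_def v_def)
  show "v x = q x *\<^sub>R N x"
    unfolding qx v_def by (subst grad_u_boundary(1)[OF x]) simp
  have "norm (grad u x) = \<bar>grad u x \<bullet> N x\<bar>"
    using grad_u_boundary(1)[OF x] norm_N[OF x] by (metis mult.right_neutral norm_scaleR)
  then show "norm (grad u x) / w x = q x" using grad_u_boundary(2)[OF x] qx by simp
qed

lemma gauss:
  assumes "\<And>j. Ck_on 1 V (\<lambda>x. F x $ j)"
  shows "(LINT x:\<Omega>|lborel. divergence F x) = (LINT x:S|\<sigma>. F x \<bullet> N x)"
  by (rule divergence_theorem[OF \<Omega>(1,5,4) V assms continuous_N N_normal])

lemma integrable_S:
  fixes f :: "real^'n \<Rightarrow> real"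
  shows "continuous_on S f \<Longrightarrow> set_integrable \<sigma> S f"
  by (rule integrable_surface_measure[OF \<Omega>(5,4)])

lemma integrable_\<Omega>:
  fixes f :: "real^'n \<Rightarrow> real"
  assumes "continuous_on V f"
  shows "set_integrable lborel \<Omega> f"
proof -
  have "compact (closure \<Omega>)" using \<Omega>(4) by (simp add: compact_closure)
  moreover have "continuous_on (closure \<Omega>) f" using assms V(2) continuous_on_subset by blast
  ultimately have "set_integrable lborel (closure \<Omega>) f"
    unfolding set_integrable_def by (rule borel_integrable_compact)
  then show ?thesis by (rule set_integrable_subset) (use \<Omega>(1) closure_subset in auto)
qed

lemma const_integrals:
  "(LINT x:\<Omega>|lborel. k) = k * measure lborel \<Omega>" "(LINT x:S|\<sigma>. k) = k * measure \<sigma> S"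
proof -
  have "emeasure lborel \<Omega> < \<infinity>" using \<Omega>(4) by (rule emeasure_bounded_finite)
  then show "(LINT x:\<Omega>|lborel. k) = k * measure lborel \<Omega>"
    using \<Omega>(1) by (simp add: set_lebesgue_integral_def)
  have "emeasure \<sigma> S \<le> emeasure \<sigma> UNIV" using \<Omega> by (intro emeasure_mono) auto
  also have "\<dots> < \<infinity>" by (rule surface_measure_is_surface_measure(2)[OF \<Omega>(5,4)])
  finally show "(LINT x:S|\<sigma>. k) = k * measure \<sigma> S"
    using \<Omega> by (simp add: set_lebesgue_integral_def)
qed

lemma volume_pos: "measure lborel \<Omega> > 0"
proof -
  have "\<not> negligible \<Omega>" using open_not_negligible[OF \<Omega>(1,3)] .
  then have "\<Omega> \<notin> null_sets lborel" using \<Omega>(1) by (auto simp: negligible_iff_null_sets null_sets_completionI)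
  then have "emeasure lborel \<Omega> \<noteq> 0" using \<Omega>(1) by (auto simp: null_sets_def)
  moreover have "emeasure lborel \<Omega> < \<infinity>" using \<Omega>(4) by (rule emeasure_bounded_finite)
  ultimately show ?thesis by (simp add: measure_def enn2real_positive_iff zero_less_iff_neq_zero)
qed

lemma mean_curvature_boundary: "x \<in> S \<Longrightarrow> H x = (divergence N x - N x \<bullet> jac N x (N x)) / (n - 1)"
  by (rule mean_curvature_eq[OF \<Omega>(5) _ N1 N_normal, folded n_eq])

lemma continuous_H: "continuous_on S H"
proof -
  have "Ck_on 1 UNIV (divergence N)" "\<And>j. Ck_on 1 UNIV (\<lambda>x. jac N x (N x) $ j)"
    using N_smooth N1 by (auto intro!: Ck_on_divergence Ck_on_jac simp: numeral_2_eq_2 simp del: Ck_on.simps jac_nth)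
  note C = this[THEN Ck_on_continuous]
  have "continuous_on UNIV (\<lambda>x. \<chi> j. jac N x (N x) $ j)" by (rule continuous_on_vec_lambda) (rule C(2))
  then have "continuous_on UNIV (divergence N)" "continuous_on UNIV (\<lambda>x. jac N x (N x))"
    using C(1) by (simp_all only: vec_nth_inverse vec_lambda_eta)
  then have "continuous_on UNIV (\<lambda>x. (divergence N x - N x \<bullet> jac N x (N x)) / (n - 1))"
    using n2 by (intro continuous_intros continuous_N) auto
  then have "continuous_on S (\<lambda>x. (divergence N x - N x \<bullet> jac N x (N x)) / (n - 1))"
    using continuous_on_subset by blast
  then show ?thesis using mean_curvature_boundary by (subst continuous_on_cong[OF refl]) auto
qed

lemma continuous_q: "continuous_on S q"
  unfolding q_def[abs_def] using continuous_on_subset[OF continuous_v S_subset(1)]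
  by (intro continuous_intros continuous_N)

lemma flux: "(LINT x:S|\<sigma>. q x) = n * measure lborel \<Omega>"
proof -
  have "(LINT x:S|\<sigma>. q x) = (LINT x:\<Omega>|lborel. divergence v x)"
    unfolding q_def by (rule gauss[symmetric, OF Ck_v])
  also have "\<dots> = (LINT x:\<Omega>|lborel. n)"
    by (rule set_lebesgue_integral_cong) (use \<Omega>(1) trace_shape_interior trace_shape in auto)
  finally show ?thesis by (simp add: const_integrals)
qed

text \<open>The divergence identity for \<open>X = Y = v\<close>.\<close>

lemma curvature_flux:
  "(LINT x:\<Omega>|lborel. n\<^sup>2 - tr2 x) = (n - 1) * (LINT x:S|\<sigma>. H x * (q x)\<^sup>2)"
proof -
  let ?F = "\<lambda>y. divergence v y *\<^sub>R v y - jac v y (v y)"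
  have F: "\<And>j. Ck_on 1 V (\<lambda>x. ?F x $ j)"
    by (rule Ck_on_newton_field[OF V(1) Ck_v Ck_v])
  have "(LINT x:\<Omega>|lborel. n\<^sup>2 - tr2 x) = (LINT x:\<Omega>|lborel. divergence ?F x)"
  proof (rule set_lebesgue_integral_cong)
    show "\<forall>x. x \<in> \<Omega> \<longrightarrow> n\<^sup>2 - tr2 x = divergence ?F x"
    proof (intro allI impI)
      fix x assume x: "x \<in> \<Omega>"
      then have "x \<in> V" using S_subset by blast
      from divergence_newton_field[OF V(1) this Ck_v Ck_v]
      show "n\<^sup>2 - tr2 x = divergence ?F x"
        using trace_shape_interior[OF x] by (simp add: trace_shape tr2_eq power2_eq_square)
    qed
  qed (use \<Omega>(1) in auto)
  also have "\<dots> = (LINT x:S|\<sigma>. ?F x \<bullet> N x)" by (rule gauss[OF F])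
  also have "\<dots> = (LINT x:S|\<sigma>. (n - 1) * (H x * (q x)\<^sup>2))"
  proof (rule set_lebesgue_integral_cong)
    show "\<forall>x. x \<in> S \<longrightarrow> ?F x \<bullet> N x = (n - 1) * (H x * (q x)\<^sup>2)"
    proof (intro allI impI)
      fix x assume x: "x \<in> S"
      have "jac v x (v x) = q x *\<^sub>R jac v x (N x)"
        by (subst v_boundary(1)[OF x]) (rule linear_scale[OF linear_jac])
      then have "?F x \<bullet> N x = q x * (divergence v x - N x \<bullet> jac v x (N x))"
        by (simp add: inner_diff_left inner_commute[of "N x" "jac v x (N x)"] right_diff_distrib q_def
            del: jac_nth)
      also have "divergence v x - N x \<bullet> jac v x (N x) = (v x \<bullet> N x) * ((n - 1) * H x)"
        by (rule tangential_divergence_normal_field[OF card \<Omega>(5) x N1 N_normal Ck_v V(1) S_subset(1), folded n_eq])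
           (use v_boundary(1) in \<open>simp_all add: q_def\<close>)
      finally show "?F x \<bullet> N x = (n - 1) * (H x * (q x)\<^sup>2)"
        by (simp add: q_def power2_eq_square)
    qed
  qed (use \<Omega> in \<open>auto simp: borel_closed\<close>)
  also have "\<dots> = (n - 1) * (LINT x:S|\<sigma>. H x * (q x)\<^sup>2)" by simp
  finally show ?thesis .
qed

lemma divergence_ident:
  fixes x :: "real^'n"
  shows "divergence (\<lambda>x. x) x = n"
proof -
  have "partial_deriv i (\<lambda>y. y $ i) x = 1" for i :: 'n
    using partial_deriv_eq[OF bounded_linear_imp_has_derivative[OF bounded_linear_vec_nth[of i]], where x=x and i=i]
    by (simp add: axis_def)
  then show ?thesis by (simp add: divergence_def n_eq)
qed

lemma Ck_ident: "Ck_on k V (\<lambda>x. x $ j)"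
  by (rule Ck_on_nth[OF V(1)])

lemma position_flux: "(LINT x:S|\<sigma>. x \<bullet> N x) = n * measure lborel \<Omega>"
  using gauss[OF Ck_ident] by (simp add: divergence_ident const_integrals)

text \<open>Otherwise the flux of the position field would vanish.\<close>

lemma area_pos: "measure \<sigma> S > 0"
proof (rule ccontr)
  assume "\<not> measure \<sigma> S > 0"
  then have "measure \<sigma> S = 0" by (simp add: not_less measure_le_0_iff)
  moreover have "emeasure \<sigma> S < \<infinity>"
    using surface_measure_is_surface_measure(2)[OF \<Omega>(5,4)] \<Omega>
    by (intro le_less_trans[OF emeasure_mono[of S UNIV]]) auto
  ultimately have "emeasure \<sigma> S = 0" by (simp add: emeasure_eq_ennreal_measure)
  then have "S \<in> null_sets \<sigma>" using \<Omega> by (auto simp: null_sets_def borel_closed)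
  then have "(LINT x:S|\<sigma>. x \<bullet> N x) = 0"
    unfolding set_lebesgue_integral_def
    by (intro integral_eq_zero_AE) (auto dest!: AE_not_in elim!: eventually_mono)
  then show False using position_flux volume_pos n2 by simp
qed

text \<open>Minkowski's formula is the divergence identity for \<open>X = x\<close> and an extension \<open>Y\<close> of the normal.\<close>

lemma minkowski: "measure \<sigma> S = (LINT x:S|\<sigma>. (x \<bullet> N x) * H x)"
proof -
  let ?F = "\<lambda>y. divergence N y *\<^sub>R y - jac N y y"
  have N2: "\<And>j. Ck_on 2 V (\<lambda>x. N x $ j)" "\<And>j. Ck_on 1 V (\<lambda>x. N x $ j)"
    using N_smooth N1 Ck_on_subset by blast+
  have F: "\<And>j. Ck_on 1 V (\<lambda>x. ?F x $ j)"
    using Ck_on_newton_field[OF V(1) _ Ck_ident, of 1 N] N2 by (simp add: numeral_2_eq_2)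
  have "(n - 1) * measure \<sigma> S = (n - 1) * (LINT x:S|\<sigma>. N x \<bullet> N x)"
    using set_lebesgue_integral_cong[of S \<sigma> "\<lambda>x. N x \<bullet> N x" "\<lambda>x. 1"] N_N \<Omega> by (simp add: const_integrals borel_closed)
  also have "\<dots> = (LINT x:\<Omega>|lborel. (n - 1) * divergence N x)"
    using gauss[OF N2(2)] by simp
  also have "\<dots> = (LINT x:\<Omega>|lborel. divergence ?F x)"
  proof (rule set_lebesgue_integral_cong)
    show "\<forall>x. x \<in> \<Omega> \<longrightarrow> (n - 1) * divergence N x = divergence ?F x"
    proof (intro allI impI)
      fix x assume "x \<in> \<Omega>"
      then have x: "x \<in> V" using S_subset by blast
      have "partial_deriv i (\<lambda>y. y $ k) x = (if k = i then 1 else 0)" for i k :: 'n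
        using partial_deriv_eq[OF bounded_linear_imp_has_derivative[OF bounded_linear_vec_nth[of k]], where x=x and i=i]
        by (simp add: axis_def)
      then have "(\<Sum>i\<in>UNIV. \<Sum>k\<in>UNIV. partial_deriv i (\<lambda>y. y $ k) x * partial_deriv k (\<lambda>y. N y $ i) x)
         = (\<Sum>i\<in>UNIV. \<Sum>k\<in>UNIV. if k = i then partial_deriv k (\<lambda>y. N y $ i) x else 0)"
        by (intro sum.cong) auto
      then show "(n - 1) * divergence N x = divergence ?F x"
        unfolding divergence_newton_field[OF V(1) x Ck_ident N2(1)]
        by (simp add: divergence_ident divergence_def[of N] left_diff_distrib)
    qed
  qed (use \<Omega>(1) in auto)
  also have "\<dots> = (LINT x:S|\<sigma>. ?F x \<bullet> N x)" by (rule gauss[OF F])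
  also have "\<dots> = (LINT x:S|\<sigma>. (n - 1) * ((x \<bullet> N x) * H x))"
  proof (rule set_lebesgue_integral_cong)
    show "\<forall>x. x \<in> S \<longrightarrow> ?F x \<bullet> N x = (n - 1) * ((x \<bullet> N x) * H x)"
    proof (intro allI impI)
      fix x assume x: "x \<in> S"
      define \<tau> where "\<tau> = x - (x \<bullet> N x) *\<^sub>R N x"
      have \<tau>0: "\<tau> \<bullet> outer_normal \<Omega> x = 0"
        using N_N[OF x] N_normal[OF x] by (simp add: \<tau>_def inner_diff_left)
      have t: "N x \<bullet> jac N x \<tau> = 0"
        by (rule jac_unit_normal_tangential[OF \<Omega>(5) x]) (rule N1 N_normal \<tau>0, assumption?)+
      have "jac N x x = jac N x (\<tau> + (x \<bullet> N x) *\<^sub>R N x)" by (simp add: \<tau>_def)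
      also have "\<dots> = jac N x \<tau> + (x \<bullet> N x) *\<^sub>R jac N x (N x)"
        using linear_jac by (metis linear_add linear_scale)
      finally have J: "N x \<bullet> jac N x x = (x \<bullet> N x) * (N x \<bullet> jac N x (N x))" using t by (simp add: inner_add_right)
      have "?F x \<bullet> N x = divergence N x * (x \<bullet> N x) - N x \<bullet> jac N x x"
        by (simp add: inner_diff_left inner_commute[of "N x" "jac N x x"] del: jac_nth)
      also have "\<dots> = (x \<bullet> N x) * (divergence N x - N x \<bullet> jac N x (N x))"
        unfolding J by (simp add: right_diff_distrib mult.commute)
      also have "divergence N x - N x \<bullet> jac N x (N x) = (n - 1) * H x"
        using mean_curvature_boundary[OF x] n2 by simp
      finally show "?F x \<bullet> N x = (n - 1) * ((x \<bullet> N x) * H x)" by (simp add: mult.left_commute)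
    qed
  qed (use \<Omega> in \<open>auto simp: borel_closed\<close>)
  also have "\<dots> = (n - 1) * (LINT x:S|\<sigma>. (x \<bullet> N x) * H x)" by simp
  finally show ?thesis using n2 by simp
qed

text \<open>Equality in the trace inequality makes \<open>v\<close> a translation of the identity, so that the graph is a
  piece of a hyperboloid and \<open>u\<close> is a function of the distance to a point.\<close>

lemma ball_of_tr2_eq:
  assumes "\<And>x. x \<in> \<Omega> \<Longrightarrow> tr2 x = n"
  shows "\<exists>a r. r > 0 \<and> \<Omega> = ball a r"
proof -
  have I: "partial_deriv i (\<lambda>y. v y $ j) x = (if i = j then 1 else 0)" if "x \<in> \<Omega>" for x i j
    using shape_matrix_eq_id[OF that assms[OF that]] by (simp add: shape_matrix_nth[symmetric] mat_def)
  have xV: "x \<in> V" if "x \<in> \<Omega>" for x using S_subset that by blast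
  have "(\<lambda>x. v x - x) constant_on \<Omega>"
  proof (rule has_derivative_zero_connected_constant_on[OF \<Omega>(2,1) finite.emptyI])
    have "continuous_on \<Omega> v" using continuous_v S_subset(2) continuous_on_subset by blast
    then show "continuous_on \<Omega> (\<lambda>x. v x - x)" by (intro continuous_intros)
    show "\<forall>x\<in>\<Omega> - {}. ((\<lambda>x. v x - x) has_derivative (\<lambda>h. 0)) (at x within \<Omega>)"
    proof
      fix x assume "x \<in> \<Omega> - {}"
      then have x: "x \<in> \<Omega>" by simp
      have "jac v x h = h" for h
        using I[OF x] by (simp add: vec_eq_iff jac_eq_sum if_distrib[of "\<lambda>a. a * _"] del: jac_nth cong: if_cong)
      then have jv: "jac v x = (\<lambda>h. h)" by (rule ext)
      have "(v has_derivative (\<lambda>h. h)) (at x within \<Omega>)"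
        using has_derivative_jac[OF Ck_v[of "Suc 0"] V(1) xV[OF x], of \<Omega>] unfolding jv .
      from has_derivative_diff[OF this has_derivative_ident]
      show "((\<lambda>x. v x - x) has_derivative (\<lambda>h. 0)) (at x within \<Omega>)" by simp
    qed
  qed
  then obtain b where b: "\<And>x. x \<in> \<Omega> \<Longrightarrow> v x - x = b" unfolding constant_on_def by blast
  define a where "a = - b"
  have va: "v x = x - a" if "x \<in> \<Omega>" for x using b[OF that] by (simp add: a_def algebra_simps)
  define \<phi> where "\<phi> x = sqrt (1 + (x - a) \<bullet> (x - a))" for x
  have pos: "1 + (x - a) \<bullet> (x - a) > 0" for x by (simp add: add_pos_nonneg)
  have c\<phi>: "continuous_on X \<phi>" for X unfolding \<phi>_def by (intro continuous_intros)
  have cu: "continuous_on (closure \<Omega>) u"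
    using Ck_on_continuous[OF u_smooth[of 0]] V(2) continuous_on_subset by blast
  have "(\<lambda>x. u x - \<phi> x) constant_on \<Omega>"
  proof (rule has_derivative_zero_connected_constant_on[OF \<Omega>(2,1) finite.emptyI])
    show "continuous_on \<Omega> (\<lambda>x. u x - \<phi> x)"
      using continuous_on_subset[OF cu closure_subset] by (intro continuous_intros c\<phi>)
    show "\<forall>x\<in>\<Omega> - {}. ((\<lambda>x. u x - \<phi> x) has_derivative (\<lambda>h. 0)) (at x within \<Omega>)"
    proof
      fix x assume "x \<in> \<Omega> - {}"
      then have x: "x \<in> \<Omega>" by simp
      note W = w_pos[OF xV[OF x]]
      have g: "grad u x = w x *\<^sub>R (x - a)" using va[OF x] W(1) by (simp add: v_def field_simps flip: va[OF x])
      have "(w x)\<^sup>2 * (1 + (x - a) \<bullet> (x - a)) = 1"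
        using W(2) by (simp add: g power2_eq_square algebra_simps)
      then have "w x * \<phi> x = 1"
        unfolding \<phi>_def using W(1) by (metis abs_of_pos real_sqrt_abs real_sqrt_mult real_sqrt_one)
      then have w\<phi>: "w x = 1 / \<phi> x" by (metis mult_zero_right nonzero_eq_divide_eq zero_neq_one)
      have "(\<phi> has_derivative (\<lambda>h. inverse (\<phi> x) * ((x - a) \<bullet> h))) (at x within \<Omega>)"
        unfolding \<phi>_def using pos[of x]
        by (auto intro!: derivative_eq_intros simp: fun_eq_iff inner_commute field_simps)
      from has_derivative_diff[OF u_has_derivative[OF xV[OF x]] this]
      show "((\<lambda>x. u x - \<phi> x) has_derivative (\<lambda>h. 0)) (at x within \<Omega>)"
        by (simp add: g w\<phi> divide_inverse)
    qed
  qed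
  then obtain k where k: "\<And>x. x \<in> \<Omega> \<Longrightarrow> u x - \<phi> x = k" unfolding constant_on_def by blast
  have "u x - \<phi> x = k" if "x \<in> closure \<Omega>" for x
    by (rule continuous_constant_on_closure[of \<Omega> "\<lambda>x. u x - \<phi> x"])
       (use k that cu in \<open>auto intro!: continuous_intros c\<phi>\<close>)
  then have \<phi>S: "\<phi> x = c - k" if "x \<in> S" for x
    using u_boundary[OF that] S_subset(3) that by (smt (verit) subsetD)
  have "S \<noteq> {}" using \<Omega> frontier_eq_empty not_bounded_UNIV by metis
  then obtain p where p: "p \<in> S" by blast
  have "S \<subseteq> sphere a (norm (p - a))"
  proof
    fix x assume "x \<in> S"
    then have "\<phi> x = \<phi> p" using \<phi>S p by simp
    then have "norm (x - a) = norm (p - a)" by (simp add: \<phi>_def norm_eq)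
    then show "x \<in> sphere a (norm (p - a))" by (simp add: dist_norm norm_minus_commute)
  qed
  from domain_bounded_by_sphere_is_ball[OF _ \<Omega>(1,4,3) this]
  have "norm (p - a) > 0 \<and> \<Omega> = ball a (norm (p - a))" using card by simp
  then show ?thesis by blast
qed

definition R0 :: real where "R0 = n * measure lborel \<Omega> / measure \<sigma> S"

lemma R0_pos: "R0 > 0"
  using volume_pos area_pos n2 by (simp add: R0_def)

lemma deficit_eq:
  "(LINT x:\<Omega>|lborel. tr2 x - n) = (n - 1) * (n * measure lborel \<Omega> - (LINT x:S|\<sigma>. H x * (q x)\<^sup>2))"
proof -
  have c: "continuous_on V tr2" using Ck_on_continuous[OF Ck_tr2] .
  have i1: "set_integrable lborel \<Omega> (\<lambda>x. n * (n - 1))" and i2: "set_integrable lborel \<Omega> (\<lambda>x. n\<^sup>2 - tr2 x)"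
    by (intro integrable_\<Omega> continuous_intros c)+
  have "(LINT x:\<Omega>|lborel. tr2 x - n) = (LINT x:\<Omega>|lborel. n * (n - 1) - (n\<^sup>2 - tr2 x))"
    by (simp add: power2_eq_square right_diff_distrib)
  also have "\<dots> = n * (n - 1) * measure lborel \<Omega> - (n - 1) * (LINT x:S|\<sigma>. H x * (q x)\<^sup>2)"
    unfolding set_integral_diff(2)[OF i1 i2] const_integrals curvature_flux ..
  finally show ?thesis by (simp add: algebra_simps)
qed

text \<open>Expand the square and use \<open>R0 |\<partial>\<Omega>| = n |\<Omega>|\<close>, which is also the flux of \<open>v\<close>.\<close>

lemma integral_identity:
  "1 / (n - 1) * (LINT x:\<Omega>|lborel. tr2 x - n) + 1 / R0 * (LINT x:S|\<sigma>. (q x - R0)\<^sup>2)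
    = (LINT x:S|\<sigma>. (1 / R0 - H x) * (q x)\<^sup>2)"
proof -
  define Q where "Q = (LINT x:S|\<sigma>. (q x)\<^sup>2)"
  define K where "K = (LINT x:S|\<sigma>. H x * (q x)\<^sup>2)"
  define vol where "vol = measure lborel \<Omega>"
  have i: "set_integrable \<sigma> S (\<lambda>x. (q x)\<^sup>2)" "set_integrable \<sigma> S (\<lambda>x. 2 * R0 * q x)" "set_integrable \<sigma> S (\<lambda>x. R0\<^sup>2)"
    "set_integrable \<sigma> S (\<lambda>x. H x * (q x)\<^sup>2)" "set_integrable \<sigma> S (\<lambda>x. 1 / R0 * (q x)\<^sup>2)"
    by (intro integrable_S continuous_intros continuous_q continuous_H)+
  have "(LINT x:S|\<sigma>. (q x - R0)\<^sup>2) = (LINT x:S|\<sigma>. ((q x)\<^sup>2 - 2 * R0 * q x) + R0\<^sup>2)"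
    by (simp add: power2_diff algebra_simps)
  also have "\<dots> = Q - 2 * R0 * (n * vol) + R0\<^sup>2 * measure \<sigma> S"
    unfolding set_integral_add(2)[OF set_integral_diff(1)[OF i(1,2)] i(3)] set_integral_diff(2)[OF i(1,2)]
      const_integrals by (simp add: flux Q_def vol_def)
  also have "R0\<^sup>2 * measure \<sigma> S = R0 * (n * vol)"
    using area_pos by (simp add: R0_def vol_def power2_eq_square)
  finally have 1: "(LINT x:S|\<sigma>. (q x - R0)\<^sup>2) = Q - R0 * (n * vol)" by simp
  have "(LINT x:S|\<sigma>. (1 / R0 - H x) * (q x)\<^sup>2) = (LINT x:S|\<sigma>. 1 / R0 * (q x)\<^sup>2 - H x * (q x)\<^sup>2)"
    by (simp add: left_diff_distrib)
  also have "\<dots> = Q / R0 - K" unfolding set_integral_diff(2)[OF i(5,4)] by (simp add: Q_def K_def)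
  finally have 2: "(LINT x:S|\<sigma>. (1 / R0 - H x) * (q x)\<^sup>2) = Q / R0 - K" .
  have 3: "(LINT x:\<Omega>|lborel. tr2 x - n) = (n - 1) * (n * vol - K)" using deficit_eq by (simp add: K_def vol_def)
  show ?thesis unfolding 1 2 3 using n2 R0_pos by (simp add: field_simps)
qed

lemma ball_of_mean_curvature_ge:
  assumes "\<And>x. x \<in> S \<Longrightarrow> H x \<ge> 1 / R0"
  shows "\<exists>a r. r > 0 \<and> \<Omega> = ball a r"
proof -
  have "0 \<le> (\<integral>x. - (indicator S x *\<^sub>R ((1 / R0 - H x) * (q x)\<^sup>2)) \<partial>\<sigma>)"
    using assms by (intro Bochner_Integration.integral_nonneg) (auto simp: indicator_def mult_nonpos_nonneg)
  then have "(LINT x:S|\<sigma>. (1 / R0 - H x) * (q x)\<^sup>2) \<le> 0"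
    unfolding set_lebesgue_integral_def by simp
  moreover have "(LINT x:S|\<sigma>. (q x - R0)\<^sup>2) \<ge> 0"
    unfolding set_lebesgue_integral_def by (intro Bochner_Integration.integral_nonneg) auto
  then have "1 / R0 * (LINT x:S|\<sigma>. (q x - R0)\<^sup>2) \<ge> 0" using R0_pos by simp
  ultimately have "1 / (n - 1) * (LINT x:\<Omega>|lborel. tr2 x - n) \<le> 0" using integral_identity by linarith
  then have le: "(LINT x:\<Omega>|lborel. tr2 x - n) \<le> 0" using n2 by (simp add: field_simps)
  have c: "continuous_on V (\<lambda>x. tr2 x - n)" using Ck_on_continuous[OF Ck_tr2] by (intro continuous_intros)
  have "tr2 x - n = 0" if "x \<in> \<Omega>" for x
    by (rule continuous_nonneg_integral_zero[OF \<Omega>(1) continuous_on_subset[OF c S_subset(2)] _ integrable_\<Omega>[OF c] le that])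
       (use tr2_ge in auto)
  then show ?thesis by (intro ball_of_tr2_eq) auto
qed

text \<open>Minkowski's formula determines the constant.\<close>

lemma ball_of_mean_curvature_const:
  assumes "\<And>x. x \<in> S \<Longrightarrow> H x = k"
  shows "\<exists>a r. r > 0 \<and> \<Omega> = ball a r"
proof -
  have "measure \<sigma> S = (LINT x:S|\<sigma>. (x \<bullet> N x) * k)"
    unfolding minkowski
    by (rule set_lebesgue_integral_cong) (use assms \<Omega> in \<open>auto simp: borel_closed\<close>)
  also have "\<dots> = n * measure lborel \<Omega> * k" by (simp add: position_flux)
  finally have "1 / R0 = k" using volume_pos n2 by (simp add: R0_def field_simps)
  then show ?thesis using assms by (intro ball_of_mean_curvature_ge) simp
qed

end


theorem theorem5p1:
  fixes \<Omega> :: "(real^'n) set" and u :: "real^'n \<Rightarrow> real" and c :: real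
  defines "n \<equiv> real CARD('n)"
  defines "\<sigma> \<equiv> surface_measure (frontier \<Omega>)"
  defines "R0 \<equiv> n * measure lebesgue \<Omega> / measure \<sigma> (frontier \<Omega>)"
  defines "H0 \<equiv> 1 / R0"
  defines "S1 \<equiv> \<lambda>x. eig_sym 1 (shape_matrix u x)"
  defines "S2 \<equiv> \<lambda>x. eig_sym 2 (shape_matrix u x)"
  defines "H \<equiv> mean_curvature \<Omega>"
  assumes n_ge_2: "CARD('n) \<ge> 2"
    and domain: "bounded_smooth_domain \<Omega>"
    and smooth: "smooth_on (closure \<Omega>) u"
    and spacelike: "\<forall>x\<in>closure \<Omega>. norm (grad u x) < 1"
    and pde: "\<forall>x\<in>\<Omega>. divergence (\<lambda>y. (1 / w_fun u y) *\<^sub>R grad u y) x = n"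
    and boundary: "\<forall>x\<in>frontier \<Omega>. u x = c"
  shows "1 / (n - 1) * (LINT x:\<Omega>|lebesgue. ((n - 1) / n * (S1 x)\<^sup>2 - 2 * S2 x))
         + 1 / R0 * (LINT x:frontier \<Omega>|\<sigma>. (norm (grad u x) / w_fun u x - R0)\<^sup>2)
       = (LINT x:frontier \<Omega>|\<sigma>. (H0 - H x) * (norm (grad u x) / w_fun u x)\<^sup>2)
    \<and> ((\<forall>x\<in>frontier \<Omega>. H x \<ge> H0) \<longrightarrow> (\<exists>a r. r > 0 \<and> \<Omega> = ball a r))
    \<and> ((\<exists>k. \<forall>x\<in>frontier \<Omega>. H x = k) \<longrightarrow> (\<exists>a r. r > 0 \<and> \<Omega> = ball a r))"
proof -
  have \<Omega>: "open \<Omega>" "connected \<Omega>" "\<Omega> \<noteq> {}" "bounded \<Omega>" "charted \<Omega>"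
    using domain bounded_smooth_domain_charted[OF domain] by (auto simp: bounded_smooth_domain_def)
  obtain U where U: "open U" "closure \<Omega> \<subseteq> U" "\<And>k. Ck_on k U u"
    using smooth unfolding smooth_on_def by blast
  define V where "V = U \<inter> grad u -` ball 0 1"
  have "continuous_on U (partial_deriv i u)" for i using U(3)[of 1] by simp
  then have "continuous_on U (grad u)" unfolding grad_def by (intro continuous_on_vec_lambda)
  then have V: "open V" "closure \<Omega> \<subseteq> V"
    using U spacelike unfolding V_def by (auto intro!: continuous_open_preimage)
  obtain N :: "real^'n \<Rightarrow> real^'n" where N: "\<And>j. Ck_on 2 UNIV (\<lambda>x. N x $ j)"
    "\<And>x. x \<in> frontier \<Omega> \<Longrightarrow> N x = outer_normal \<Omega> x"
    using normal_extension[OF \<Omega>(5,4), of 2] by metis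
  interpret G: cmc_graph \<Omega> u c V N n
  proof
    show "Ck_on k V u" for k using U(3) by (rule Ck_on_subset) (simp add: V_def)
    show "norm (grad u x) < 1" if "x \<in> V" for x using that by (simp add: V_def)
  qed (use n_def n_ge_2 \<Omega> V pde boundary N in auto)
  have \<Omega>b: "\<Omega> \<in> sets borel" using \<Omega>(1) by simp
  have R0: "R0 = G.R0"
    using \<Omega>b by (simp add: R0_def G.R0_def \<sigma>_def measure_completion)
  have int: "integrable lborel (\<lambda>x. indicator \<Omega> x *\<^sub>R (G.tr2 x - n))"
    using Ck_on_continuous[OF G.Ck_tr2] unfolding set_integrable_def[symmetric]
    by (intro G.integrable_\<Omega> continuous_intros)
  have "(LINT x:\<Omega>|lebesgue. ((n - 1) / n * (S1 x)\<^sup>2 - 2 * S2 x)) = (LINT x:\<Omega>|lebesgue. G.tr2 x - n)"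
  proof (rule set_lebesgue_integral_cong)
    show "\<forall>x. x \<in> \<Omega> \<longrightarrow> (n - 1) / n * (S1 x)\<^sup>2 - 2 * S2 x = G.tr2 x - n"
    proof (intro allI impI)
      fix x assume x: "x \<in> \<Omega>"
      have "S1 x = n" using G.trace_shape_interior[OF x] by (simp add: S1_def eig_sym_1[simplified])
      moreover have "2 * S2 x = n\<^sup>2 - G.tr2 x"
        using G.trace_shape_interior[OF x] by (simp add: S2_def eig_sym_2 G.tr2_def)
      moreover have "(n - 1) / n * n\<^sup>2 = n\<^sup>2 - n"
        using G.n2 by (simp add: power2_eq_square field_simps)
      ultimately show "(n - 1) / n * (S1 x)\<^sup>2 - 2 * S2 x = G.tr2 x - n" by simp
    qed
  qed (use \<Omega>b in simp)
  also have "\<dots> = (LINT x:\<Omega>|lborel. G.tr2 x - n)"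
    unfolding set_lebesgue_integral_def using int by (intro integral_completion) auto
  finally have 1: "(LINT x:\<Omega>|lebesgue. ((n - 1) / n * (S1 x)\<^sup>2 - 2 * S2 x)) = (LINT x:\<Omega>|lborel. G.tr2 x - n)" .
  have Sb: "frontier \<Omega> \<in> sets \<sigma>" unfolding \<sigma>_def using \<Omega> by (simp add: borel_closed)
  have 2: "(LINT x:frontier \<Omega>|\<sigma>. (norm (grad u x) / w_fun u x - R0)\<^sup>2) = (LINT x:frontier \<Omega>|\<sigma>. (G.q x - R0)\<^sup>2)"
    by (rule set_lebesgue_integral_cong[OF Sb]) (simp add: G.v_boundary(2))
  have 3: "(LINT x:frontier \<Omega>|\<sigma>. (H0 - H x) * (norm (grad u x) / w_fun u x)\<^sup>2)
      = (LINT x:frontier \<Omega>|\<sigma>. (H0 - H x) * (G.q x)\<^sup>2)"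
    by (rule set_lebesgue_integral_cong[OF Sb]) (simp add: G.v_boundary(2))
  show ?thesis
    unfolding 1 2 3
    using G.integral_identity G.ball_of_mean_curvature_ge G.ball_of_mean_curvature_const
    unfolding H0_def H_def \<sigma>_def R0 by blast
qed


end
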